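(* Let $\varphi\in\operatorname{LFM}(B_N)$ be parabolic. Then: (1) $\varphi$ is conjugated to a map $\psi:\mathbb{H}^N\to\mathbb{H}^N$ defined by $$\psi(z,u,v,w)=\left(z+2i\langle u,a\rangle+2i\langle w,c\rangle+b,\;u+a,\;Dv,\;Aw\right),$$ where $b\in\mathbb{C}$, $a\in\mathbb{C}^p$, $c\in\mathbb{C}^q$, $D\in\mathbb{C}^{r\times r}$, $A\in\mathbb{C}^{q\times q}$, $1+p+q+r=N$, with (a) $D$ is diagonal and $\sigma(D)\subset\partial\mathbb{D}\setminus\{1\}$; (b) $Q=I-A^HA$ is a Hermitian positive semi-definite matrix; (c) $\operatorname{Im}(b)-|a|^2\ge\langle Q^+c,c\rangle$; (d) $QQ^+c=c$. (2) Suppose $0\notin\sigma(A)$ and $I-A^H$ is invertible. Let $M$ be a matrix with $\exp(M)=A$, and set $$c_t=\left(I-\exp(M)^H\right)^{-1}\left(I-\exp(tM)^H\right)c,\qquad Q_t=I-\exp(tM)^H\exp(tM).$$ If (a) $M$ is dissipative; (b) for any $t\ge0$, $t\left(\operatorname{Im}b-|a|^2\right)\ge\langle Q_t^+c_t,c_t\rangle$; (c) for any $t\ge0$, $Q_tQ_t^+c_t=c_t$, then $\psi$ can be embedded into a semigroup of $\mathbb{H}^N$.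
   Context: $B_N$ is the open unit ball of $\mathbb{C}^N$, $\mathbb{D}$ the open unit disc of $\mathbb{C}$, and $\mathbb{H}^N=\{(u_1,u')\in\mathbb{C}\times\mathbb{C}^{N-1}:\operatorname{Im}u_1>|u'|^2\}$ the Siegel half-plane, biholomorphic to $B_N$. $\langle x,y\rangle=y^Hx$, $^H$ is the conjugate transpose, $\sigma(\cdot)$ the spectrum, $\exp$ the matrix exponential, and $Q^+$ denotes the (Moore-Penrose) pseudo-inverse of $Q$. A square matrix $M$ is dissipative if $\operatorname{Re}(x^HMx)\le0$ for all complex vectors $x$. Coordinates are $(z,u,v,w)\in\mathbb{H}^N\subset\mathbb{C}\times\mathbb{C}^p\times\mathbb{C}^r\times\mathbb{C}^q$; some of the blocks $u,v,w$ may be absent. A holomorphic map is linear fractional if it has the form $z\mapsto \frac{Az+B}{\langle z,C\rangle+D}$ with $A\in\mathbb{C}^{N\times N}$, $B,C\in\mathbb{C}^N$, $D\in\mathbb{C}$; $\operatorname{LFM}(B_N)$ is the set of linear fractional self-maps of $B_N$. If a holomorphic self-map $\varphi$ of $B_N$ has no fixed point in $B_N$, its iterates converge locally uniformly to a unique point $w\in\partial B_N$ (the Denjoy-Wolff point), and $\liminf_{z\to w}\frac{1-|\varphi(z)|^2}{1-|z|^2}=\delta\in(0,1]$ is its boundary dilation coefficient; $\varphi$ is parabolic if it has no fixed point in $B_N$ and $\delta=1$. Holomorphic self-maps $\psi$ of $D$ and $\psi'$ of $D'$ are conjugated if there is a biholomorphic map $\sigma:D\to D'$ with $\psi=\sigma^{-1}\circ\psi'\circ\sigma$.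 A (continuous) semigroup $\{\varphi_t\}_{t\ge0}$ on a domain $D$ is a continuous homomorphism from the additive semigroup of non-negative reals into the composition semigroup of holomorphic self-maps of $D$ with the compact-open topology (so $\varphi_0=\mathrm{id}$, $\varphi_{t+s}=\varphi_t\circ\varphi_s$). A self-map $\varphi$ of $D$ can be embedded into a semigroup on $D$ if there is a semigroup $\{\varphi_t\}$ on $D$ with $\varphi_1=\varphi$. *)

theory Defs
  imports
    "HOL-Analysis.Analysis"
    "Jordan_Normal_Form.Spectral_Radius"
    "Jordan_Normal_Form.Gauss_Jordan_Elimination"
begin

unbundle no inner_syntax
unbundle no vec_syntax
hide_const (open) Finite_Cartesian_Product.vec Finite_Cartesian_Product.mat

notation vec_nth (infixl "$h" 90)
notation vec_lambda (binder "\<chi>" 10)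

text \<open>
  The ambient space of \<open>B\<^sub>N\<close> and of the Siegel half-plane is \<^typ>\<open>complex^'n\<close> with \<open>N = CARD('n) \<ge> 1\<close>.
  The blocks \<open>u\<close>, \<open>v\<close>, \<open>w\<close> may be absent and their sizes are existentially quantified, so they
  and the matrices acting on them are \<^typ>\<open>complex Matrix.vec\<close> and \<^typ>\<open>complex mat\<close>, whose
  dimensions are natural numbers (possibly 0).  The standard inner product \<open>\<langle>x,y\<rangle> = y\<^sup>H x\<close> of
  such vectors is \<open>x \<bullet>c y\<close>.
\<close>

definition holomorphic_map :: "(complex^'n) set \<Rightarrow> (complex^'n \<Rightarrow> complex^'m) \<Rightarrow> bool" where
  "holomorphic_map S f \<longleftrightarrow>
     (\<forall>x\<in>S. \<exists>f'. (f has_derivative f') (at x) \<and> Vector_Spaces.linear (*s) (*s) f')"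

definition holomorphic_self_map :: "(complex^'n) set \<Rightarrow> (complex^'n \<Rightarrow> complex^'n) \<Rightarrow> bool" where
  "holomorphic_self_map S f \<longleftrightarrow> holomorphic_map S f \<and> f ` S \<subseteq> S"

definition biholomorphic_map ::
    "(complex^'n) set \<Rightarrow> (complex^'m) set \<Rightarrow> (complex^'n \<Rightarrow> complex^'m) \<Rightarrow> bool" where
  "biholomorphic_map S T f \<longleftrightarrow>
     bij_betw f S T \<and> holomorphic_map S f \<and> holomorphic_map T (inv_into S f)"

definition conjugated ::
    "(complex^'n) set \<Rightarrow> (complex^'n \<Rightarrow> complex^'n) \<Rightarrow>
     (complex^'m) set \<Rightarrow> (complex^'m \<Rightarrow> complex^'m) \<Rightarrow> bool" where
  "conjugated S f T g \<longleftrightarrow>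
     holomorphic_self_map S f \<and> holomorphic_self_map T g \<and>
     (\<exists>\<sigma>. biholomorphic_map S T \<sigma> \<and> (\<forall>x\<in>S. f x = inv_into S \<sigma> (g (\<sigma> x))))"

text \<open>
  Maps are total functions, and the topology ignores their values outside \<open>S\<close>.  The compact
  set \<open>K = {}\<close> shows that its carrier consists of all holomorphic self-maps of \<open>S\<close>.
\<close>

definition compact_open_topology :: "(complex^'n) set \<Rightarrow> (complex^'n \<Rightarrow> complex^'n) topology" where
  "compact_open_topology S = topology_generated_by
     {{f. holomorphic_self_map S f \<and> f ` K \<subseteq> U} | K U. compact K \<and> K \<subseteq> S \<and> open U}"

definition continuous_semigroup ::
    "(complex^'n) set \<Rightarrow> (real \<Rightarrow> complex^'n \<Rightarrow> complex^'n) \<Rightarrow> bool" where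
  "continuous_semigroup S \<Phi> \<longleftrightarrow>
     continuous_map (top_of_set {0..}) (compact_open_topology S) \<Phi> \<and>
     (\<forall>x\<in>S. \<Phi> 0 x = x) \<and>
     (\<forall>s\<ge>0. \<forall>t\<ge>0. \<forall>x\<in>S. \<Phi> (t + s) x = \<Phi> t (\<Phi> s x))"

definition embeddable_into_semigroup ::
    "(complex^'n) set \<Rightarrow> (complex^'n \<Rightarrow> complex^'n) \<Rightarrow> bool" where
  "embeddable_into_semigroup S f \<longleftrightarrow>
     (\<exists>\<Phi>. continuous_semigroup S \<Phi> \<and> (\<forall>x\<in>S. \<Phi> 1 x = f x))"

abbreviation unit_ball :: "(complex^'n) set" where
  "unit_ball \<equiv> ball 0 1"

definition hprod :: "complex^'n \<Rightarrow> complex^'n \<Rightarrow> complex" where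
  "hprod x y = (\<Sum>i\<in>UNIV. x $h i * cnj (y $h i))"

definition linear_fractional_on :: "(complex^'n) set \<Rightarrow> (complex^'n \<Rightarrow> complex^'n) \<Rightarrow> bool" where
  "linear_fractional_on S f \<longleftrightarrow>
     (\<exists>(A :: complex^'n^'n) B C D. \<forall>z\<in>S.
        hprod z C + D \<noteq> 0 \<and> f z = inverse (hprod z C + D) *s (A *v z + B))"

definition LFM_ball :: "(complex^'n \<Rightarrow> complex^'n) set" where
  "LFM_ball = {f. linear_fractional_on unit_ball f \<and> f ` unit_ball \<subseteq> unit_ball}"

definition denjoy_wolff_point :: "(complex^'n \<Rightarrow> complex^'n) \<Rightarrow> complex^'n \<Rightarrow> bool" where
  "denjoy_wolff_point f w \<longleftrightarrow>
     w \<in> sphere 0 1 \<and>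
     (\<forall>x\<in>unit_ball. \<exists>e>0. uniform_limit (ball x e \<inter> unit_ball) (\<lambda>n. f ^^ n) (\<lambda>_. w) sequentially)"

definition boundary_dilation :: "(complex^'n \<Rightarrow> complex^'n) \<Rightarrow> complex^'n \<Rightarrow> ereal" where
  "boundary_dilation f w =
     Liminf (at w within unit_ball) (\<lambda>z. ereal ((1 - (norm (f z))\<^sup>2) / (1 - (norm z)\<^sup>2)))"

definition parabolic :: "(complex^'n \<Rightarrow> complex^'n) \<Rightarrow> bool" where
  "parabolic f \<longleftrightarrow>
     holomorphic_self_map unit_ball f \<and> (\<forall>z\<in>unit_ball. f z \<noteq> z) \<and>
     (\<exists>w. denjoy_wolff_point f w \<and> boundary_dilation f w = 1)"

text \<open>The exponential series converges for every square matrix, entry by entry.\<close>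

definition mat_exp :: "complex mat \<Rightarrow> complex mat" where
  "mat_exp X = mat (dim_row X) (dim_col X) (\<lambda>ij. \<Sum>k. (X ^\<^sub>m k) $$ ij / fact k)"

text \<open>The Moore-Penrose pseudo-inverse is the unique solution of the four Penrose equations.\<close>

definition pseudo_inverse :: "complex mat \<Rightarrow> complex mat" where
  "pseudo_inverse X = (THE Y. Y \<in> carrier_mat (dim_col X) (dim_row X) \<and>
     X * Y * X = X \<and> Y * X * Y = Y \<and>
     mat_adjoint (X * Y) = X * Y \<and> mat_adjoint (Y * X) = Y * X)"

definition hermitian_psd :: "complex mat \<Rightarrow> bool" where
  "hermitian_psd X \<longleftrightarrow> square_mat X \<and> mat_adjoint X = X \<and>
     (\<forall>x\<in>carrier_vec (dim_row X). Re ((X *\<^sub>v x) \<bullet>c x) \<ge> 0)"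

definition dissipative :: "complex mat \<Rightarrow> bool" where
  "dissipative X \<longleftrightarrow> square_mat X \<and>
     (\<forall>x\<in>carrier_vec (dim_row X). Re ((X *\<^sub>v x) \<bullet>c x) \<le> 0)"

text \<open>
  The number \<open>\<langle>X\<^sup>+c,c\<rangle>\<close>; it is real for Hermitian \<open>X\<close>, the only case of interest.
\<close>

definition pinv_form :: "complex mat \<Rightarrow> complex Matrix.vec \<Rightarrow> real" where
  "pinv_form X c = Re ((pseudo_inverse X *\<^sub>v c) \<bullet>c c)"

text \<open>Column vector of the coordinates with respect to a fixed enumeration of the index type.\<close>

definition coords :: "complex^'n \<Rightarrow> complex Matrix.vec" where
  "coords x = Matrix.vec CARD('n) (\<lambda>i. x $h from_nat_into UNIV i)"

definition of_coords :: "complex Matrix.vec \<Rightarrow> complex^'n" where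
  "of_coords y = (\<chi> j. y $ to_nat_on UNIV j)"

definition siegel :: "(complex^'n) set" where
  "siegel = {x. Im (coords x $ 0) > (\<Sum>i = 1..<CARD('n). (cmod (coords x $ i))\<^sup>2)}"

text \<open>
  The map \<open>(z,u,v,w) \<mapsto> (z + 2i\<langle>u,a\<rangle> + 2i\<langle>w,c\<rangle> + b, u + a, Dv, Aw)\<close>; the block sizes are
  read off from \<open>a\<close>, \<open>D\<close> and \<open>A\<close>.
\<close>

definition normal_map ::
    "complex \<Rightarrow> complex Matrix.vec \<Rightarrow> complex Matrix.vec \<Rightarrow> complex mat \<Rightarrow> complex mat \<Rightarrow>
     complex^'n \<Rightarrow> complex^'n" where
  "normal_map b a c D A x =
     (let p = dim_vec a; r = dim_row D; q = dim_row A;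
          y = coords x;
          z = y $ 0;
          u = Matrix.vec p (\<lambda>i. y $ (1 + i));
          v = Matrix.vec r (\<lambda>i. y $ (1 + p + i));
          w = Matrix.vec q (\<lambda>i. y $ (1 + p + r + i))
      in of_coords
           (Matrix.vec 1 (\<lambda>_. z + 2 * \<i> * (u \<bullet>c a) + 2 * \<i> * (w \<bullet>c c) + b)
             @\<^sub>v (u + a) @\<^sub>v (D *\<^sub>v v) @\<^sub>v (A *\<^sub>v w)))"

definition normal_form_data ::
    "nat \<Rightarrow> complex \<Rightarrow> complex Matrix.vec \<Rightarrow> complex Matrix.vec \<Rightarrow> complex mat \<Rightarrow> complex mat \<Rightarrow> bool"
where
  "normal_form_data N b a c D A \<longleftrightarrow>
     (\<exists>p q r. 1 + p + q + r = N \<and>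
        a \<in> carrier_vec p \<and> c \<in> carrier_vec q \<and> D \<in> carrier_mat r r \<and> A \<in> carrier_mat q q \<and>
        diagonal_mat D \<and> spectrum D \<subseteq> sphere 0 1 - {1} \<and>
        (let Q = 1\<^sub>m q - mat_adjoint A * A in
           hermitian_psd Q \<and>
           Im b - Re (a \<bullet>c a) \<ge> pinv_form Q c \<and>
           Q * pseudo_inverse Q *\<^sub>v c = c))"

definition c_at :: "complex mat \<Rightarrow> complex Matrix.vec \<Rightarrow> real \<Rightarrow> complex Matrix.vec" where
  "c_at M c t =
     the (mat_inverse (1\<^sub>m (dim_row M) - mat_adjoint (mat_exp M))) *\<^sub>v
       ((1\<^sub>m (dim_row M) - mat_adjoint (mat_exp (complex_of_real t \<cdot>\<^sub>m M))) *\<^sub>v c)"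

definition Q_at :: "complex mat \<Rightarrow> real \<Rightarrow> complex mat" where
  "Q_at M t =
     1\<^sub>m (dim_row M) -
       mat_adjoint (mat_exp (complex_of_real t \<cdot>\<^sub>m M)) * mat_exp (complex_of_real t \<cdot>\<^sub>m M)"

end

theory Submission
  imports Defs
begin

text \<open>
  After a unitary change of coordinates the Denjoy--Wolff point is \<open>e\<^sub>0\<close>, and the Cayley transform
  carries \<open>\<phi>\<close> to a linear fractional map of the Siegel half-plane.  The difference between the
  denominator of \<open>\<phi>\<close> and its first numerator vanishes at \<open>e\<^sub>0\<close>, because the iterates converge to
  \<open>e\<^sub>0\<close>, and nowhere in the ball, so it is a multiple of \<open>1 - x\<^sub>0\<close>; hence the transformed map is
  affine, of the form \<open>(z, Z) \<mapsto> (\<rho>z + \<langle>Z, \<beta>\<rangle> + t, SZ + s)\<close>.  If \<open>\<rho> < 1\<close> the orbits would be bounded,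
  and \<open>\<rho> > 1\<close> contradicts the dilation coefficient \<open>1\<close>, so \<open>\<rho> = 1\<close> and \<open>S\<close> is a contraction.
  A Heisenberg translation removes the component of \<open>s\<close> in the range of \<open>I - S\<close>; what remains is
  fixed by the contraction \<open>S\<close>, hence by its adjoint, and is rotated to a multiple of a basis
  vector.  This normal form has \<open>p \<le> 1\<close> and no \<open>v\<close>-block, all unimodular eigenvalues
  being left in \<open>A\<close>.  Invariance of the half-plane is a quadratic inequality in \<open>w\<close>,
  which is equivalent to (b), (c) and (d).

  For the embedding, \<open>\<phi>\<^sub>t\<close> is again a normal form, with data \<open>tb + i(t\<^sup>2 - t)|a|\<^sup>2\<close>, \<open>ta\<close>, \<open>c\<^sub>t\<close>,
  \<open>D\<^sup>t\<close> and \<open>exp(tM)\<close>; the semigroup law amounts to \<open>c\<^sub>t\<^sub>+\<^sub>s = c\<^sub>s + exp(sM)\<^sup>H c\<^sub>t\<close>.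
\<close>

section \<open>Adjoints and the pseudo-inverse\<close>

text \<open>Under a normal map the quantity Im z - |u|^2 - |v|^2 - |w|^2 changes by |v|^2 - |Dv|^2
  plus a real polynomial in w with quadratic part <Qw,w>, linear part 2 Re<w,c> and constant part Im
  b - |a|^2. Completing the square at -Q^+c decides when this polynomial is nonnegative. Read in one
  direction this yields the conditions of part (1); read in the other it makes each
  \<open>\<phi>\<^sub>t\<close> of part (2) a self-map, dissipativity of M being what makes exp(tM)
  a contraction. The correction i(t^2 - t)|a|^2 is there because composing the translations by sa
  and ta of the u-block adds 2i<sa,ta> to z. With it, the constant part for
  \<open>\<phi>\<^sub>t\<close> is t(Im b - |a|^2), the left side of hypothesis (b). At the
  Denjoy-Wolff point the denominator of \<phi> could a priori vanish. The value of numerator against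
  denominator there is therefore read off along the orbit of 0, after clearing denominators.\<close>

lemma mat_adjoint_carrier [simp]: "A \<in> carrier_mat n m \<Longrightarrow> mat_adjoint A \<in> carrier_mat m n"
  by (auto simp: mat_adjoint_def)

lemma dim_mat_adjoint [simp]:
  "dim_row (mat_adjoint A) = dim_col A" "dim_col (mat_adjoint A) = dim_row A"
  by (auto simp: mat_adjoint_def)

lemma index_mat_adjoint [simp]:
  "i < dim_col A \<Longrightarrow> j < dim_row A \<Longrightarrow> mat_adjoint (A :: complex mat) $$ (i, j) = cnj (A $$ (j, i))"
  by (auto simp: mat_adjoint_def mat_of_rows_index)

lemma mat_adjoint_adjoint [simp]: "mat_adjoint (mat_adjoint (A :: complex mat)) = A"
  by (rule eq_matI) auto

lemma mat_adjoint_mult: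
  fixes A B :: "complex mat"
  assumes "A \<in> carrier_mat n m" "B \<in> carrier_mat m k"
  shows "mat_adjoint (A * B) = mat_adjoint B * mat_adjoint A"
  using assms by (intro eq_matI) (auto simp: scalar_prod_def mult.commute intro!: sum.cong)

lemma mat_adjoint_add:
  fixes A B :: "complex mat"
  assumes "A \<in> carrier_mat n m" "B \<in> carrier_mat n m"
  shows "mat_adjoint (A + B) = mat_adjoint A + mat_adjoint B"
  using assms by (intro eq_matI) auto

lemma mat_adjoint_diff:
  fixes A B :: "complex mat"
  assumes "A \<in> carrier_mat n m" "B \<in> carrier_mat n m"
  shows "mat_adjoint (A - B) = mat_adjoint A - mat_adjoint B"
  using assms by (intro eq_matI) auto

lemma mat_adjoint_one [simp]: "mat_adjoint (1\<^sub>m n :: complex mat) = 1\<^sub>m n"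
  by (intro eq_matI) auto

lemma cscalar_prod_sum:
  "x \<bullet>c (y :: complex Matrix.vec) = (\<Sum>i<dim_vec y. x $ i * cnj (y $ i))"
  by (simp add: scalar_prod_def atLeast0LessThan)

lemma cscalar_prod_adjoint:
  fixes A :: "complex mat"
  assumes "A \<in> carrier_mat n m" "x \<in> carrier_vec m" "y \<in> carrier_vec n"
  shows "(A *\<^sub>v x) \<bullet>c y = x \<bullet>c (mat_adjoint A *\<^sub>v y)"
proof -
  have "(A *\<^sub>v x) \<bullet>c y = (\<Sum>i<n. \<Sum>j<m. A $$ (i, j) * x $ j * cnj (y $ i))"
    using assms by (auto simp: cscalar_prod_sum scalar_prod_def sum_distrib_right atLeast0LessThan intro!: sum.cong)
  also have "\<dots> = (\<Sum>j<m. \<Sum>i<n. A $$ (i, j) * x $ j * cnj (y $ i))"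
    by (rule sum.swap)
  also have "\<dots> = x \<bullet>c (mat_adjoint A *\<^sub>v y)"
    using assms by (auto simp: cscalar_prod_sum scalar_prod_def sum_distrib_left atLeast0LessThan algebra_simps intro!: sum.cong)
  finally show ?thesis .
qed

lemma cscalar_prod_add_left:
  "x \<in> carrier_vec n \<Longrightarrow> y \<in> carrier_vec n \<Longrightarrow> z \<in> carrier_vec n \<Longrightarrow>
    (x + y) \<bullet>c z = x \<bullet>c z + y \<bullet>c (z :: complex Matrix.vec)"
  by (auto simp: cscalar_prod_sum algebra_simps sum.distrib)

lemma cscalar_prod_add_right:
  "x \<in> carrier_vec n \<Longrightarrow> y \<in> carrier_vec n \<Longrightarrow> z \<in> carrier_vec n \<Longrightarrow>
    x \<bullet>c (y + z) = x \<bullet>c y + x \<bullet>c (z :: complex Matrix.vec)"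
  by (auto simp: cscalar_prod_sum algebra_simps sum.distrib)

lemma cscalar_prod_diff_left:
  "x \<in> carrier_vec n \<Longrightarrow> y \<in> carrier_vec n \<Longrightarrow> z \<in> carrier_vec n \<Longrightarrow>
    (x - y) \<bullet>c z = x \<bullet>c z - y \<bullet>c (z :: complex Matrix.vec)"
  by (auto simp: cscalar_prod_sum algebra_simps sum_subtractf)

lemma cscalar_prod_smult_left:
  "x \<in> carrier_vec n \<Longrightarrow> y \<in> carrier_vec n \<Longrightarrow>
    (k \<cdot>\<^sub>v x) \<bullet>c y = k * (x \<bullet>c (y :: complex Matrix.vec))"
  by (auto simp: cscalar_prod_sum algebra_simps sum_distrib_left)

lemma cscalar_prod_smult_right:
  "x \<in> carrier_vec n \<Longrightarrow> y \<in> carrier_vec n \<Longrightarrow>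
    x \<bullet>c (k \<cdot>\<^sub>v y) = cnj k * (x \<bullet>c (y :: complex Matrix.vec))"
  by (auto simp: cscalar_prod_sum algebra_simps sum_distrib_left)

lemma cnj_cscalar_prod:
  "x \<in> carrier_vec n \<Longrightarrow> y \<in> carrier_vec n \<Longrightarrow> cnj (x \<bullet>c (y :: complex Matrix.vec)) = y \<bullet>c x"
  by (auto simp: cscalar_prod_sum algebra_simps)

lemma cscalar_prod_self: "x \<bullet>c (x :: complex Matrix.vec) = of_real (\<Sum>i<dim_vec x. (cmod (x $ i))\<^sup>2)"
  by (simp add: cscalar_prod_sum complex_norm_square[symmetric])

lemma Re_cscalar_prod_self_ge0: "Re (x \<bullet>c (x :: complex Matrix.vec)) \<ge> 0"
  by (simp add: cscalar_prod_self sum_nonneg)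

text \<open>Penrose's argument: inserting \<open>X = X * Z * X\<close> into the Hermitian matrix
  \<open>X * Y\<close> and taking adjoints reverses the order of the factors, so that
  \<open>X * Y\<close> collapses to \<open>X * Z\<close>. The same works on the other side, and Y =
  YXY = ZXY = ZXZ = Z.\<close>

lemma pseudo_inverse_unique:
  fixes X Y Z :: "complex mat"
  assumes X: "X \<in> carrier_mat n m" and Y: "Y \<in> carrier_mat m n" and Z: "Z \<in> carrier_mat m n"
    and "X * Y * X = X" "Y * X * Y = Y" "mat_adjoint (X * Y) = X * Y" "mat_adjoint (Y * X) = Y * X"
    and "X * Z * X = X" "Z * X * Z = Z" "mat_adjoint (X * Z) = X * Z" "mat_adjoint (Z * X) = Z * X"
  shows "Y = Z"
proof -
  have XY: "X * Y \<in> carrier_mat n n" and XZ: "X * Z \<in> carrier_mat n n"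
    and YX: "Y * X \<in> carrier_mat m m" and ZX: "Z * X \<in> carrier_mat m m"
    using X Y Z by auto
  have 1: "X * Y = X * Z"
  proof -
    have "X * Y = mat_adjoint ((X * Z * X) * Y)" using assms by simp
    also have "(X * Z * X) * Y = (X * Z) * (X * Y)" by (rule assoc_mult_mat[OF XZ X Y])
    also have "mat_adjoint \<dots> = (X * Y) * (X * Z)" using assms XY XZ by (simp add: mat_adjoint_mult[OF XZ XY])
    also have "\<dots> = (X * Y * X) * Z" using XY X Z by (simp add: assoc_mult_mat)
    finally show ?thesis using assms by simp
  qed
  have 2: "Y * X = Z * X"
  proof -
    have "Y * X = mat_adjoint (Y * (X * Z * X))" using assms by simp
    also have "Y * (X * Z * X) = (Y * X) * (Z * X)"
      using X Y Z XZ YX ZX by (simp add: assoc_mult_mat[OF X Z X] assoc_mult_mat[OF Y X ZX])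
    also have "mat_adjoint \<dots> = (Z * X) * (Y * X)" using assms YX ZX by (simp add: mat_adjoint_mult[OF YX ZX])
    also have "\<dots> = Z * (X * Y * X)"
      using X Y Z YX by (simp add: assoc_mult_mat[OF X Y X] assoc_mult_mat[OF Z X YX])
    finally show ?thesis using assms by simp
  qed
  have "Y = Z * X * Y" using assms 2 by simp
  also have "\<dots> = Z * (X * Y)" using X Y Z by (simp add: assoc_mult_mat)
  also have "\<dots> = Z * X * Z" using X Z 1 by (simp add: assoc_mult_mat[OF Z X Z])
  finally show ?thesis using assms by simp
qed

lemma pseudo_inverse_eqI:
  fixes X Y :: "complex mat"
  assumes "X \<in> carrier_mat n m" "Y \<in> carrier_mat m n"
    "X * Y * X = X" "Y * X * Y = Y" "mat_adjoint (X * Y) = X * Y" "mat_adjoint (Y * X) = Y * X"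
  shows "pseudo_inverse X = Y"
  unfolding pseudo_inverse_def using assms
  by (intro the_equality) (auto intro: pseudo_inverse_unique[of X n m])

section \<open>Existence of the pseudo-inverse of a Hermitian matrix\<close>

lemma mat_add_diff_cancel:
  "A \<in> carrier_mat n m \<Longrightarrow> B \<in> carrier_mat n m \<Longrightarrow> A + B - B = (A :: complex mat)"
  by (rule eq_matI) auto

lemma mat_diff_zero: "A \<in> carrier_mat n m \<Longrightarrow> A - 0\<^sub>m n m = (A :: complex mat)"
  by (rule eq_matI) auto

lemma mat_trivial_kernel_left_inverse:
  fixes X :: "complex mat"
  assumes X: "X \<in> carrier_mat n n" and ker: "\<And>x. x \<in> carrier_vec n \<Longrightarrow> X *\<^sub>v x = 0\<^sub>v n \<Longrightarrow> x = 0\<^sub>v n"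
  obtains B where "B \<in> carrier_mat n n" "X * B = 1\<^sub>m n" "B * X = 1\<^sub>m n"
proof -
  have "det X \<noteq> 0"
    using ker det_0_iff_vec_prod_zero_field[OF X] by auto
  from det_non_zero_imp_unit[OF X this, of "()"]
  show ?thesis using that unfolding Units_def ring_mat_def by auto
qed

lemma mult_mat_vec_eq_0_imp_mult_outer_eq_0:
  fixes X :: "complex mat"
  assumes "X \<in> carrier_mat n n" "x \<in> carrier_vec n" "X *\<^sub>v x = 0\<^sub>v n"
  shows "X * mat n n (\<lambda>(i, j). x $ i * cnj (x $ j) / s) = 0\<^sub>m n n"
proof (rule eq_matI)
  fix i j assume "i < dim_row (0\<^sub>m n n :: complex mat)" "j < dim_col (0\<^sub>m n n :: complex mat)"
  hence ij: "i < n" "j < n" by auto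
  have "(\<Sum>l<n. X $$ (i, l) * x $ l) = 0"
    using arg_cong[OF assms(3), of "\<lambda>v. v $ i"] assms(1,2) ij by (auto simp: scalar_prod_def atLeast0LessThan)
  moreover have "(X * mat n n (\<lambda>(i, j). x $ i * cnj (x $ j) / s)) $$ (i, j)
      = (\<Sum>l<n. X $$ (i, l) * x $ l) * (cnj (x $ j) / s)"
    using ij assms(1,2)
    by (simp add: scalar_prod_def atLeast0LessThan sum_distrib_right sum_divide_distrib mult.assoc)
  ultimately show "(X * mat n n (\<lambda>(i, j). x $ i * cnj (x $ j) / s)) $$ (i, j) = 0\<^sub>m n n $$ (i, j)"
    using ij by simp
qed (use assms in auto)

text \<open>A projection of maximal trace among those with range inside the kernel is onto the kernel:
  otherwise a projection onto a further kernel vector could be added.\<close>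

lemma hermitian_kernel_projection:
  fixes Q :: "complex mat"
  assumes Q: "Q \<in> carrier_mat n n"
  obtains R where "R \<in> carrier_mat n n" "mat_adjoint R = R" "R * R = R" "Q * R = 0\<^sub>m n n"
    "\<And>x. x \<in> carrier_vec n \<Longrightarrow> Q *\<^sub>v x = 0\<^sub>v n \<Longrightarrow> R *\<^sub>v x = 0\<^sub>v n \<Longrightarrow> x = 0\<^sub>v n"
proof -
  define P where "P R \<longleftrightarrow> R \<in> carrier_mat n n \<and> mat_adjoint R = R \<and> R * R = R \<and> Q * R = 0\<^sub>m n n"
    for R :: "complex mat"
  \<comment> \<open>In a Hermitian idempotent a diagonal entry is the squared norm of its row, hence
    at least its own square, hence at most 1.\<close>
  have bound: "Re (\<Sum>i<n. R $$ (i, i)) \<le> real n" if "P R" for R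
  proof -
    have R: "R \<in> carrier_mat n n" and adj: "mat_adjoint R = R" and idem: "R * R = R"
      using that by (auto simp: P_def)
    have "Re (R $$ (i, i)) \<le> 1" if i: "i < n" for i
    proof -
      have cnj: "R $$ (l, i) = cnj (R $$ (i, l))" if "l < n" for l
        using index_mat_adjoint[of l R i] adj R i that by auto
      have "R $$ (i, i) = (\<Sum>l<n. R $$ (i, l) * R $$ (l, i))"
        using arg_cong[OF idem, of "\<lambda>M. M $$ (i, i)"] R i by (auto simp: scalar_prod_def atLeast0LessThan)
      also have "\<dots> = (\<Sum>l<n. of_real ((cmod (R $$ (i, l)))\<^sup>2))"
      proof (rule sum.cong)
        fix l assume "l \<in> {..<n}"
        hence "R $$ (l, i) = cnj (R $$ (i, l))" using cnj by simp
        thus "R $$ (i, l) * R $$ (l, i) = of_real ((cmod (R $$ (i, l)))\<^sup>2)"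
          by (metis complex_norm_square)
      qed simp
      finally have "Re (R $$ (i, i)) = (\<Sum>l<n. (cmod (R $$ (i, l)))\<^sup>2)"
        by (metis Re_complex_of_real of_real_sum)
      also have "\<dots> \<ge> (cmod (R $$ (i, i)))\<^sup>2"
        using i by (intro member_le_sum) auto
      finally have "(Re (R $$ (i, i)))\<^sup>2 \<le> Re (R $$ (i, i))"
        using cmod_power2[of "R $$ (i,i)"] by (smt (verit) zero_le_power2)
      hence "\<not> Re (R $$ (i, i)) > 1"
        using mult_strict_left_mono[of 1 "Re (R $$ (i, i))" "Re (R $$ (i, i))"] by (auto simp: power2_eq_square)
      thus ?thesis by simp
    qed
    hence "(\<Sum>i<n. Re (R $$ (i, i))) \<le> (\<Sum>i<n. 1)" by (intro sum_mono) auto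
    thus ?thesis by simp
  qed
  have "\<exists>R. P R \<and> (\<forall>x\<in>carrier_vec n. Q *\<^sub>v x = 0\<^sub>v n \<longrightarrow> R *\<^sub>v x = 0\<^sub>v n \<longrightarrow> x = 0\<^sub>v n)"
  proof (rule ccontr)
    assume neg: "\<not> ?thesis"
    \<comment> \<open>Under the negated claim the trace of any admissible \<open>R\<close> can be
      raised by exactly 1, so every natural number would be a trace; \<open>Suc n\<close> then
      violates \<open>bound\<close>.\<close>
    have "\<exists>R. P R \<and> (\<Sum>i<n. R $$ (i, i)) = of_nat k" for k
    proof (induction k)
      case 0
      show ?case using Q by (intro exI[of _ "0\<^sub>m n n"]) (auto simp: P_def intro!: eq_matI)
    next
      case (Suc k)
      then obtain R where PR: "P R" and tr: "(\<Sum>i<n. R $$ (i, i)) = of_nat k" by blast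
      have R: "R \<in> carrier_mat n n" and adj: "mat_adjoint R = R" and idem: "R * R = R"
        and QR: "Q * R = 0\<^sub>m n n"
        using PR by (auto simp: P_def)
      obtain x where x: "x \<in> carrier_vec n" "Q *\<^sub>v x = 0\<^sub>v n" "R *\<^sub>v x = 0\<^sub>v n" "x \<noteq> 0\<^sub>v n"
        using neg PR by blast
      define s :: complex where "s = (\<Sum>i<n. x $ i * cnj (x $ i))"
      have s0: "s \<noteq> 0"
      proof
        assume "s = 0"
        hence "x \<bullet>c x = 0" using x(1) by (simp add: cscalar_prod_sum s_def)
        thus False using x(1,4) by simp
      qed
      have s_real: "cnj s = s" by (simp add: s_def mult.commute)
      \<comment> \<open>The orthogonal projection onto the line of the kernel vector
        \<open>x\<close>; since \<open>R\<close> kills \<open>x\<close>, the two projections are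
        orthogonal and their sum is again one.\<close>
      define E where "E = mat n n (\<lambda>(i, j). x $ i * cnj (x $ j) / s)"
      have E: "E \<in> carrier_mat n n" by (simp add: E_def)
      have adjE: "mat_adjoint E = E"
        by (rule eq_matI) (auto simp: E_def s_real)
      have RE: "R * E = 0\<^sub>m n n" and QE: "Q * E = 0\<^sub>m n n"
        unfolding E_def using Q R x by (auto intro!: mult_mat_vec_eq_0_imp_mult_outer_eq_0)
      have "mat_adjoint (R * E) = 0\<^sub>m n n" unfolding RE by (rule eq_matI) auto
      hence ER: "E * R = 0\<^sub>m n n" using mat_adjoint_mult[OF R E] adj adjE by simp
      have EE: "E * E = E"
      proof (rule eq_matI)
        fix i j assume "i < dim_row E" "j < dim_col E"
        hence ij: "i < n" "j < n" by (auto simp: E_def)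
        have "(E * E) $$ (i, j) = (\<Sum>l<n. x $ i * cnj (x $ l) / s * (x $ l * cnj (x $ j) / s))"
          using ij by (auto simp: E_def scalar_prod_def atLeast0LessThan)
        also have "\<dots> = (\<Sum>l<n. x $ l * cnj (x $ l)) * (x $ i * cnj (x $ j) / (s * s))"
          unfolding sum_distrib_right by (intro sum.cong) auto
        also have "\<dots> = s * (x $ i * cnj (x $ j) / (s * s))"
          unfolding s_def[symmetric] ..
        finally show "(E * E) $$ (i, j) = E $$ (i, j)"
          using ij s0 by (simp add: E_def)
      qed (auto simp: E_def)
      have REc: "R + E \<in> carrier_mat n n" using R E by simp
      have "(R + E) * (R + E) = R * R + E * R + (R * E + E * E)"
        using mult_add_distrib_mat[OF REc R E] add_mult_distrib_mat[OF R E R] add_mult_distrib_mat[OF R E E]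
        by simp
      also have "\<dots> = R + E" using R E by (simp add: idem EE RE ER)
      finally have "(R + E) * (R + E) = R + E" .
      moreover have "Q * (R + E) = 0\<^sub>m n n"
        using mult_add_distrib_mat[OF Q R E] by (simp add: QR QE)
      moreover have "mat_adjoint (R + E) = R + E"
        using mat_adjoint_add[OF R E] adj adjE by simp
      ultimately have "P (R + E)" using REc by (simp add: P_def)
      moreover have "(\<Sum>i<n. (R + E) $$ (i, i)) = of_nat (Suc k)"
      proof -
        have "(\<Sum>i<n. E $$ (i, i)) = (\<Sum>i<n. x $ i * cnj (x $ i)) / s"
          unfolding sum_divide_distrib by (intro sum.cong) (auto simp: E_def)
        hence "(\<Sum>i<n. E $$ (i, i)) = s / s" unfolding s_def[symmetric] .
        thus ?thesis using R E tr s0 by (simp add: sum.distrib)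
      qed
      ultimately show ?case by blast
    qed
    then obtain R where "P R" "(\<Sum>i<n. R $$ (i, i)) = of_nat (Suc n)" by blast
    thus False using bound[of R] by simp
  qed
  thus ?thesis using that unfolding P_def by blast
qed

text \<open>With R the projection onto the kernel of Q, the sum Q + R is injective: applying R to (Q
  + R)x = 0 gives Rx = 0, then Qx = 0. Its inverse B acts as the identity on the kernel, so B - R
  inverts Q off the kernel and vanishes on it. Both products with Q equal 1 - R, from which the
  Penrose equations follow.\<close>

lemma hermitian_pseudo_inverse:
  fixes Q :: "complex mat"
  assumes Q: "Q \<in> carrier_mat n n" and adjQ: "mat_adjoint Q = Q"
  shows "pseudo_inverse Q \<in> carrier_mat n n" and "Q * pseudo_inverse Q * Q = Q"
    and "mat_adjoint (Q * pseudo_inverse Q) = Q * pseudo_inverse Q"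
proof -
  obtain R where R: "R \<in> carrier_mat n n" and adj: "mat_adjoint R = R" and idem: "R * R = R"
    and QR: "Q * R = 0\<^sub>m n n"
    and ker: "\<And>x. x \<in> carrier_vec n \<Longrightarrow> Q *\<^sub>v x = 0\<^sub>v n \<Longrightarrow> R *\<^sub>v x = 0\<^sub>v n \<Longrightarrow> x = 0\<^sub>v n"
    using hermitian_kernel_projection[OF Q] by metis
  have "mat_adjoint (Q * R) = 0\<^sub>m n n" unfolding QR by (rule eq_matI) auto
  hence RQ: "R * Q = 0\<^sub>m n n" using mat_adjoint_mult[OF Q R] adj adjQ by simp
  have QRc: "Q + R \<in> carrier_mat n n" using Q R by simp
  have RQR: "R * (Q + R) = R" using Q R by (simp add: mult_add_distrib_mat[of _ n n] RQ idem)
  have QRR: "(Q + R) * R = R" using Q R by (simp add: add_mult_distrib_mat[of _ n n] QR idem)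
  obtain B where B: "B \<in> carrier_mat n n" and B1: "(Q + R) * B = 1\<^sub>m n" and B2: "B * (Q + R) = 1\<^sub>m n"
  proof (rule mat_trivial_kernel_left_inverse[OF QRc])
    fix x :: "complex Matrix.vec" assume x: "x \<in> carrier_vec n" and 0: "(Q + R) *\<^sub>v x = 0\<^sub>v n"
    have "R *\<^sub>v x = R *\<^sub>v ((Q + R) *\<^sub>v x)"
      using assoc_mult_mat_vec[OF R QRc x] RQR by simp
    hence Rx: "R *\<^sub>v x = 0\<^sub>v n" using 0 R by auto
    moreover have "Q *\<^sub>v x + R *\<^sub>v x = 0\<^sub>v n" using 0 add_mult_distrib_mat_vec[OF Q R x] by simp
    ultimately show "x = 0\<^sub>v n" using ker[OF x] Q R x by auto
  qed
  have BR: "B * R = R"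
    using assoc_mult_mat[OF B QRc R] QRR B2 R by simp
  have RB: "R * B = R"
    using assoc_mult_mat[OF R QRc B] RQR B1 R by simp
  define Y where "Y = B - R"
  have Y: "Y \<in> carrier_mat n n" using B R by (auto simp: Y_def)
  define P where "P = 1\<^sub>m n - R"
  have P: "P \<in> carrier_mat n n" using R by (auto simp: P_def)
  have "(Q + R) * B = Q * B + R" using Q R B RB by (simp add: add_mult_distrib_mat[of _ n n])
  hence QB: "Q * B = P" using B1 mat_add_diff_cancel[of "Q * B" n n R] Q B R by (simp add: P_def)
  have "B * (Q + R) = B * Q + R" using Q R B BR by (simp add: mult_add_distrib_mat[of _ n n])
  hence BQ: "B * Q = P" using B2 mat_add_diff_cancel[of "B * Q" n n R] Q B R by (simp add: P_def)
  have QY: "Q * Y = P" using Q B R QB QR P unfolding Y_def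
    by (simp add: mult_minus_distrib_mat[of _ n n] mat_diff_zero)
  have YQ: "Y * Q = P" using Q B R BQ RQ P unfolding Y_def
    by (simp add: minus_mult_distrib_mat[of _ n n] mat_diff_zero)
  have PQ: "P * Q = Q" using Q R RQ unfolding P_def
    by (simp add: minus_mult_distrib_mat[of _ n n] mat_diff_zero)
  have "R * Y = 0\<^sub>m n n" using B R RB idem unfolding Y_def
    by (simp add: mult_minus_distrib_mat[of _ n n] mat_diff_zero)
  hence PY: "P * Y = Y" using Y R unfolding P_def
    by (simp add: minus_mult_distrib_mat[of _ n n] mat_diff_zero)
  have adjP: "mat_adjoint P = P" using R adj unfolding P_def
    by (simp add: mat_adjoint_diff[of _ n n])
  have "pseudo_inverse Q = Y"
    using Q Y QY YQ PQ PY adjP by (intro pseudo_inverse_eqI[of _ n n]) auto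
  thus "pseudo_inverse Q \<in> carrier_mat n n" "Q * pseudo_inverse Q * Q = Q"
    "mat_adjoint (Q * pseudo_inverse Q) = Q * pseudo_inverse Q"
    using Y QY PQ adjP by auto
qed

text \<open>Completing the square: with y = Q^+c the range condition says Qy = c, so <Q(w+y),w+y> is
  the polynomial with constant term <Q^+c,c>.\<close>

lemma psd_quadratic_nonneg:
  fixes Q :: "complex mat"
  assumes Q: "Q \<in> carrier_mat n n" and psd: "hermitian_psd Q"
    and c: "c \<in> carrier_vec n" and cQ: "Q * pseudo_inverse Q *\<^sub>v c = c"
    and k: "k \<ge> pinv_form Q c" and w: "w \<in> carrier_vec n"
  shows "0 \<le> Re ((Q *\<^sub>v w) \<bullet>c w) + 2 * Re (w \<bullet>c c) + k"
proof -
  have adjQ: "mat_adjoint Q = Q" using psd by (simp add: hermitian_psd_def)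
  define y where "y = pseudo_inverse Q *\<^sub>v c"
  have Y: "pseudo_inverse Q \<in> carrier_mat n n" by (rule hermitian_pseudo_inverse[OF Q adjQ])
  have y: "y \<in> carrier_vec n" using Y c by (auto simp: y_def)
  have Qy: "Q *\<^sub>v y = c" using cQ assoc_mult_mat_vec[OF Q Y c] by (simp add: y_def)
  have Qw: "Q *\<^sub>v w \<in> carrier_vec n" using Q w by auto
  have "0 \<le> Re ((Q *\<^sub>v (w + y)) \<bullet>c (w + y))"
    using psd w y Q by (auto simp: hermitian_psd_def)
  also have "(Q *\<^sub>v (w + y)) \<bullet>c (w + y) = (Q *\<^sub>v w) \<bullet>c w + (Q *\<^sub>v w) \<bullet>c y + c \<bullet>c w + c \<bullet>c y"
    using Q w y Qw c Qy
    by (simp add: mult_add_distrib_mat_vec[of _ n n] cscalar_prod_add_left[of _ n] cscalar_prod_add_right[of _ n])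
  also have "(Q *\<^sub>v w) \<bullet>c y = w \<bullet>c c"
    using cscalar_prod_adjoint[OF Q w y] adjQ Qy by simp
  also have "c \<bullet>c w = cnj (w \<bullet>c c)" using cnj_cscalar_prod[OF w c] by simp
  also have "c \<bullet>c y = cnj (y \<bullet>c c)" using cnj_cscalar_prod[OF y c] by simp
  finally show ?thesis using k by (simp add: pinv_form_def y_def)
qed

text \<open>The part d of c outside the range of Q lies in the kernel of Q. Along -d the quadratic
  term vanishes and the linear one tends to minus infinity, so d = 0. Evaluating at the minimiser w
  = -Q^+c then gives the bound.\<close>

lemma psd_quadratic_bound_imp:
  fixes Q :: "complex mat"
  assumes Q: "Q \<in> carrier_mat n n" and psd: "hermitian_psd Q"
    and c: "c \<in> carrier_vec n"
    and nonneg: "\<And>w. w \<in> carrier_vec n \<Longrightarrow> 0 \<le> Re ((Q *\<^sub>v w) \<bullet>c w) + 2 * Re (w \<bullet>c c) + k"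
  shows "pinv_form Q c \<le> k" and "Q * pseudo_inverse Q *\<^sub>v c = c"
proof -
  have adjQ: "mat_adjoint Q = Q" using psd by (simp add: hermitian_psd_def)
  have Y: "pseudo_inverse Q \<in> carrier_mat n n" and QYQ: "Q * pseudo_inverse Q * Q = Q"
    and adjQY: "mat_adjoint (Q * pseudo_inverse Q) = Q * pseudo_inverse Q"
    by (rule hermitian_pseudo_inverse[OF Q adjQ])+
  define y where "y = pseudo_inverse Q *\<^sub>v c"
  have y: "y \<in> carrier_vec n" using Y c by (auto simp: y_def)
  define d where "d = c - Q *\<^sub>v y"
  have Qy: "Q *\<^sub>v y \<in> carrier_vec n" using Q y by auto
  have d: "d \<in> carrier_vec n" using c Qy by (auto simp: d_def)
  have QY: "Q * pseudo_inverse Q \<in> carrier_mat n n" using Q Y by simp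
  have "Q * (Q * pseudo_inverse Q) = Q"
    using mat_adjoint_mult[OF QY Q] QYQ adjQ adjQY by simp
  hence "Q *\<^sub>v (Q *\<^sub>v y) = Q *\<^sub>v c"
    using assoc_mult_mat_vec[OF Q QY c] assoc_mult_mat_vec[OF Q Y c] by (simp add: y_def)
  hence Qd: "Q *\<^sub>v d = 0\<^sub>v n"
    using Q c Qy by (simp add: d_def mult_minus_distrib_mat_vec[of _ n n])
  have c_eq: "c = d + Q *\<^sub>v y" using c Qy Q by (auto simp: d_def intro!: eq_vecI)
  have dd: "d \<bullet>c c = d \<bullet>c d"
  proof -
    have "d \<bullet>c c = d \<bullet>c (d + Q *\<^sub>v y)" using c_eq by simp
    also have "\<dots> = d \<bullet>c d + d \<bullet>c (Q *\<^sub>v y)" by (rule cscalar_prod_add_right[OF d d Qy])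
    also have "d \<bullet>c (Q *\<^sub>v y) = (Q *\<^sub>v d) \<bullet>c y"
      using cscalar_prod_adjoint[OF Q d y] adjQ by simp
    also have "\<dots> = 0" using y by (simp add: Qd cscalar_prod_sum)
    finally show ?thesis by simp
  qed
  have "d \<bullet>c d = 0"
  proof (rule ccontr)
    assume "d \<bullet>c d \<noteq> 0"
    moreover have "d \<bullet>c d = of_real (Re (d \<bullet>c d))" by (simp add: cscalar_prod_self)
    ultimately have pos: "Re (d \<bullet>c d) > 0"
      using Re_cscalar_prod_self_ge0[of d] by (metis less_eq_real_def of_real_0)
    \<comment> \<open>Makes the linear term equal to -2(|k| + 1), which outweighs
      \<open>k\<close>.\<close>
    define \<tau> where "\<tau> = (\<bar>k\<bar> + 1) / Re (d \<bullet>c d)"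
    define w where "w = complex_of_real (- \<tau>) \<cdot>\<^sub>v d"
    have w: "w \<in> carrier_vec n" using d by (simp add: w_def)
    have "Q *\<^sub>v w = 0\<^sub>v n" using mult_mat_vec[OF Q d] Qd unfolding w_def by auto
    hence "0 \<le> 2 * Re (w \<bullet>c c) + k" using nonneg[OF w] w by (simp add: cscalar_prod_sum)
    also have "w \<bullet>c c = of_real (- \<tau>) * (d \<bullet>c d)"
      unfolding w_def using cscalar_prod_smult_left[OF d c] dd by simp
    also have "Re \<dots> = - (\<bar>k\<bar> + 1)" using pos by (simp add: \<tau>_def)
    finally show False by simp
  qed
  hence "d = 0\<^sub>v n" using d by simp
  hence Qyc: "Q *\<^sub>v y = c" using c_eq Qy by simp
  show *: "Q * pseudo_inverse Q *\<^sub>v c = c"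
    using Qyc assoc_mult_mat_vec[OF Q Y c] by (simp add: y_def)
  have Qy': "Q *\<^sub>v y = c" using * assoc_mult_mat_vec[OF Q Y c] by (simp add: y_def)
  have my: "- y \<in> carrier_vec n" using y by simp
  have "Q *\<^sub>v (- y) = - (Q *\<^sub>v y)"
    using Q y by (intro eq_vecI) (auto simp: scalar_prod_def sum_negf)
  hence "Q *\<^sub>v (- y) = - c" using Qy' by simp
  moreover have "(- c) \<bullet>c (- y) = c \<bullet>c y" "(- y) \<bullet>c c = - (y \<bullet>c c)"
    using c y by (auto simp: cscalar_prod_sum sum_negf)
  ultimately show "pinv_form Q c \<le> k" using nonneg[OF my] cnj_cscalar_prod[OF y c, symmetric]
    by (simp add: pinv_form_def y_def[symmetric])
qed

section \<open>The matrix exponential\<close>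

lemma index_mult_mat_sum:
  fixes A B :: "complex mat"
  assumes "A \<in> carrier_mat n m" "B \<in> carrier_mat m k" "i < n" "j < k"
  shows "(A * B) $$ (i, j) = (\<Sum>l<m. A $$ (i, l) * B $$ (l, j))"
  using assms by (simp add: scalar_prod_def atLeast0LessThan)

lemma index_mult_mat_vec_sum:
  fixes A :: "complex mat"
  assumes "A \<in> carrier_mat n m" "x \<in> carrier_vec m" "i < n"
  shows "(A *\<^sub>v x) $ i = (\<Sum>l<m. A $$ (i, l) * x $ l)"
  using assms by (simp add: scalar_prod_def atLeast0LessThan)

lemma pow_mat_add:
  fixes X :: "complex mat"
  assumes X: "X \<in> carrier_mat n n"
  shows "X ^\<^sub>m (k + l) = X ^\<^sub>m k * X ^\<^sub>m l"
proof (induction l)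
  case 0
  show ?case using X pow_carrier_mat[OF X, of k] by simp
next
  case (Suc l)
  show ?case
    using Suc assoc_mult_mat[OF pow_carrier_mat[OF X, of k] pow_carrier_mat[OF X, of l] X] by simp
qed

lemma smult_pow_mat:
  fixes X :: "complex mat"
  assumes X: "X \<in> carrier_mat n n"
  shows "(c \<cdot>\<^sub>m X) ^\<^sub>m k = c ^ k \<cdot>\<^sub>m (X ^\<^sub>m k)"
proof (induction k)
  case 0
  show ?case using X by (intro eq_matI) auto
next
  case (Suc k)
  have Xk: "X ^\<^sub>m k \<in> carrier_mat n n" using X by simp
  show ?case using X Xk Suc
    by (intro eq_matI) (auto simp: algebra_simps)
qed

text \<open>The sum of the moduli of all entries dominates every column sum, which lets an entrywise
  bound pass through a product. It makes the exponential series comparable to a scalar one.\<close>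

lemma cmod_pow_mat_le:
  fixes X :: "complex mat"
  assumes X: "X \<in> carrier_mat n n" and ij: "i < n" "j < n"
  shows "cmod ((X ^\<^sub>m k) $$ (i, j)) \<le> (\<Sum>i<n. \<Sum>j<n. cmod (X $$ (i, j))) ^ k"
  using ij
proof (induction k arbitrary: j)
  case 0
  then show ?case using X by auto
next
  case (Suc k)
  define K where "K = (\<Sum>i<n. \<Sum>j<n. cmod (X $$ (i, j)))"
  have K0: "K \<ge> 0" by (auto simp: K_def intro!: sum_nonneg)
  have Xk: "X ^\<^sub>m k \<in> carrier_mat n n" using X by simp
  have "cmod ((X ^\<^sub>m Suc k) $$ (i, j)) = cmod (\<Sum>l<n. (X ^\<^sub>m k) $$ (i, l) * X $$ (l, j))"
    using X Xk Suc.prems by (simp add: scalar_prod_def atLeast0LessThan)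
  also have "\<dots> \<le> (\<Sum>l<n. K ^ k * cmod (X $$ (l, j)))"
    using Suc by (intro order_trans[OF norm_sum] sum_mono) (auto simp: norm_mult K_def intro!: mult_right_mono)
  also have "\<dots> = K ^ k * (\<Sum>l<n. cmod (X $$ (l, j)))" by (simp add: sum_distrib_left)
  also have "\<dots> \<le> K ^ k * K"
    unfolding K_def[of] using Suc.prems
    by (intro mult_left_mono sum_mono member_le_sum zero_le_power sum_nonneg) auto
  finally show ?case by (simp add: K_def mult.commute)
qed

lemma summable_mat_exp:
  fixes X :: "complex mat"
  assumes X: "X \<in> carrier_mat n n" and ij: "i < n" "j < n"
  shows "summable (\<lambda>k. norm ((X ^\<^sub>m k) $$ (i, j) / fact k * z ^ k))"
proof (rule summable_comparison_test')
  let ?K = "\<Sum>i<n. \<Sum>j<n. cmod (X $$ (i, j))"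
  show "summable (\<lambda>k. inverse (fact k) * (?K * norm z) ^ k)" by (rule summable_exp)
  fix k :: nat
  show "norm (norm ((X ^\<^sub>m k) $$ (i, j) / fact k * z ^ k)) \<le> inverse (fact k) * (?K * norm z) ^ k"
    using cmod_pow_mat_le[OF X ij, of k]
    by (auto simp: norm_mult norm_divide norm_power power_mult_distrib divide_simps intro!: mult_right_mono)
qed

lemma mat_exp_carrier [simp]: "X \<in> carrier_mat n m \<Longrightarrow> mat_exp X \<in> carrier_mat n m"
  by (auto simp: mat_exp_def)

text \<open>Regarding an entry of exp(cX) as a scalar power series in c makes the Cauchy product and
  termwise differentiation available.\<close>

lemma index_mat_exp_smult:
  fixes X :: "complex mat"
  assumes X: "X \<in> carrier_mat n n" and ij: "i < n" "j < n"
  shows "mat_exp (c \<cdot>\<^sub>m X) $$ (i, j) = (\<Sum>k. (X ^\<^sub>m k) $$ (i, j) / fact k * c ^ k)"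
proof -
  have "((c \<cdot>\<^sub>m X) ^\<^sub>m k) $$ (i, j) / fact k = (X ^\<^sub>m k) $$ (i, j) / fact k * c ^ k" for k
  proof -
    have "(c ^ k \<cdot>\<^sub>m X ^\<^sub>m k) $$ (i, j) = c ^ k * (X ^\<^sub>m k) $$ (i, j)"
      using X ij pow_carrier_mat[OF X, of k] by (subst index_smult_mat) auto
    thus ?thesis by (simp add: smult_pow_mat[OF X])
  qed
  thus ?thesis using X ij by (simp add: mat_exp_def)
qed

lemma mat_exp_zero_smult:
  assumes X: "X \<in> carrier_mat n n"
  shows "mat_exp (0 \<cdot>\<^sub>m X) = 1\<^sub>m n"
proof (rule eq_matI)
  fix i j assume "i < dim_row (1\<^sub>m n :: complex mat)" "j < dim_col (1\<^sub>m n :: complex mat)"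
  thus "mat_exp (0 \<cdot>\<^sub>m X) $$ (i, j) = 1\<^sub>m n $$ (i, j)"
    using X powser_zero[of "\<lambda>k. (X ^\<^sub>m k) $$ (i, j) / fact k"]
    by (simp add: index_mat_exp_smult[of _ n] del: times_divide_eq_left)
qed (use X in \<open>auto simp: mat_exp_def\<close>)

text \<open>Cauchy product of the entries: summing over the inner matrix index recombines the two
  powers of X into \<open>X ^\<^sub>m k\<close>, independently of how k is split, and the binomial
  theorem remains.\<close>

lemma mat_exp_add_smult:
  fixes X :: "complex mat"
  assumes X: "X \<in> carrier_mat n n"
  shows "mat_exp ((s + t) \<cdot>\<^sub>m X) = mat_exp (s \<cdot>\<^sub>m X) * mat_exp (t \<cdot>\<^sub>m X)"
proof (rule eq_matI)
  let ?P = "mat_exp (s \<cdot>\<^sub>m X) * mat_exp (t \<cdot>\<^sub>m X)"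
  have c: "mat_exp (s \<cdot>\<^sub>m X) \<in> carrier_mat n n" "mat_exp (t \<cdot>\<^sub>m X) \<in> carrier_mat n n"
    using X by auto
  fix i j assume "i < dim_row ?P" "j < dim_col ?P"
  hence ij: "i < n" "j < n" using c by auto
  define a where "a l k = (X ^\<^sub>m k) $$ (i, l) / fact k * s ^ k" for l k
  define b where "b l k = (X ^\<^sub>m k) $$ (l, j) / fact k * t ^ k" for l k
  have sa: "summable (\<lambda>k. norm (a l k))" and sb: "summable (\<lambda>k. norm (b l k))" if "l < n" for l
    using summable_mat_exp[OF X] ij that by (auto simp: a_def b_def)
  have conv: "(\<Sum>l<n. \<Sum>m\<le>k. a l m * b l (k - m)) = (X ^\<^sub>m k) $$ (i, j) / fact k * (s + t) ^ k" for k
  proof -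
    have "(\<Sum>l<n. \<Sum>m\<le>k. a l m * b l (k - m)) = (\<Sum>m\<le>k. \<Sum>l<n. a l m * b l (k - m))"
      by (rule sum.swap)
    also have "\<dots> = (\<Sum>m\<le>k. (X ^\<^sub>m k) $$ (i, j) * (s ^ m / fact m * (t ^ (k - m) / fact (k - m))))"
    proof (rule sum.cong)
      fix m assume "m \<in> {..k}"
      hence "X ^\<^sub>m k = X ^\<^sub>m m * X ^\<^sub>m (k - m)" using pow_mat_add[OF X, of m "k - m"] by simp
      hence "(X ^\<^sub>m k) $$ (i, j) = (\<Sum>l<n. (X ^\<^sub>m m) $$ (i, l) * (X ^\<^sub>m (k - m)) $$ (l, j))"
        using ij by (simp only: index_mult_mat_sum[OF pow_carrier_mat[OF X] pow_carrier_mat[OF X]])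
      thus "(\<Sum>l<n. a l m * b l (k - m)) =
          (X ^\<^sub>m k) $$ (i, j) * (s ^ m / fact m * (t ^ (k - m) / fact (k - m)))"
        by (simp only: sum_distrib_right) (simp add: a_def b_def mult_ac)
    qed simp
    also have "\<dots> = (X ^\<^sub>m k) $$ (i, j) * ((s + t) ^ k / fact k)"
      using exp_series_add_commuting[of s t k]
      by (simp add: sum_distrib_left[symmetric] scaleR_conv_of_real divide_inverse mult.commute)
    finally show ?thesis by simp
  qed
  have "?P $$ (i, j) = (\<Sum>l<n. (\<Sum>k. a l k) * (\<Sum>k. b l k))"
    using ij by (simp add: index_mult_mat_sum[OF c] index_mat_exp_smult[OF X] a_def b_def
        del: times_divide_eq_left)
  also have "\<dots> = (\<Sum>l<n. \<Sum>k. \<Sum>m\<le>k. a l m * b l (k - m))"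
    by (intro sum.cong Cauchy_product sa sb) auto
  also have "\<dots> = (\<Sum>k. \<Sum>l<n. \<Sum>m\<le>k. a l m * b l (k - m))"
    by (intro suminf_sum[symmetric] summable_Cauchy_product sa sb) auto
  also have "\<dots> = mat_exp ((s + t) \<cdot>\<^sub>m X) $$ (i, j)"
    using ij by (simp add: conv index_mat_exp_smult[OF X])
  finally show "mat_exp ((s + t) \<cdot>\<^sub>m X) $$ (i, j) = ?P $$ (i, j)" by simp
qed (use X in \<open>auto simp: mat_exp_def\<close>)

lemma has_field_derivative_mat_exp:
  fixes X :: "complex mat"
  assumes X: "X \<in> carrier_mat n n" and ij: "i < n" "j < n"
  shows "((\<lambda>z. mat_exp (z \<cdot>\<^sub>m X) $$ (i, j)) has_field_derivative
    (\<Sum>l<n. X $$ (i, l) * mat_exp (z \<cdot>\<^sub>m X) $$ (l, j))) (at z)"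
proof -
  define c where "c i k = (X ^\<^sub>m k) $$ (i, j) / fact k" for i k
  have summ: "summable (\<lambda>k. c l k * y ^ k)" if "l < n" for y l
    using summable_norm_cancel[OF summable_mat_exp[OF X that ij(2)]] by (simp add: c_def)
  have "((\<lambda>z. \<Sum>k. c i k * z ^ k) has_field_derivative (\<Sum>k. diffs (c i) k * z ^ k)) (at z)"
    using summ[OF ij(1)] by (rule termdiffs_strong_converges_everywhere)
  moreover have "(\<lambda>z. mat_exp (z \<cdot>\<^sub>m X) $$ (i, j)) = (\<lambda>z. \<Sum>k. c i k * z ^ k)"
    by (simp add: index_mat_exp_smult[OF X ij] c_def)
  moreover have "(\<Sum>k. diffs (c i) k * z ^ k) = (\<Sum>l<n. X $$ (i, l) * mat_exp (z \<cdot>\<^sub>m X) $$ (l, j))"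
  proof -
    have "diffs (c i) k * z ^ k = (\<Sum>l<n. X $$ (i, l) * (c l k * z ^ k))" for k
    proof -
      \<comment> \<open>The power is defined with the new factor on the right. Splitting it off on
        the left gives the derivative as X exp(zX), the form used for the contraction
        property.\<close>
      have "X ^\<^sub>m Suc k = X * X ^\<^sub>m k" using pow_mat_add[OF X, of 1 k] X by simp
      hence "(X ^\<^sub>m Suc k) $$ (i, j) = (\<Sum>l<n. X $$ (i, l) * (X ^\<^sub>m k) $$ (l, j))"
        using ij by (simp only: index_mult_mat_sum[OF X pow_carrier_mat[OF X]])
      moreover have "diffs (c i) k = (X ^\<^sub>m Suc k) $$ (i, j) / fact k"
        by (simp add: diffs_def c_def del: pow_mat.simps of_nat_Suc)
      ultimately show ?thesis
        by (simp only: sum_distrib_right sum_divide_distrib) (simp add: c_def mult.assoc)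
    qed
    hence "(\<Sum>k. diffs (c i) k * z ^ k) = (\<Sum>k. \<Sum>l<n. X $$ (i, l) * (c l k * z ^ k))" by simp
    also have "\<dots> = (\<Sum>l<n. \<Sum>k. X $$ (i, l) * (c l k * z ^ k))"
      by (intro suminf_sum summable_mult summ) auto
    also have "\<dots> = (\<Sum>l<n. X $$ (i, l) * (\<Sum>k. c l k * z ^ k))"
      by (intro sum.cong suminf_mult summ) auto
    finally show ?thesis using ij by (simp add: index_mat_exp_smult[OF X] c_def)
  qed
  ultimately show ?thesis by simp
qed

lemma has_vector_derivative_mat_exp:
  fixes X :: "complex mat"
  assumes "X \<in> carrier_mat n n" "i < n" "j < n"
  shows "((\<lambda>t. mat_exp (complex_of_real t \<cdot>\<^sub>m X) $$ (i, j)) has_vector_derivative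
    (\<Sum>l<n. X $$ (i, l) * mat_exp (complex_of_real t \<cdot>\<^sub>m X) $$ (l, j))) (at t)"
  using has_vector_derivative_real_field[OF has_field_derivative_mat_exp[OF assms]] .

lemma continuous_on_mat_exp:
  fixes X :: "complex mat"
  assumes "X \<in> carrier_mat n n" "i < n" "j < n"
  shows "continuous_on S (\<lambda>t. mat_exp (complex_of_real t \<cdot>\<^sub>m X) $$ (i, j))"
  using has_vector_derivative_mat_exp[OF assms]
  by (meson continuous_at_imp_continuous_on has_vector_derivative_continuous)

text \<open>Along Y' = XY the squared norm of Y has derivative 2 Re<XY,Y>, which dissipativity makes
  nonpositive.\<close>

lemma dissipative_mat_exp_contraction:
  fixes X :: "complex mat"
  assumes X: "X \<in> carrier_mat n n" and diss: "dissipative X" and t: "t \<ge> 0" and x: "x \<in> carrier_vec n"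
  defines "y \<equiv> mat_exp (complex_of_real t \<cdot>\<^sub>m X) *\<^sub>v x"
  shows "Re (y \<bullet>c y) \<le> Re (x \<bullet>c x)"
proof -
  define Y where "Y t = mat_exp (complex_of_real t \<cdot>\<^sub>m X) *\<^sub>v x" for t
  have E: "mat_exp (complex_of_real t \<cdot>\<^sub>m X) \<in> carrier_mat n n" for t using X by simp
  have Yc: "Y t \<in> carrier_vec n" for t using E[of t] x by (auto simp: Y_def)
  \<comment> \<open>Splitting into real and imaginary parts makes the squared norm a real function
    to which the real differentiation rules apply.\<close>
  define f where "f t = (\<Sum>i<n. (Re (Y t $ i))\<^sup>2 + (Im (Y t $ i))\<^sup>2)" for t
  have f: "Re (Y t \<bullet>c Y t) = f t" for t
    using Yc[of t] by (simp add: cscalar_prod_self f_def cmod_power2)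
  have dY: "((\<lambda>t. Y t $ i) has_vector_derivative (X *\<^sub>v Y t) $ i) (at t)" if i: "i < n" for t i
  proof -
    have "((\<lambda>t. \<Sum>j<n. mat_exp (complex_of_real t \<cdot>\<^sub>m X) $$ (i, j) * x $ j) has_vector_derivative
        (\<Sum>j<n. (\<Sum>l<n. X $$ (i, l) * mat_exp (complex_of_real t \<cdot>\<^sub>m X) $$ (l, j)) * x $ j)) (at t)"
      using i by (intro has_vector_derivative_sum has_vector_derivative_mult_left has_vector_derivative_mat_exp[OF X]) auto
    moreover have "(\<Sum>j<n. (\<Sum>l<n. X $$ (i, l) * mat_exp (complex_of_real t \<cdot>\<^sub>m X) $$ (l, j)) * x $ j)
        = (\<Sum>l<n. \<Sum>j<n. X $$ (i, l) * (mat_exp (complex_of_real t \<cdot>\<^sub>m X) $$ (l, j) * x $ j))"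
      by (subst sum.swap) (simp add: sum_distrib_right mult.assoc)
    moreover have "\<dots> = (X *\<^sub>v Y t) $ i"
      using i by (simp add: index_mult_mat_vec_sum[OF X Yc] sum_distrib_left)
        (simp add: Y_def index_mult_mat_vec_sum[OF E x] sum_distrib_left)
    moreover have "Y t $ i = (\<Sum>j<n. mat_exp (complex_of_real t \<cdot>\<^sub>m X) $$ (i, j) * x $ j)" for t
      using i by (simp add: Y_def index_mult_mat_vec_sum[OF E x])
    ultimately show ?thesis by simp
  qed
  have df: "(f has_real_derivative 2 * Re ((X *\<^sub>v Y t) \<bullet>c Y t)) (at t)" for t
  proof -
    have "(f has_real_derivative (\<Sum>i<n. 2 * (Re (Y t $ i) * Re ((X *\<^sub>v Y t) $ i))
        + 2 * (Im (Y t $ i) * Im ((X *\<^sub>v Y t) $ i)))) (at t)"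
      unfolding f_def
    proof (rule DERIV_sum)
      fix i assume "i \<in> {..<n}"
      hence i: "i < n" by simp
      have re: "((\<lambda>t. Re (Y t $ i)) has_real_derivative Re ((X *\<^sub>v Y t) $ i)) (at t)"
        using bounded_linear.has_vector_derivative[OF bounded_linear_Re dY[OF i]]
        by (simp add: has_real_derivative_iff_has_vector_derivative)
      have im: "((\<lambda>t. Im (Y t $ i)) has_real_derivative Im ((X *\<^sub>v Y t) $ i)) (at t)"
        using bounded_linear.has_vector_derivative[OF bounded_linear_Im dY[OF i]]
        by (simp add: has_real_derivative_iff_has_vector_derivative)
      show "((\<lambda>t. (Re (Y t $ i))\<^sup>2 + (Im (Y t $ i))\<^sup>2) has_real_derivative
        2 * (Re (Y t $ i) * Re ((X *\<^sub>v Y t) $ i)) + 2 * (Im (Y t $ i) * Im ((X *\<^sub>v Y t) $ i))) (at t)"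
        by (rule derivative_eq_intros re im refl | simp)+
    qed
    also have "(\<Sum>i<n. 2 * (Re (Y t $ i) * Re ((X *\<^sub>v Y t) $ i))
        + 2 * (Im (Y t $ i) * Im ((X *\<^sub>v Y t) $ i))) = 2 * Re ((X *\<^sub>v Y t) \<bullet>c Y t)"
      using Yc[of t] by (simp add: cscalar_prod_sum sum_distrib_left algebra_simps)
    finally show ?thesis .
  qed
  have "f t \<le> f 0"
  proof (rule DERIV_nonpos_imp_nonincreasing[OF t])
    fix s
    have "Re ((X *\<^sub>v Y s) \<bullet>c Y s) \<le> 0" using diss Yc[of s] X by (auto simp: dissipative_def)
    thus "\<exists>y. (f has_real_derivative y) (at s) \<and> y \<le> 0" using df[of s] by force
  qed
  moreover have "Y 0 = x" using x by (simp add: Y_def mat_exp_zero_smult[OF X])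
  ultimately show ?thesis using f[of t] f[of 0] by (simp add: y_def Y_def)
qed

section \<open>Block coordinates and the normal form map\<close>

text \<open>The enumeration by which \<open>coords\<close> reads off entries. Index
  \<open>idx 0\<close> carries the variable z of the half-plane.\<close>

abbreviation idx :: "nat \<Rightarrow> 'n::finite" where
  "idx \<equiv> from_nat_into UNIV"

lemma idx_eq_iff: "i < CARD('n::finite) \<Longrightarrow> j < CARD('n) \<Longrightarrow> (idx i :: 'n) = idx j \<longleftrightarrow> i = j"
  using bij_betw_from_nat_into_finite[of "UNIV :: 'n set"] by (auto simp: bij_betw_def inj_on_def)

lemma ex_idx: obtains i where "i < CARD('n::finite)" "k = (idx i :: 'n)"
  using bij_betw_from_nat_into_finite[of "UNIV :: 'n set"] by (auto simp: bij_betw_def image_iff)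

lemma to_nat_on_idx: "i < CARD('n::finite) \<Longrightarrow> to_nat_on UNIV (idx i :: 'n) = i"
  using bij_betw_imp_surj_on[OF to_nat_on_finite[of "UNIV :: 'n set"]] by (intro to_nat_on_from_nat_into) auto

lemma sum_UNIV_idx: "(\<Sum>k\<in>UNIV. f k) = (\<Sum>i<CARD('n::finite). f (idx i :: 'n))"
  using sum.reindex_bij_betw[OF bij_betw_from_nat_into_finite[of "UNIV :: 'n set"], of f] by simp

lemma vec_eq_idxI:
  "(\<And>i. i < CARD('n) \<Longrightarrow> x $h (idx i :: 'n) = y $h idx i) \<Longrightarrow> x = (y :: ('a, 'n::finite) Finite_Cartesian_Product.vec)"
  by (metis ex_idx Finite_Cartesian_Product.vec_eq_iff)

lemma dim_coords [simp]: "dim_vec (coords (x :: complex^'n)) = CARD('n)"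
  by (simp add: coords_def)

lemma index_coords [simp]: "i < CARD('n) \<Longrightarrow> coords (x :: complex^'n) $ i = x $h idx i"
  by (simp add: coords_def)

lemma of_coords_idx: "i < CARD('n::finite) \<Longrightarrow> of_coords y $h (idx i :: 'n) = y $ i"
  by (simp add: of_coords_def to_nat_on_idx)

lemma coords_of_coords:
  assumes "y \<in> carrier_vec CARD('n::finite)"
  shows "coords (of_coords y :: complex^'n) = y"
  using assms by (intro eq_vecI) (auto simp: of_coords_idx)

text \<open>The components u, v, w are \<open>block 1 p\<close>, \<open>block (1 + p) r\<close> and
  \<open>block (1 + p + r) q\<close>: the offsets follow the order p, r, q.\<close>

definition block :: "nat \<Rightarrow> nat \<Rightarrow> complex^'n::finite \<Rightarrow> complex Matrix.vec" where
  "block i k x = Matrix.vec k (\<lambda>j. coords x $ (i + j))"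

lemma block_carrier [simp]: "block i k x \<in> carrier_vec k"
  by (simp add: block_def)

lemma siegel_iff:
  fixes x :: "complex^'n::finite"
  shows "x \<in> siegel \<longleftrightarrow> (\<Sum>i\<in>UNIV - {idx 0}. (cmod (x $h i))\<^sup>2) < Im (x $h idx 0)"
proof -
  have N: "0 < CARD('n)" by simp
  have "(\<Sum>i\<in>UNIV - {idx 0}. (cmod (x $h i))\<^sup>2) = (\<Sum>i\<in>UNIV. (cmod (x $h i))\<^sup>2) - (cmod (x $h idx 0))\<^sup>2"
    by (simp add: sum_diff1)
  also have "\<dots> = (\<Sum>i = 1..<CARD('n). (cmod (x $h idx i))\<^sup>2)"
    unfolding sum_UNIV_idx using N
    by (simp add: sum.atLeast_Suc_lessThan atLeast0LessThan[symmetric])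
  also have "\<dots> = (\<Sum>i = 1..<CARD('n). (cmod (coords x $ i))\<^sup>2)"
    by simp
  finally show ?thesis using N by (simp add: siegel_def)
qed

lemma siegel_block:
  fixes x :: "complex^'n::finite"
  assumes N: "1 + p + q + r = CARD('n)"
  shows "x \<in> siegel \<longleftrightarrow> Re (block 1 p x \<bullet>c block 1 p x) + Re (block (1 + p) r x \<bullet>c block (1 + p) r x)
    + Re (block (1 + p + r) q x \<bullet>c block (1 + p + r) q x) < Im (coords x $ 0)"
proof -
  define f where "f i = (cmod (coords x $ i))\<^sup>2" for i
  have *: "Re (block i k x \<bullet>c block i k x) = sum f {i..<i + k}" for i k
    unfolding cscalar_prod_self block_def f_def
    using sum.shift_bounds_nat_ivl[of "\<lambda>j. (cmod (coords x $ j))\<^sup>2" 0 i k]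
    by (simp add: atLeast0LessThan add.commute)
  have "sum f {1..<CARD('n)} = sum f {1..<1 + p} + sum f {1 + p..<1 + p + r} + sum f {1 + p + r..<1 + p + r + q}"
  proof -
    have "CARD('n) = 1 + p + r + q" using N by simp
    thus ?thesis
      using sum.atLeastLessThan_concat[of 1 "1 + p" "1 + p + r" f]
        sum.atLeastLessThan_concat[of 1 "1 + p + r" "1 + p + r + q" f] by (simp only: le_add1 le_add_same_cancel1 zero_le)
  qed
  thus ?thesis unfolding * siegel_def f_def by simp
qed

lemma coords_normal_map:
  fixes x :: "complex^'n::finite"
  assumes N: "1 + p + q + r = CARD('n)"
    and "a \<in> carrier_vec p" "D \<in> carrier_mat r r" "A \<in> carrier_mat q q"
  shows "coords (normal_map b a c D A x) =
    Matrix.vec 1 (\<lambda>_. coords x $ 0 + 2 * \<i> * (block 1 p x \<bullet>c a)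
      + 2 * \<i> * (block (1 + p + r) q x \<bullet>c c) + b)
    @\<^sub>v (block 1 p x + a) @\<^sub>v (D *\<^sub>v block (1 + p) r x) @\<^sub>v (A *\<^sub>v block (1 + p + r) q x)"
proof -
  have dims: "dim_vec a = p" "dim_row D = r" "dim_row A = q"
    using assms by auto
  show ?thesis
    unfolding normal_map_def Let_def block_def dims
    by (rule coords_of_coords, rule carrier_vecI) (use N dims in simp)
qed

lemma block_normal_map:
  fixes x :: "complex^'n::finite"
  assumes N: "1 + p + q + r = CARD('n)"
    and "a \<in> carrier_vec p" "D \<in> carrier_mat r r" "A \<in> carrier_mat q q"
  shows "coords (normal_map b a c D A x) $ 0 = coords x $ 0 + 2 * \<i> * (block 1 p x \<bullet>c a)
      + 2 * \<i> * (block (1 + p + r) q x \<bullet>c c) + b"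
    and "block 1 p (normal_map b a c D A x) = block 1 p x + a"
    and "block (1 + p) r (normal_map b a c D A x) = D *\<^sub>v block (1 + p) r x"
    and "block (1 + p + r) q (normal_map b a c D A x) = A *\<^sub>v block (1 + p + r) q x"
proof -
  note * = coords_normal_map[OF assms, of b c x]
  show "coords (normal_map b a c D A x) $ 0 = coords x $ 0 + 2 * \<i> * (block 1 p x \<bullet>c a)
      + 2 * \<i> * (block (1 + p + r) q x \<bullet>c c) + b"
    unfolding * by (simp add: append_vec_def)
  show "block 1 p (normal_map b a c D A x) = block 1 p x + a"
    unfolding block_def[of _ _ "normal_map b a c D A x"] * using assms
    by (intro eq_vecI) (auto simp: append_vec_def Let_def)
  show "block (1 + p) r (normal_map b a c D A x) = D *\<^sub>v block (1 + p) r x"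
    unfolding block_def[of _ _ "normal_map b a c D A x"] * using assms
    by (intro eq_vecI) (auto simp: append_vec_def Let_def)
  show "block (1 + p + r) q (normal_map b a c D A x) = A *\<^sub>v block (1 + p + r) q x"
    unfolding block_def[of _ _ "normal_map b a c D A x"] * using assms
    by (intro eq_vecI) (auto simp: append_vec_def Let_def)
qed

lemma idx_cases:
  fixes k :: "'n::finite"
  assumes "1 + p + q + r = CARD('n)"
  obtains "k = idx 0" | i where "i < p" "k = idx (1 + i)" | i where "i < r" "k = idx (1 + p + i)"
    | i where "i < q" "k = idx (1 + p + r + i)"
proof -
  obtain m where m: "m < CARD('n)" "k = idx m" by (rule ex_idx)
  consider "m = 0" | "1 \<le> m" "m < 1 + p" | "1 + p \<le> m" "m < 1 + p + r" | "1 + p + r \<le> m" by linarith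
  thus ?thesis
  proof cases
    case 2 thus ?thesis using that(2)[of "m - 1"] m by simp
  next
    case 3 thus ?thesis using that(3)[of "m - (1 + p)"] m by simp
  next
    case 4 thus ?thesis using that(4)[of "m - (1 + p + r)"] m assms by simp
  qed (use that m in auto)
qed

lemma normal_map_nth:
  fixes x :: "complex^'n::finite"
  assumes N: "1 + p + q + r = CARD('n)"
    and a: "a \<in> carrier_vec p" and c: "c \<in> carrier_vec q" and D: "D \<in> carrier_mat r r" and A: "A \<in> carrier_mat q q"
  shows "normal_map b a c D A x $h idx 0 = x $h idx 0 + 2 * \<i> * (\<Sum>i<p. x $h idx (1 + i) * cnj (a $ i))
      + 2 * \<i> * (\<Sum>i<q. x $h idx (1 + p + r + i) * cnj (c $ i)) + b"
    and "i < p \<Longrightarrow> normal_map b a c D A x $h idx (1 + i) = x $h idx (1 + i) + a $ i"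
    and "i < r \<Longrightarrow> normal_map b a c D A x $h idx (1 + p + i) = (\<Sum>j<r. D $$ (i, j) * x $h idx (1 + p + j))"
    and "i < q \<Longrightarrow> normal_map b a c D A x $h idx (1 + p + r + i) = (\<Sum>j<q. A $$ (i, j) * x $h idx (1 + p + r + j))"
proof -
  note * = block_normal_map[OF N a D A, of b c x]
  show "normal_map b a c D A x $h idx 0 = x $h idx 0 + 2 * \<i> * (\<Sum>i<p. x $h idx (1 + i) * cnj (a $ i))
      + 2 * \<i> * (\<Sum>i<q. x $h idx (1 + p + r + i) * cnj (c $ i)) + b"
    using *(1) N a c by (simp add: cscalar_prod_sum block_def)
  show "i < p \<Longrightarrow> normal_map b a c D A x $h idx (1 + i) = x $h idx (1 + i) + a $ i"
    using arg_cong[OF *(2), of "\<lambda>v. v $ i"] N a by (simp add: block_def)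
  show "i < r \<Longrightarrow> normal_map b a c D A x $h idx (1 + p + i) = (\<Sum>j<r. D $$ (i, j) * x $h idx (1 + p + j))"
    using arg_cong[OF *(3), of "\<lambda>v. v $ i"] N D
    by (simp add: index_mult_mat_vec_sum[of _ r r] del: index_mult_mat_vec) (simp add: block_def)
  show "i < q \<Longrightarrow> normal_map b a c D A x $h idx (1 + p + r + i) = (\<Sum>j<q. A $$ (i, j) * x $h idx (1 + p + r + j))"
    using arg_cong[OF *(4), of "\<lambda>v. v $ i"] N A
    by (simp add: index_mult_mat_vec_sum[of _ q q] del: index_mult_mat_vec) (simp add: block_def)
qed

lemma eq_blockI:
  fixes x y :: "complex^'n::finite"
  assumes N: "1 + p + q + r = CARD('n)"
    and "coords x $ 0 = coords y $ 0" and "block 1 p x = block 1 p y"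
    and "block (1 + p) r x = block (1 + p) r y" and "block (1 + p + r) q x = block (1 + p + r) q y"
  shows "x = y"
proof (rule Finite_Cartesian_Product.vec_eq_iff[THEN iffD2, rule_format])
  fix k
  show "x $h k = y $h k"
  proof (cases rule: idx_cases[OF N, of k])
    case 1 thus ?thesis using assms by simp
  next
    case (2 i) thus ?thesis using N arg_cong[OF assms(3), of "\<lambda>v. v $ i"] by (simp add: block_def)
  next
    case (3 i) thus ?thesis using N arg_cong[OF assms(4), of "\<lambda>v. v $ i"] by (simp add: block_def)
  next
    case (4 i) thus ?thesis using N arg_cong[OF assms(5), of "\<lambda>v. v $ i"] by (simp add: block_def)
  qed
qed

text \<open>A Heisenberg-type group law. The second translation sees u already shifted, which
  produces the cocycle 2i<a2,a1>. The linear form <w,c1> is evaluated at A2 w, which moves the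
  adjoint of A2 onto c1. These two terms dictate the shape of \<open>\<beta>\<close> and of
  \<open>c_at\<close> in the embedding.\<close>

lemma normal_map_comp:
  fixes x :: "complex^'n::finite"
  assumes N: "1 + p + q + r = CARD('n)"
    and 1: "a1 \<in> carrier_vec p" "c1 \<in> carrier_vec q" "D1 \<in> carrier_mat r r" "A1 \<in> carrier_mat q q"
    and 2: "a2 \<in> carrier_vec p" "c2 \<in> carrier_vec q" "D2 \<in> carrier_mat r r" "A2 \<in> carrier_mat q q"
  shows "normal_map b1 a1 c1 D1 A1 (normal_map b2 a2 c2 D2 A2 x) =
    normal_map (b1 + b2 + 2 * \<i> * (a2 \<bullet>c a1)) (a1 + a2) (c2 + mat_adjoint A2 *\<^sub>v c1) (D1 * D2) (A1 * A2) x"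
proof -
  have 3: "a1 + a2 \<in> carrier_vec p" "D1 * D2 \<in> carrier_mat r r" "A1 * A2 \<in> carrier_mat q q"
    using 1 2 by auto
  have Ac: "mat_adjoint A2 *\<^sub>v c1 \<in> carrier_vec q" using 1 2 by (intro mult_mat_vec_carrier) auto
  note b1 = block_normal_map[OF N 1(1,3,4)] and b2 = block_normal_map[OF N 2(1,3,4)]
    and b3 = block_normal_map[OF N 3]
  show ?thesis
  proof (rule eq_blockI[OF N], unfold b1 b2 b3)
    show "coords x $ 0 + 2 * \<i> * (block 1 p x \<bullet>c a2) + 2 * \<i> * (block (1 + p + r) q x \<bullet>c c2) + b2 +
        2 * \<i> * ((block 1 p x + a2) \<bullet>c a1) + 2 * \<i> * ((A2 *\<^sub>v block (1 + p + r) q x) \<bullet>c c1) + b1 =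
      coords x $ 0 + 2 * \<i> * (block 1 p x \<bullet>c (a1 + a2)) +
        2 * \<i> * (block (1 + p + r) q x \<bullet>c (c2 + mat_adjoint A2 *\<^sub>v c1)) + (b1 + b2 + 2 * \<i> * (a2 \<bullet>c a1))"
      using cscalar_prod_adjoint[OF 2(4) _ 1(2), of "block (1 + p + r) q x"] 1 2 Ac
      by (simp add: cscalar_prod_add_left[of _ p] cscalar_prod_add_right[of _ p]
          cscalar_prod_add_right[of _ q] algebra_simps)
    show "block 1 p x + a2 + a1 = block 1 p x + (a1 + a2)"
      using 1 2 block_carrier[of 1 p x] by (intro eq_vecI) auto
  qed (use 1 2 in \<open>auto intro!: assoc_mult_mat_vec[symmetric]\<close>)
qed

section \<open>The defect of a contraction and invariance of the half-plane\<close>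

lemma defect_form:
  fixes A :: "complex mat"
  assumes A: "A \<in> carrier_mat q q" and w: "w \<in> carrier_vec q"
  shows "((1\<^sub>m q - mat_adjoint A * A) *\<^sub>v w) \<bullet>c w = w \<bullet>c w - (A *\<^sub>v w) \<bullet>c (A *\<^sub>v w)"
proof -
  have Aw: "A *\<^sub>v w \<in> carrier_vec q" using A w by simp
  have A': "mat_adjoint A \<in> carrier_mat q q" using A by simp
  have AA: "mat_adjoint A * A \<in> carrier_mat q q" by (rule mult_carrier_mat[OF A' A])
  have "(1\<^sub>m q - mat_adjoint A * A) *\<^sub>v w = w - mat_adjoint A *\<^sub>v (A *\<^sub>v w)"
    using minus_mult_distrib_mat_vec[OF _ AA w, of "1\<^sub>m q"] w assoc_mult_mat_vec[OF A' A w] by simp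
  moreover have "(mat_adjoint A *\<^sub>v (A *\<^sub>v w)) \<bullet>c w = (A *\<^sub>v w) \<bullet>c (A *\<^sub>v w)"
    using cscalar_prod_adjoint[OF A' Aw w] by simp
  ultimately show ?thesis
    using w mult_mat_vec_carrier[OF A' Aw] by (simp add: cscalar_prod_diff_left[of _ q])
qed

lemma hermitian_psd_defect:
  fixes A :: "complex mat"
  assumes A: "A \<in> carrier_mat q q"
    and le: "\<And>w. w \<in> carrier_vec q \<Longrightarrow> Re ((A *\<^sub>v w) \<bullet>c (A *\<^sub>v w)) \<le> Re (w \<bullet>c w)"
  shows "hermitian_psd (1\<^sub>m q - mat_adjoint A * A)"
proof -
  have A': "mat_adjoint A \<in> carrier_mat q q" using A by simp
  have AA: "mat_adjoint A * A \<in> carrier_mat q q" by (rule mult_carrier_mat[OF A' A])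
  have "mat_adjoint (1\<^sub>m q - mat_adjoint A * A) = 1\<^sub>m q - mat_adjoint A * A"
    using mat_adjoint_diff[OF _ AA, of "1\<^sub>m q"] mat_adjoint_mult[OF A' A] by simp
  moreover have "0 \<le> Re (((1\<^sub>m q - mat_adjoint A * A) *\<^sub>v w) \<bullet>c w)" if "w \<in> carrier_vec q" for w
    using defect_form[OF A that] le[OF that] by simp
  ultimately show ?thesis using A by (auto simp: hermitian_psd_def)
qed

text \<open>The term 2 Re<u,a> of |u+a|^2 is cancelled by Im(2i<u,a>), and the v-block does not
  grow. What is left of the change is the polynomial in w of \<open>psd_quadratic_nonneg\<close>,
  with Q the defect of A.\<close>

lemma normal_map_siegel:
  fixes x :: "complex^'n::finite"
  assumes N: "1 + p + q + r = CARD('n)"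
    and a: "a \<in> carrier_vec p" and c: "c \<in> carrier_vec q" and D: "D \<in> carrier_mat r r" and A: "A \<in> carrier_mat q q"
    and Dle: "\<And>v. v \<in> carrier_vec r \<Longrightarrow> Re ((D *\<^sub>v v) \<bullet>c (D *\<^sub>v v)) \<le> Re (v \<bullet>c v)"
  defines "Q \<equiv> 1\<^sub>m q - mat_adjoint A * A"
  assumes psd: "hermitian_psd Q" and k: "pinv_form Q c \<le> Im b - Re (a \<bullet>c a)"
    and Qc: "Q * pseudo_inverse Q *\<^sub>v c = c" and x: "x \<in> siegel"
  shows "normal_map b a c D A x \<in> siegel"
proof -
  define u v w where "u = block 1 p x" and "v = block (1 + p) r x" and "w = block (1 + p + r) q x"
  have u: "u \<in> carrier_vec p" and v: "v \<in> carrier_vec r" and w: "w \<in> carrier_vec q"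
    by (simp_all add: u_def v_def w_def)
  have Q: "Q \<in> carrier_mat q q" using A by (auto simp: Q_def)
  have Qw: "(Q *\<^sub>v w) \<bullet>c w = w \<bullet>c w - (A *\<^sub>v w) \<bullet>c (A *\<^sub>v w)"
    unfolding Q_def by (rule defect_form[OF A w])
  have "0 \<le> Re ((Q *\<^sub>v w) \<bullet>c w) + 2 * Re (w \<bullet>c c) + (Im b - Re (a \<bullet>c a))"
    by (rule psd_quadratic_nonneg[OF Q psd c Qc k w])
  moreover have "Re (u \<bullet>c u) + Re (v \<bullet>c v) + Re (w \<bullet>c w) < Im (coords x $ 0)"
    using x siegel_block[OF N, of x] by (simp add: u_def v_def w_def)
  moreover have "Re ((u + a) \<bullet>c (u + a)) = Re (u \<bullet>c u) + 2 * Re (u \<bullet>c a) + Re (a \<bullet>c a)"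
  proof -
    have "Re (a \<bullet>c u) = Re (u \<bullet>c a)" using cnj_cscalar_prod[OF u a] by (metis complex_cnj(1) complex.sel(1) cnj.simps(1))
    thus ?thesis using u a by (simp add: cscalar_prod_add_left[of _ p] cscalar_prod_add_right[of _ p])
  qed
  ultimately show ?thesis
    using Dle[OF v] unfolding siegel_block[OF N] block_normal_map[OF N a D A] Qw
    by (simp add: u_def v_def w_def)
qed

section \<open>Holomorphic maps and semigroups\<close>

text \<open>Scalar version of \<open>holomorphic_map\<close>. A \<open>has_derivative\<close>
  witness is already real linear, so only homogeneity under complex scalars has to be added.\<close>

definition holomorphic_fun :: "(complex^'n::finite) set \<Rightarrow> (complex^'n \<Rightarrow> complex) \<Rightarrow> bool" where
  "holomorphic_fun S g \<longleftrightarrow>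
     (\<forall>x\<in>S. \<exists>g'. (g has_derivative g') (at x) \<and> (\<forall>k h. g' (k *s h) = k * g' h))"

lemma holomorphic_fun_const: "holomorphic_fun S (\<lambda>x. k)"
  unfolding holomorphic_fun_def by (force intro: derivative_intros)

lemma holomorphic_fun_nth: "holomorphic_fun S (\<lambda>x. x $h i)"
  unfolding holomorphic_fun_def
  by (intro ballI exI[of _ "\<lambda>x. x $h i"]) (auto intro!: bounded_linear_imp_has_derivative)

lemma holomorphic_fun_add:
  assumes "holomorphic_fun S f" "holomorphic_fun S g"
  shows "holomorphic_fun S (\<lambda>x. f x + g x)"
  unfolding holomorphic_fun_def
proof
  fix x assume "x \<in> S"
  then obtain f' g' where "(f has_derivative f') (at x)" "\<And>k h. f' (k *s h) = k * f' h"
    "(g has_derivative g') (at x)" "\<And>k h. g' (k *s h) = k * g' h"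
    using assms unfolding holomorphic_fun_def by blast
  thus "\<exists>h. ((\<lambda>x. f x + g x) has_derivative h) (at x) \<and> (\<forall>k v. h (k *s v) = k * h v)"
    by (intro exI[of _ "\<lambda>v. f' v + g' v"]) (auto intro!: derivative_intros simp: algebra_simps)
qed

lemma holomorphic_fun_mult:
  assumes "holomorphic_fun S f" "holomorphic_fun S g"
  shows "holomorphic_fun S (\<lambda>x. f x * g x)"
  unfolding holomorphic_fun_def
proof
  fix x assume "x \<in> S"
  then obtain f' g' where "(f has_derivative f') (at x)" "\<And>k h. f' (k *s h) = k * f' h"
    "(g has_derivative g') (at x)" "\<And>k h. g' (k *s h) = k * g' h"
    using assms unfolding holomorphic_fun_def by blast
  thus "\<exists>h. ((\<lambda>x. f x * g x) has_derivative h) (at x) \<and> (\<forall>k v. h (k *s v) = k * h v)"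
    by (intro exI[of _ "\<lambda>v. f x * g' v + f' v * g x"]) (auto intro!: derivative_intros simp: algebra_simps)
qed

lemma holomorphic_fun_inverse:
  assumes "holomorphic_fun S f" and "\<And>x. x \<in> S \<Longrightarrow> f x \<noteq> 0"
  shows "holomorphic_fun S (\<lambda>x. inverse (f x))"
  unfolding holomorphic_fun_def
proof
  fix x assume x: "x \<in> S"
  then obtain f' where "(f has_derivative f') (at x)" "\<And>k h. f' (k *s h) = k * f' h"
    using assms unfolding holomorphic_fun_def by blast
  thus "\<exists>h. ((\<lambda>x. inverse (f x)) has_derivative h) (at x) \<and> (\<forall>k v. h (k *s v) = k * h v)"
    using assms(2)[OF x]
    by (intro exI[of _ "\<lambda>v. - (inverse (f x) * f' v * inverse (f x))"]) (auto intro!: derivative_intros)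
qed

lemma holomorphic_fun_sum:
  assumes "\<And>i. i \<in> I \<Longrightarrow> holomorphic_fun S (f i)"
  shows "holomorphic_fun S (\<lambda>x. \<Sum>i\<in>I. f i x)"
  using assms by (induction I rule: infinite_finite_induct) (auto intro: holomorphic_fun_const holomorphic_fun_add)

lemmas holomorphic_fun_intros =
  holomorphic_fun_const holomorphic_fun_nth holomorphic_fun_add holomorphic_fun_mult holomorphic_fun_sum

lemma holomorphic_mapI:
  fixes f :: "complex^'n::finite \<Rightarrow> complex^'m::finite"
  assumes "\<And>j. holomorphic_fun S (\<lambda>x. f x $h j)"
  shows "holomorphic_map S f"
  unfolding holomorphic_map_def
proof
  fix x assume x: "x \<in> S"
  have "\<forall>j. \<exists>g'. ((\<lambda>x. f x $h j) has_derivative g') (at x) \<and> (\<forall>k h. g' (k *s h) = k * g' h)"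
    using assms x unfolding holomorphic_fun_def by blast
  then obtain g' where g': "\<And>j. ((\<lambda>x. f x $h j) has_derivative g' j) (at x)"
    and lin: "\<And>j k h. g' j (k *s h) = k * g' j h" by metis
  define f' where "f' h = (\<chi> j. g' j h)" for h
  have "(f has_derivative f') (at x)"
  proof (subst has_derivative_componentwise_within, rule ballI)
    fix b :: "complex^'m" assume "b \<in> Basis"
    then obtain j and u :: complex where b: "b = axis j u" by (auto simp: Basis_vec_def)
    have "((\<lambda>x. inner (f x $h j) u) has_derivative (\<lambda>h. inner (g' j h) u)) (at x)"
      by (intro has_derivative_inner_left g')
    thus "((\<lambda>x. inner (f x) b) has_derivative (\<lambda>h. inner (f' h) b)) (at x)"
      by (simp add: b inner_axis f'_def)
  qed
  moreover have "Vector_Spaces.linear (*s) (*s) f'"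
  proof (rule Vector_Spaces.linear_iff[THEN iffD2], safe)
    fix h k c
    show "f' (h + k) = f' h + f' k"
      using linear_add[OF has_derivative_linear[OF g']]
      by (simp add: f'_def Finite_Cartesian_Product.vec_eq_iff)
    show "f' (c *s h) = c *s f' h"
      by (simp add: f'_def Finite_Cartesian_Product.vec_eq_iff lin)
  qed (rule vector_space_over_itself.vector_space_axioms vec.vector_space_axioms)+
  ultimately show "\<exists>f'. (f has_derivative f') (at x) \<and> Vector_Spaces.linear (*s) (*s) f'" by blast
qed

lemma holomorphic_map_compose:
  assumes f: "holomorphic_map S f" and g: "holomorphic_map T g" and "f ` S \<subseteq> T"
  shows "holomorphic_map S (g \<circ> f)"
  unfolding holomorphic_map_def
proof
  fix x assume x: "x \<in> S"
  obtain f' where f': "(f has_derivative f') (at x)" "Vector_Spaces.linear (*s) (*s) f'"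
    using f x unfolding holomorphic_map_def by blast
  obtain g' where g': "(g has_derivative g') (at (f x))" "Vector_Spaces.linear (*s) (*s) g'"
    using g x assms(3) unfolding holomorphic_map_def by blast
  show "\<exists>h. (g \<circ> f has_derivative h) (at x) \<and> Vector_Spaces.linear (*s) (*s) h"
    using diff_chain_at[OF f'(1) g'(1)] Vector_Spaces.linear_compose[OF f'(2) g'(2)] by blast
qed

lemma holomorphic_map_cong:
  assumes "holomorphic_map S f" "open S" "\<And>x. x \<in> S \<Longrightarrow> f x = g x"
  shows "holomorphic_map S g"
  using assms has_derivative_transform_within_open[of f _ _ UNIV S g]
  unfolding holomorphic_map_def by meson

lemma biholomorphic_mapI:
  assumes "holomorphic_map S f" "holomorphic_map T g" "open T"
    and "\<And>x. x \<in> S \<Longrightarrow> f x \<in> T" "\<And>y. y \<in> T \<Longrightarrow> g y \<in> S"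
    and "\<And>x. x \<in> S \<Longrightarrow> g (f x) = x" "\<And>y. y \<in> T \<Longrightarrow> f (g y) = y"
  shows "biholomorphic_map S T f" and "\<And>y. y \<in> T \<Longrightarrow> inv_into S f y = g y"
proof -
  have bij: "bij_betw f S T"
    using assms(4-7) by (intro bij_betw_byWitness[where f' = g]) auto
  show inv: "inv_into S f y = g y" if "y \<in> T" for y
    using that assms(4-7) bij by (metis bij_betw_inv_into_left)
  have "holomorphic_map T (inv_into S f)"
    using holomorphic_map_cong[OF assms(2,3)] inv by metis
  thus "biholomorphic_map S T f" using bij assms(1) by (simp add: biholomorphic_map_def)
qed

text \<open>The map on T is identified through its values on T alone. Being a holomorphic self-map
  is inherited from the composition, openness of T allowing the passage between maps that agree
  there.\<close>

lemma conjugatedI: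
  assumes "holomorphic_map S f" "holomorphic_map T g" "open S" "open T"
    and "\<And>x. x \<in> S \<Longrightarrow> f x \<in> T" "\<And>y. y \<in> T \<Longrightarrow> g y \<in> S"
    and "\<And>x. x \<in> S \<Longrightarrow> g (f x) = x" "\<And>y. y \<in> T \<Longrightarrow> f (g y) = y"
    and \<phi>: "holomorphic_self_map S \<phi>" and \<psi>: "\<And>y. y \<in> T \<Longrightarrow> \<psi> y = f (\<phi> (g y))"
  shows "conjugated S \<phi> T \<psi>"
proof -
  note bih = biholomorphic_mapI[OF assms(1,2,4-8)]
  have \<phi>S: "holomorphic_map S \<phi>" "\<And>x. x \<in> S \<Longrightarrow> \<phi> x \<in> S"
    using \<phi> by (auto simp: holomorphic_self_map_def)
  have "holomorphic_map T (f \<circ> (\<phi> \<circ> g))"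
    using assms(5,6) \<phi>S by (intro holomorphic_map_compose[of T _ S] assms(1,2)) auto
  hence "holomorphic_map T \<psi>"
    by (rule holomorphic_map_cong) (use assms in auto)
  hence "holomorphic_self_map T \<psi>"
    using \<psi> assms(5,6) \<phi>S by (auto simp: holomorphic_self_map_def)
  moreover have "\<phi> x = inv_into S f (\<psi> (f x))" if "x \<in> S" for x
    using that assms(5-8) \<psi> bih(2) \<phi>S by simp
  ultimately show ?thesis using \<phi> bih(1) unfolding conjugated_def by blast
qed

text \<open>By the tube lemma, joint continuity makes the set of times at which a compact K is
  mapped into an open U an open set. Continuity is asked for on the whole product space, so that no
  subspace topology enters this argument.\<close>

lemma continuous_semigroupI:
  fixes \<Phi> :: "real \<Rightarrow> complex^'n::finite \<Rightarrow> complex^'n"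
  assumes self: "\<And>t. t \<ge> 0 \<Longrightarrow> holomorphic_self_map S (\<Phi> t)"
    and cont: "continuous_on UNIV (\<lambda>z. \<Phi> (fst z) (snd z))"
    and "\<And>x. x \<in> S \<Longrightarrow> \<Phi> 0 x = x"
    and "\<And>s t x. s \<ge> 0 \<Longrightarrow> t \<ge> 0 \<Longrightarrow> x \<in> S \<Longrightarrow> \<Phi> (t + s) x = \<Phi> t (\<Phi> s x)"
  shows "continuous_semigroup S \<Phi>"
proof -
  have "continuous_map (top_of_set {0..}) (compact_open_topology S) \<Phi>"
    unfolding compact_open_topology_def
  proof (rule continuous_on_generated_topo)
    fix V :: "(complex^'n \<Rightarrow> complex^'n) set"
    assume "V \<in> {{f. holomorphic_self_map S f \<and> f ` K \<subseteq> U} |K U. compact K \<and> K \<subseteq> S \<and> open U}"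
    then obtain K U where V: "V = {f. holomorphic_self_map S f \<and> f ` K \<subseteq> U}" and K: "compact K" and U: "open U"
      by blast
    define W where "W = (\<lambda>z. \<Phi> (fst z) (snd z)) -` U"
    have W: "open W" unfolding W_def by (rule open_vimage[OF U cont])
    have "open {t. \<Phi> t ` K \<subseteq> U}"
    proof (rule open_subopen[THEN iffD2, rule_format])
      fix t assume "t \<in> {t. \<Phi> t ` K \<subseteq> U}"
      hence "{t} \<times> K \<subseteq> W" unfolding W_def by auto
      then obtain X where "t \<in> X" "open X" "X \<times> K \<subseteq> W" using Elementary_Topology.tube_lemma[OF K W] by blast
      thus "\<exists>T. open T \<and> t \<in> T \<and> T \<subseteq> {t. \<Phi> t ` K \<subseteq> U}"
        unfolding W_def by (intro exI[of _ X]) (auto simp: subset_iff)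
    qed
    moreover have "\<Phi> -` V \<inter> topspace (top_of_set {0..}) = {0..} \<inter> {t. \<Phi> t ` K \<subseteq> U}"
      using self by (auto simp: V)
    ultimately show "openin (top_of_set {0..}) (\<Phi> -` V \<inter> topspace (top_of_set {0..}))"
      by (simp add: openin_open_Int)
  next
    \<comment> \<open>The subbasic set for the empty compact set contains every holomorphic
      self-map, so the subbasis covers the image.\<close>
    let ?V = "{f. holomorphic_self_map S f \<and> f ` {} \<subseteq> (UNIV :: (complex^'n) set)}"
    have "\<Phi> ` topspace (top_of_set {0..}) \<subseteq> ?V" using self by auto
    also have "?V \<subseteq> \<Union> {{f. holomorphic_self_map S f \<and> f ` K \<subseteq> U} |K U. compact K \<and> K \<subseteq> S \<and> open U}"
      by (intro Union_upper CollectI exI[of _ "{}"] exI[of _ UNIV]) simp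
    finally show "\<Phi> ` topspace (top_of_set {0..}) \<subseteq>
        \<Union> {{f. holomorphic_self_map S f \<and> f ` K \<subseteq> U} |K U. compact K \<and> K \<subseteq> S \<and> open U}" .
  qed
  thus ?thesis using assms(3,4) unfolding continuous_semigroup_def by blast
qed

section \<open>Embedding the normal form\<close>

lemma dim_block [simp]: "dim_vec (block i k x) = k"
  by (simp add: block_def)

lemma holomorphic_normal_map:
  fixes S :: "(complex^'n::finite) set"
  assumes N: "1 + p + q + r = CARD('n)"
    and a: "a \<in> carrier_vec p" and c: "c \<in> carrier_vec q" and D: "D \<in> carrier_mat r r" and A: "A \<in> carrier_mat q q"
  shows "holomorphic_map S (normal_map b a c D A)"
proof (rule holomorphic_mapI)
  fix j :: 'n
  note nth = normal_map_nth[OF N a c D A]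
  show "holomorphic_fun S (\<lambda>x. normal_map b a c D A x $h j)"
    by (cases rule: idx_cases[OF N, of j])
      (simp_all only: nth, (intro holomorphic_fun_intros)+)
qed

section \<open>The flow of D and the cocycle \<open>c\<^sub>t\<close>\<close>

lemma diagonal_mat_eigenvalue:
  fixes D :: "complex mat"
  assumes D: "D \<in> carrier_mat r r" and diag: "diagonal_mat D" and i: "i < r"
  shows "D $$ (i, i) \<in> spectrum D"
proof -
  have "D *\<^sub>v unit_vec r i = D $$ (i, i) \<cdot>\<^sub>v unit_vec r i"
    using D diag i by (intro eq_vecI) (auto simp: diagonal_mat_def)
  hence "eigenvector D (unit_vec r i) (D $$ (i, i))"
    using D i by (auto simp: eigenvector_def)
  thus ?thesis by (auto simp: spectrum_def eigenvalue_def)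
qed

text \<open>The one-parameter group of real powers of a diagonal unitary matrix with arguments
  \<theta>.\<close>

definition diag_flow :: "nat \<Rightarrow> (nat \<Rightarrow> real) \<Rightarrow> real \<Rightarrow> complex mat" where
  "diag_flow r \<theta> t = mat r r (\<lambda>(i, j). if i = j then cis (t * \<theta> i) else 0)"

lemma dim_diag_flow [simp]: "dim_row (diag_flow r \<theta> t) = r" "dim_col (diag_flow r \<theta> t) = r"
  by (simp_all add: diag_flow_def)

lemma diag_flow_carrier [simp]: "diag_flow r \<theta> t \<in> carrier_mat r r"
  by (simp add: diag_flow_def)

lemma diag_flow_mult_vec:
  assumes "v \<in> carrier_vec r" "i < r"
  shows "(diag_flow r \<theta> t *\<^sub>v v) $ i = cis (t * \<theta> i) * v $ i"
proof -
  have "(diag_flow r \<theta> t *\<^sub>v v) $ i = (\<Sum>l<r. (if l = i then cis (t * \<theta> i) * v $ i else 0))"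
    using assms unfolding index_mult_mat_vec_sum[OF diag_flow_carrier assms]
    by (intro sum.cong) (auto simp: diag_flow_def)
  thus ?thesis using assms by simp
qed

lemma diag_flow_add: "diag_flow r \<theta> (t + s) = diag_flow r \<theta> t * diag_flow r \<theta> s"
proof (rule eq_matI)
  fix i j assume "i < dim_row (diag_flow r \<theta> t * diag_flow r \<theta> s)" "j < dim_col (diag_flow r \<theta> t * diag_flow r \<theta> s)"
  hence ij: "i < r" "j < r" by (auto simp: diag_flow_def)
  have "(diag_flow r \<theta> t * diag_flow r \<theta> s) $$ (i, j) =
      (\<Sum>l<r. (if l = i then cis (t * \<theta> i) * diag_flow r \<theta> s $$ (i, j) else 0))"
    using ij unfolding index_mult_mat_sum[OF diag_flow_carrier diag_flow_carrier ij]
    by (intro sum.cong) (auto simp: diag_flow_def)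
  thus "diag_flow r \<theta> (t + s) $$ (i, j) = (diag_flow r \<theta> t * diag_flow r \<theta> s) $$ (i, j)"
    using ij by (auto simp: diag_flow_def cis_mult ring_distribs)
qed (auto simp: diag_flow_def)

lemma diag_flow_isometry:
  assumes "v \<in> carrier_vec r"
  shows "Re ((diag_flow r \<theta> t *\<^sub>v v) \<bullet>c (diag_flow r \<theta> t *\<^sub>v v)) = Re (v \<bullet>c v)"
proof -
  have "dim_vec (diag_flow r \<theta> t *\<^sub>v v) = r" by (simp add: diag_flow_def)
  thus ?thesis using assms
    by (simp add: cscalar_prod_self diag_flow_mult_vec norm_mult del: index_mult_mat_vec)
qed

lemma dim_mat_exp [simp]: "dim_row (mat_exp X) = dim_row X" "dim_col (mat_exp X) = dim_col X"
  by (simp_all add: mat_exp_def)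

text \<open>Replaces the partial function \<open>mat_inverse\<close> inside \<open>c_at\<close> by a
  genuine two-sided inverse \<open>B\<close>, the same one for all t.\<close>

lemma c_at_carrier:
  assumes M: "M \<in> carrier_mat q q" and c: "c \<in> carrier_vec q"
    and inv: "invertible_mat (1\<^sub>m q - mat_adjoint (mat_exp M))"
  obtains B where "B \<in> carrier_mat q q"
    "B * (1\<^sub>m q - mat_adjoint (mat_exp M)) = 1\<^sub>m q" "(1\<^sub>m q - mat_adjoint (mat_exp M)) * B = 1\<^sub>m q"
    "\<And>t. c_at M c t = B *\<^sub>v ((1\<^sub>m q - mat_adjoint (mat_exp (complex_of_real t \<cdot>\<^sub>m M))) *\<^sub>v c)"
proof -
  let ?K = "1\<^sub>m q - mat_adjoint (mat_exp M)"
  have K: "?K \<in> carrier_mat q q" using M by (intro minus_carrier_mat) simp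
  obtain B' where B': "inverts_mat ?K B'" "inverts_mat B' ?K"
    using inv by (auto simp: invertible_mat_def)
  have dimK: "dim_row ?K = q" "dim_col ?K = q" using carrier_matD[OF K] by blast+
  \<comment> \<open>\<open>inverts_mat\<close> does not prescribe the shape of \<open>B'\<close>.
    Comparing the dimensions of the products with those of the identity matrices forces it.\<close>
  have "dim_row B' = q"
    using arg_cong[OF B'(2)[unfolded inverts_mat_def], of dim_col] by (simp only: index_mult_mat index_one_mat dimK)
  moreover have "dim_col B' = q"
    using arg_cong[OF B'(1)[unfolded inverts_mat_def], of dim_col] by (simp only: index_mult_mat index_one_mat dimK)
  ultimately have B'c: "B' \<in> carrier_mat q q" by (rule carrier_matI)
  have KB': "?K * B' = 1\<^sub>m q" using B'(1) dimK(1) unfolding inverts_mat_def by (simp only:)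
  have BK': "B' * ?K = 1\<^sub>m q" using B'(2) carrier_matD(1)[OF B'c] unfolding inverts_mat_def by (simp only:)
  have "?K \<in> Units (ring_mat TYPE(complex) q ())"
    unfolding Units_def using K B'c KB' BK'
    by (intro CollectI conjI bexI[of _ B']) (simp_all only: ring_mat_def ring_record_simps monoid.simps partial_object.simps)
  hence "mat_inverse ?K \<noteq> None" using mat_inverse(1)[OF K, of "()"] by blast
  then obtain B where B: "mat_inverse ?K = Some B" by blast
  have *: "dim_row M = q" using M by simp
  have "c_at M c t = B *\<^sub>v ((1\<^sub>m q - mat_adjoint (mat_exp (complex_of_real t \<cdot>\<^sub>m M))) *\<^sub>v c)" for t
    unfolding c_at_def * B option.sel ..
  moreover have "B \<in> carrier_mat q q" "B * ?K = 1\<^sub>m q" "?K * B = 1\<^sub>m q"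
    using mat_inverse(2)[OF K B] by blast+
  ultimately show ?thesis by (intro that[of B])
qed

text \<open>The matrices F(t) commute with each other, hence with I - F(1) and with its inverse B.
  The law is then B applied to I - F(t+s) = (I - F(s)) + F(s)(I - F(t)): up to the factor B, the
  vector \<open>c_at\<close> is the coboundary of c under F. The factor B normalises the value at
  time 1 to c.\<close>

lemma c_at_add:
  assumes M: "M \<in> carrier_mat q q" and c: "c \<in> carrier_vec q"
    and inv: "invertible_mat (1\<^sub>m q - mat_adjoint (mat_exp M))"
  defines "F \<equiv> \<lambda>t. mat_adjoint (mat_exp (complex_of_real t \<cdot>\<^sub>m M))"
  shows "c_at M c t \<in> carrier_vec q"
    and "c_at M c (t + s) = c_at M c s + F s *\<^sub>v c_at M c t"
    and "c_at M c 0 = 0\<^sub>v q" and "c_at M c 1 = c"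
proof -
  obtain B where B: "B \<in> carrier_mat q q"
    and BK: "B * (1\<^sub>m q - mat_adjoint (mat_exp M)) = 1\<^sub>m q" and KB: "(1\<^sub>m q - mat_adjoint (mat_exp M)) * B = 1\<^sub>m q"
    and c_at: "\<And>t. c_at M c t = B *\<^sub>v ((1\<^sub>m q - F t) *\<^sub>v c)"
    using c_at_carrier[OF M c inv] unfolding F_def by metis
  have E: "mat_exp (complex_of_real t \<cdot>\<^sub>m M) \<in> carrier_mat q q" for t using M by simp
  have F: "F t \<in> carrier_mat q q" for t unfolding F_def using E by simp
  have F1: "F 1 = mat_adjoint (mat_exp M)"
  proof -
    have "1 \<cdot>\<^sub>m M = M" by (intro eq_matI) auto
    thus ?thesis by (simp add: F_def)
  qed
  have F0: "F 0 = 1\<^sub>m q" by (simp add: F_def mat_exp_zero_smult[OF M])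
  have Fadd: "F (t + s) = F s * F t" for t s
    using mat_adjoint_mult[OF E E, of t s] by (simp add: F_def mat_exp_add_smult[OF M])
  have Fcomm: "F s * F t = F t * F s" for t s
    using Fadd[of t s] Fadd[of s t] by (simp add: add.commute)
  define K where "K = 1\<^sub>m q - F 1"
  have K: "K \<in> carrier_mat q q" unfolding K_def by (rule minus_carrier_mat[OF F])
  have BK': "B * K = 1\<^sub>m q" and KB': "K * B = 1\<^sub>m q" using BK KB by (simp_all add: K_def F1)
  have FK: "F s * K = K * F s" for s
    unfolding K_def using F[of s] F[of 1] Fcomm[of s 1]
    by (simp add: mult_minus_distrib_mat[OF F one_carrier_mat F] minus_mult_distrib_mat[OF one_carrier_mat F F])
  have FB: "F s * B = B * F s" for s
  proof -
    have "F s * B = B * K * (F s * B)" using BK' F[of s] B by (simp add: left_mult_one_mat[of _ q q])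
    also have "\<dots> = B * (K * F s * B)" using B K F[of s] by (simp add: assoc_mult_mat[of _ q q _ q _ q])
    also have "\<dots> = B * (F s * K * B)" by (simp add: FK)
    also have "\<dots> = B * (F s * (K * B))" using B K F[of s] by (simp add: assoc_mult_mat[of _ q q _ q _ q])
    also have "\<dots> = B * F s" using KB' F[of s] by (simp add: right_mult_one_mat[of _ q q])
    finally show ?thesis .
  qed
  have IF: "1\<^sub>m q - F t \<in> carrier_mat q q" for t by (rule minus_carrier_mat[OF F])
  have IFc: "(1\<^sub>m q - F t) *\<^sub>v c \<in> carrier_vec q" for t by (rule mult_mat_vec_carrier[OF IF c])
  show cc: "c_at M c t \<in> carrier_vec q" unfolding c_at by (rule mult_mat_vec_carrier[OF B IFc])
  show "c_at M c 0 = 0\<^sub>v q"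
  proof -
    have "(1\<^sub>m q - F 0) *\<^sub>v c = 0\<^sub>v q"
      using minus_mult_distrib_mat_vec[of "1\<^sub>m q" q q "1\<^sub>m q" c] c by (simp add: F0)
    thus ?thesis unfolding c_at using B by (auto simp: scalar_prod_def intro!: eq_vecI)
  qed
  show "c_at M c 1 = c"
    unfolding c_at K_def[symmetric] using assoc_mult_mat_vec[OF B K c] BK' c by simp
  have "F s *\<^sub>v c_at M c t = (F s * B) *\<^sub>v ((1\<^sub>m q - F t) *\<^sub>v c)"
    unfolding c_at by (rule assoc_mult_mat_vec[OF F B IFc, symmetric])
  also have "\<dots> = B *\<^sub>v (F s *\<^sub>v ((1\<^sub>m q - F t) *\<^sub>v c))"
    unfolding FB by (rule assoc_mult_mat_vec[OF B F IFc])
  also have "F s *\<^sub>v ((1\<^sub>m q - F t) *\<^sub>v c) = (F s * (1\<^sub>m q - F t)) *\<^sub>v c"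
    by (rule assoc_mult_mat_vec[OF F IF c, symmetric])
  also have "F s * (1\<^sub>m q - F t) = F s - F (t + s)"
    using F[of s] F[of t] by (simp add: mult_minus_distrib_mat[OF F one_carrier_mat F] Fadd)
  finally have "c_at M c s + F s *\<^sub>v c_at M c t = B *\<^sub>v ((1\<^sub>m q - F s) *\<^sub>v c) + B *\<^sub>v ((F s - F (t + s)) *\<^sub>v c)"
    by (simp add: c_at)
  also have "\<dots> = B *\<^sub>v ((1\<^sub>m q - F s) *\<^sub>v c + (F s - F (t + s)) *\<^sub>v c)"
    by (rule mult_add_distrib_mat_vec[OF B IFc, symmetric], rule mult_mat_vec_carrier[OF minus_carrier_mat[OF F] c])
  also have "(1\<^sub>m q - F s) *\<^sub>v c + (F s - F (t + s)) *\<^sub>v c = ((1\<^sub>m q - F s) + (F s - F (t + s))) *\<^sub>v c"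
    by (rule add_mult_distrib_mat_vec[OF IF minus_carrier_mat[OF F] c, symmetric])
  also have "(1\<^sub>m q - F s) + (F s - F (t + s)) = 1\<^sub>m q - F (t + s)"
    using F[of s] F[of "t + s"] by (intro eq_matI) auto
  finally show "c_at M c (t + s) = c_at M c s + F s *\<^sub>v c_at M c t" by (simp add: c_at)
qed

lemma continuous_on_c_at:
  assumes M: "M \<in> carrier_mat q q" and c: "c \<in> carrier_vec q" and i: "i < q"
    and inv: "invertible_mat (1\<^sub>m q - mat_adjoint (mat_exp M))"
  shows "continuous_on UNIV (\<lambda>t. c_at M c t $ i)"
proof -
  obtain B where B: "B \<in> carrier_mat q q"
    and c_at: "\<And>t. c_at M c t = B *\<^sub>v ((1\<^sub>m q - mat_adjoint (mat_exp (complex_of_real t \<cdot>\<^sub>m M))) *\<^sub>v c)"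
    using c_at_carrier[OF M c inv] by metis
  have K: "1\<^sub>m q - mat_adjoint (mat_exp (complex_of_real t \<cdot>\<^sub>m M)) \<in> carrier_mat q q" for t
    by (rule minus_carrier_mat) (use M in simp)
  have "c_at M c t $ i = (\<Sum>j<q. B $$ (i, j) *
      (\<Sum>k<q. (1\<^sub>m q $$ (j, k) - cnj (mat_exp (complex_of_real t \<cdot>\<^sub>m M) $$ (k, j))) * c $ k))" for t
    using M i unfolding c_at index_mult_mat_vec_sum[OF B mult_mat_vec_carrier[OF K c] i]
    by (intro sum.cong refl) (simp add: index_mult_mat_vec_sum[OF K c] del: index_mult_mat_vec)
  thus ?thesis by (auto intro!: continuous_intros continuous_on_mat_exp[OF M])
qed

lemma embeddable_normal_map:
  fixes b :: complex
  assumes data: "normal_form_data CARD('n::finite) b a c D A"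
    and inv: "invertible_mat (1\<^sub>m (dim_row A) - mat_adjoint A)"
    and M: "M \<in> carrier_mat (dim_row A) (dim_row A)" and exp: "mat_exp M = A"
    and diss: "dissipative M"
    and bt: "\<And>t. t \<ge> 0 \<Longrightarrow> t * (Im b - Re (a \<bullet>c a)) \<ge> pinv_form (Q_at M t) (c_at M c t)"
    and ct: "\<And>t. t \<ge> 0 \<Longrightarrow> Q_at M t * pseudo_inverse (Q_at M t) *\<^sub>v c_at M c t = c_at M c t"
  shows "embeddable_into_semigroup (siegel :: (complex^'n) set) (normal_map b a c D A)"
proof -
  obtain p q r where N: "1 + p + q + r = CARD('n)"
    and a: "a \<in> carrier_vec p" and c: "c \<in> carrier_vec q" and D: "D \<in> carrier_mat r r" and A: "A \<in> carrier_mat q q"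
    and diag: "diagonal_mat D" and spec: "spectrum D \<subseteq> sphere 0 1 - {1}"
    using data unfolding normal_form_data_def by blast
  have M: "M \<in> carrier_mat q q" and inv: "invertible_mat (1\<^sub>m q - mat_adjoint (mat_exp M))"
    using M A inv exp by auto
  note c_at = c_at_add[OF M c inv]
  \<comment> \<open>A logarithm of D: its entries are eigenvalues and therefore unimodular. Any
    branch of the argument would do.\<close>
  define \<theta> where "\<theta> i = Arg (D $$ (i, i))" for i
  define E where "E t = mat_exp (complex_of_real t \<cdot>\<^sub>m M)" for t
  have E: "E t \<in> carrier_mat q q" for t using M by (simp add: E_def)
  define \<alpha> where "\<alpha> = Re (a \<bullet>c a)"
  have \<alpha>: "a \<bullet>c a = of_real \<alpha>" by (simp add: \<alpha>_def cscalar_prod_self)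
  \<comment> \<open>Since (t+s)^2 - t^2 - s^2 = 2ts, the t^2 term absorbs the cocycle 2i<sa,ta> of
    \<open>normal_map_comp\<close>; subtracting t restores the value b at t = 1. Moreover Im
    \<beta>(t) - |ta|^2 = t(Im b - |a|^2), which is what \<open>bt\<close> bounds from
    below.\<close>
  define \<beta> where "\<beta> t = of_real t * b + \<i> * of_real ((t\<^sup>2 - t) * \<alpha>)" for t
  define \<Phi> :: "real \<Rightarrow> complex^'n \<Rightarrow> complex^'n" where
    "\<Phi> t = normal_map (\<beta> t) (of_real t \<cdot>\<^sub>v a) (c_at M c t) (diag_flow r \<theta> t) (E t)" for t
  have ta: "of_real t \<cdot>\<^sub>v a \<in> carrier_vec p" for t using a by simp
  have D1: "diag_flow r \<theta> 1 = D"
  proof (rule eq_matI)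
    fix i j assume "i < dim_row D" "j < dim_col D"
    hence ij: "i < r" "j < r" using D by auto
    have "cmod (D $$ (i, i)) = 1" using diagonal_mat_eigenvalue[OF D diag ij(1)] spec by auto
    hence "cis (\<theta> i) = D $$ (i, i)" unfolding \<theta>_def
      by (metis cis_Arg norm_zero zero_neq_one sgn_div_norm scaleR_one inverse_1)
    thus "diag_flow r \<theta> 1 $$ (i, j) = D $$ (i, j)"
      using ij diag D by (auto simp: diag_flow_def diagonal_mat_def)
  qed (use D in \<open>auto simp: diag_flow_def\<close>)
  have E1: "E 1 = A"
  proof -
    have "1 \<cdot>\<^sub>m M = M" by (intro eq_matI) auto
    thus ?thesis by (simp add: E_def exp)
  qed
  have "continuous_semigroup siegel \<Phi>"
  proof (rule continuous_semigroupI)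
    fix t :: real assume t: "t \<ge> 0"
    have Q: "Q_at M t = 1\<^sub>m q - mat_adjoint (E t) * E t" using M by (simp add: Q_at_def E_def)
    have "\<Phi> t x \<in> siegel" if "x \<in> siegel" for x
      unfolding \<Phi>_def
    proof (rule normal_map_siegel[OF N ta c_at(1) diag_flow_carrier E])
      show "Re ((diag_flow r \<theta> t *\<^sub>v v) \<bullet>c (diag_flow r \<theta> t *\<^sub>v v)) \<le> Re (v \<bullet>c v)" if "v \<in> carrier_vec r" for v
        using diag_flow_isometry[OF that] by simp
      show "hermitian_psd (1\<^sub>m q - mat_adjoint (E t) * E t)"
        unfolding E_def by (intro hermitian_psd_defect dissipative_mat_exp_contraction[OF M diss t]) (use M in auto)
      have "Im (\<beta> t) - Re ((of_real t \<cdot>\<^sub>v a) \<bullet>c (of_real t \<cdot>\<^sub>v a)) = t * (Im b - Re (a \<bullet>c a))"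
        using a by (simp add: cscalar_prod_smult_left[of _ p] cscalar_prod_smult_right[of _ p] \<alpha> \<beta>_def
            power2_eq_square algebra_simps)
      thus "pinv_form (1\<^sub>m q - mat_adjoint (E t) * E t) (c_at M c t) \<le>
          Im (\<beta> t) - Re ((of_real t \<cdot>\<^sub>v a) \<bullet>c (of_real t \<cdot>\<^sub>v a))"
        using bt[OF t] by (simp add: Q)
      show "(1\<^sub>m q - mat_adjoint (E t) * E t) * pseudo_inverse (1\<^sub>m q - mat_adjoint (E t) * E t) *\<^sub>v c_at M c t = c_at M c t"
        using ct[OF t] by (simp add: Q)
    qed (fact that)
    moreover have "holomorphic_map siegel (\<Phi> t)"
      unfolding \<Phi>_def by (rule holomorphic_normal_map[OF N ta c_at(1) diag_flow_carrier E])
    ultimately show "holomorphic_self_map siegel (\<Phi> t)" by (auto simp: holomorphic_self_map_def)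
  next
    have cont\<beta>: "continuous_on UNIV \<beta>" unfolding \<beta>_def by (intro continuous_intros)
    have contE: "continuous_on UNIV (\<lambda>z. E (fst z) $$ (i, j))" if "i < q" "j < q" for i j
      unfolding E_def
      by (rule continuous_on_compose2[OF continuous_on_mat_exp[OF M that, of UNIV]]) (auto intro: continuous_intros)
    have contc: "continuous_on UNIV (\<lambda>z. c_at M c (fst z) $ i)" if "i < q" for i
      by (rule continuous_on_compose2[OF continuous_on_c_at[OF M c that inv]]) (auto intro: continuous_intros)
    have contD: "continuous_on UNIV (\<lambda>z. diag_flow r \<theta> (fst z) $$ (i, j))" if "i < r" "j < r" for i j
      using that by (cases "i = j") (auto simp: diag_flow_def intro!: continuous_intros)
    have conta: "continuous_on UNIV (\<lambda>z. (of_real (fst z) \<cdot>\<^sub>v a) $ i)" if "i < p" for i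
      using that a by (auto intro!: continuous_intros)
    have cont\<beta>': "continuous_on UNIV (\<lambda>z. \<beta> (fst z))"
      by (rule continuous_on_compose2[OF cont\<beta>]) (auto intro: continuous_intros)
    note nth = normal_map_nth[OF N ta c_at(1) diag_flow_carrier E]
    have "continuous_on UNIV (\<lambda>z. \<Phi> (fst z) (snd z) $h k)" for k
    proof (cases rule: idx_cases[OF N, of k])
      case 1
      show ?thesis unfolding \<Phi>_def 1 nth by (intro continuous_intros conta contc cont\<beta>') simp_all
    next
      case (2 i)
      show ?thesis unfolding \<Phi>_def 2 nth(2)[OF 2(1)] by (intro continuous_intros conta 2)
    next
      case (3 i)
      show ?thesis unfolding \<Phi>_def 3 nth(3)[OF 3(1)] by (intro continuous_intros contD 3) simp
    next
      case (4 i)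
      show ?thesis unfolding \<Phi>_def 4 nth(4)[OF 4(1)] by (intro continuous_intros contE 4) simp
    qed
    hence "continuous_on UNIV (\<lambda>z. \<chi> k. \<Phi> (fst z) (snd z) $h k)" by (intro continuous_on_vec_lambda)
    thus "continuous_on UNIV (\<lambda>z. \<Phi> (fst z) (snd z))" by simp
  next
    fix x :: "complex^'n"
    show "\<Phi> 0 x = x"
      unfolding \<Phi>_def
      by (rule eq_blockI[OF N], unfold block_normal_map[OF N ta diag_flow_carrier E])
        (use a in \<open>auto simp: \<beta>_def c_at(3) E_def mat_exp_zero_smult[OF M] cscalar_prod_sum
          diag_flow_mult_vec[OF block_carrier] simp del: index_mult_mat_vec intro!: eq_vecI\<close>)
  next
    fix s t :: real and x :: "complex^'n"
    have "\<Phi> t (\<Phi> s x) = normal_map (\<beta> t + \<beta> s + 2 * \<i> * ((of_real s \<cdot>\<^sub>v a) \<bullet>c (of_real t \<cdot>\<^sub>v a)))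
      (of_real t \<cdot>\<^sub>v a + of_real s \<cdot>\<^sub>v a) (c_at M c s + mat_adjoint (E s) *\<^sub>v c_at M c t)
      (diag_flow r \<theta> t * diag_flow r \<theta> s) (E t * E s) x"
      unfolding \<Phi>_def
      by (rule normal_map_comp[OF N ta c_at(1) diag_flow_carrier E ta c_at(1) diag_flow_carrier E])
    also have "\<beta> t + \<beta> s + 2 * \<i> * ((of_real s \<cdot>\<^sub>v a) \<bullet>c (of_real t \<cdot>\<^sub>v a)) = \<beta> (t + s)"
      using a by (simp add: cscalar_prod_smult_left[of _ p] cscalar_prod_smult_right[of _ p] \<alpha> \<beta>_def
            power2_eq_square algebra_simps)
    also have "of_real t \<cdot>\<^sub>v a + of_real s \<cdot>\<^sub>v a = of_real (t + s) \<cdot>\<^sub>v a"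
      using a by (intro eq_vecI) (auto simp: algebra_simps)
    also have "c_at M c s + mat_adjoint (E s) *\<^sub>v c_at M c t = c_at M c (t + s)"
      by (simp add: c_at(2) E_def)
    also have "diag_flow r \<theta> t * diag_flow r \<theta> s = diag_flow r \<theta> (t + s)" by (simp add: diag_flow_add)
    also have "E t * E s = E (t + s)" by (simp add: E_def mat_exp_add_smult[OF M])
    finally show "\<Phi> (t + s) x = \<Phi> t (\<Phi> s x)" by (simp add: \<Phi>_def)
  qed
  moreover have "\<Phi> 1 x = normal_map b a c D A x" for x
  proof -
    have "\<beta> 1 = b" "complex_of_real 1 \<cdot>\<^sub>v a = a" by (auto simp: \<beta>_def intro: eq_vecI)
    thus ?thesis by (simp only: \<Phi>_def D1 E1 c_at(4))
  qed
  ultimately show ?thesis unfolding embeddable_into_semigroup_def by blast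
qed

section \<open>Unitary matrices and Heisenberg translations\<close>

abbreviation "e\<^sub>0 \<equiv> axis (idx 0) 1 :: complex^'n::finite"

lemma hprod_add_left: "hprod (x + y) z = hprod x z + hprod y z"
  by (simp add: hprod_def sum.distrib algebra_simps)

lemma hprod_add_right: "hprod x (y + z) = hprod x y + hprod x z"
  by (simp add: hprod_def sum.distrib algebra_simps)

lemma hprod_diff_left: "hprod (x - y) z = hprod x z - hprod y z"
  by (simp add: hprod_def sum_subtractf algebra_simps)

lemma hprod_diff_right: "hprod x (y - z) = hprod x y - hprod x z"
  by (simp add: hprod_def sum_subtractf algebra_simps)

lemma hprod_smult_left: "hprod (k *s x) y = k * hprod x y"
  by (simp add: hprod_def sum_distrib_left algebra_simps)

lemma hprod_smult_right: "hprod x (k *s y) = cnj k * hprod x y"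
  by (simp add: hprod_def sum_distrib_left algebra_simps)

lemma hprod_0_left [simp]: "hprod 0 y = 0"
  by (simp add: hprod_def)

lemma hprod_0_right [simp]: "hprod x 0 = 0"
  by (simp add: hprod_def)

lemma hprod_uminus_right: "hprod x (- y) = - hprod x y"
  by (simp add: hprod_def sum_negf)

lemma cnj_hprod: "cnj (hprod x y) = hprod y x"
  by (simp add: hprod_def mult.commute)

lemma hprod_axis_right: "hprod x (axis k 1) = x $h k"
  by (simp add: hprod_def axis_def if_distrib[of cnj] if_distrib[of "(*) _"] cong: if_cong)

lemma hprod_axis_left: "hprod (axis k 1) x = cnj (x $h k)"
  by (metis cnj_hprod hprod_axis_right)

lemma Re_hprod: "Re (hprod x y) = inner x y"
  by (simp add: hprod_def inner_vec_def inner_complex_def)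

lemma norm_sq_sum: "(norm (x :: complex^'n::finite))\<^sup>2 = (\<Sum>k\<in>UNIV. (cmod (x $h k))\<^sup>2)"
  by (simp add: norm_vec_def L2_set_def sum_nonneg)

lemma hprod_self: "hprod x x = of_real ((norm x)\<^sup>2)"
  by (simp add: norm_sq_sum hprod_def complex_norm_square[symmetric])

lemma norm_add_sq: "(norm (x + y :: complex^'n::finite))\<^sup>2 = (norm x)\<^sup>2 + 2 * Re (hprod x y) + (norm y)\<^sup>2"
  by (simp add: Re_hprod power2_norm_eq_inner inner_add_left inner_add_right inner_commute)

lemma norm_smult: "norm (k *s x :: complex^'n::finite) = cmod k * norm x"
proof -
  have "complex_of_real ((norm (k *s x))\<^sup>2) = k * cnj k * of_real ((norm x)\<^sup>2)"
    unfolding hprod_self[symmetric] by (simp add: hprod_smult_left hprod_smult_right)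
  also have "\<dots> = of_real ((cmod k * norm x)\<^sup>2)"
    by (simp add: complex_norm_square[symmetric] power_mult_distrib)
  finally have "(norm (k *s x))\<^sup>2 = (cmod k * norm x)\<^sup>2" unfolding of_real_eq_iff .
  thus ?thesis by simp
qed

section \<open>Adjoints, unitary matrices and completion of orthonormal systems\<close>

definition adj :: "complex^'n^'n::finite \<Rightarrow> complex^'n^'n" where
  "adj P = (\<chi> i j. cnj (P $h j $h i))"

lemma hprod_adj: "hprod (P *v x) y = hprod x (adj P *v (y :: complex^'n::finite))"
proof -
  have "hprod (P *v x) y = (\<Sum>i\<in>UNIV. \<Sum>j\<in>UNIV. P $h i $h j * x $h j * cnj (y $h i))"
    by (simp add: hprod_def matrix_vector_mult_def sum_distrib_right)
  also have "\<dots> = (\<Sum>j\<in>UNIV. \<Sum>i\<in>UNIV. P $h i $h j * x $h j * cnj (y $h i))"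
    by (rule sum.swap)
  also have "\<dots> = hprod x (adj P *v y)"
    by (simp add: hprod_def matrix_vector_mult_def sum_distrib_left adj_def mult_ac)
  finally show ?thesis .
qed

lemma hprod_adj': "hprod (adj P *v x) y = hprod x (P *v (y :: complex^'n::finite))"
  by (metis cnj_hprod hprod_adj)

lemma matrix_vector_mult_smult: "P *v (k *s x) = k *s (P *v (x :: complex^'n::finite))"
  by (simp add: matrix_vector_mult_def Finite_Cartesian_Product.vec_eq_iff sum_distrib_left mult_ac)

definition unitary :: "complex^'n^'n::finite \<Rightarrow> bool" where
  "unitary P \<longleftrightarrow> (\<forall>x. adj P *v (P *v x) = x) \<and> (\<forall>x. P *v (adj P *v x) = x)"

lemma unitary_norm:
  assumes "unitary P"
  shows "norm (P *v x) = norm x" and "norm (adj P *v x) = norm x"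
proof -
  have "hprod (P *v x) (P *v x) = hprod x x" "hprod (adj P *v x) (adj P *v x) = hprod x x"
    using assms unfolding unitary_def by (metis hprod_adj, metis hprod_adj')
  hence "(norm (P *v x))\<^sup>2 = (norm x)\<^sup>2" "(norm (adj P *v x))\<^sup>2 = (norm x)\<^sup>2"
    unfolding hprod_self of_real_eq_iff by simp_all
  thus "norm (P *v x) = norm x" and "norm (adj P *v x) = norm x" by simp_all
qed

text \<open>Complex orthogonality to m vectors is real orthogonality to these vectors and their
  multiples by i. These are at most 2m vectors in real dimension 2N.\<close>

lemma ex_orthogonal_vector:
  fixes f :: "nat \<Rightarrow> complex^'n::finite"
  assumes m: "m < CARD('n)"
  obtains v where "norm v = 1" "\<And>i. i < m \<Longrightarrow> hprod v (f i) = 0"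
proof -
  define B where "B = f ` {..<m} \<union> (\<lambda>i. \<i> *s f i) ` {..<m}"
  have "card B \<le> m + m"
    unfolding B_def by (rule order_trans[OF card_Un_le]) (intro add_mono, (rule order_trans[OF card_image_le]; simp)+)
  moreover have "dim B \<le> card B" by (rule dim_le_card') (simp add: B_def)
  ultimately have "dim B < DIM(complex^'n)" using m by simp
  then obtain x where x: "x \<noteq> 0" "\<And>y. y \<in> span B \<Longrightarrow> real_inner_class.orthogonal x y"
    using orthogonal_to_subspace_exists[of B] by blast
  have "hprod x (f i) = 0" if "i < m" for i
  proof -
    have "f i \<in> span B" "\<i> *s f i \<in> span B" using that by (auto simp: B_def intro!: span_base)
    hence "Re (hprod x (f i)) = 0" "Re (hprod x (\<i> *s f i)) = 0"
      using x(2) by (auto simp: Re_hprod real_inner_class.orthogonal_def)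
    thus ?thesis by (simp add: hprod_smult_right complex_eq_iff)
  qed
  thus ?thesis using x(1)
    by (intro that[of "of_real (inverse (norm x)) *s x"])
      (simp_all add: hprod_smult_left norm_smult norm_inverse)
qed

text \<open>The system is completed one vector at a time and becomes the columns of P.
  Orthonormality says that \<open>adj P\<close> is a left inverse, and for a square matrix a left
  inverse is also a right one.\<close>

lemma unitary_extension:
  fixes f :: "nat \<Rightarrow> complex^'n::finite"
  assumes m: "m \<le> CARD('n)"
    and ortho: "\<And>i j. i < m \<Longrightarrow> j < m \<Longrightarrow> hprod (f i) (f j) = (if i = j then 1 else 0)"
  obtains P where "unitary P" "\<And>i. i < m \<Longrightarrow> P *v axis (idx i) 1 = f i"
proof -
  have "\<exists>g. (\<forall>i<m + d. \<forall>j<m + d. hprod (g i) (g j) = (if i = j then 1 else 0)) \<and> (\<forall>i<m. g i = f i)"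
    if "m + d \<le> CARD('n)" for d
    using that
  proof (induction d)
    case 0
    show ?case using ortho by (intro exI[of _ f]) simp
  next
    case (Suc d)
    then obtain g where g: "\<And>i j. i < m + d \<Longrightarrow> j < m + d \<Longrightarrow> hprod (g i) (g j) = (if i = j then 1 else 0)"
      "\<And>i. i < m \<Longrightarrow> g i = f i" by auto
    obtain v where v: "norm v = 1" "\<And>i. i < m + d \<Longrightarrow> hprod v (g i) = 0"
      using ex_orthogonal_vector[of "m + d" g] Suc.prems by auto
    have v': "hprod (g i) v = 0" if "i < m + d" for i using v(2)[OF that] by (metis cnj_hprod complex_cnj_zero)
    have "hprod v v = 1" using v(1) by (simp add: hprod_self)
    thus ?case using g v v' by (intro exI[of _ "g(m + d := v)"]) (auto simp: less_Suc_eq)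
  qed
  from this[of "CARD('n) - m"] m obtain g
    where g: "\<And>i j. i < CARD('n) \<Longrightarrow> j < CARD('n) \<Longrightarrow> hprod (g i) (g j) = (if i = j then 1 else 0)"
      and gf: "\<And>i. i < m \<Longrightarrow> g i = f i" by auto
  define P :: "complex^'n^'n" where "P = (\<chi> k j. g (to_nat_on UNIV j) $h k)"
  have col: "P *v axis (idx i) 1 = g i" if "i < CARD('n)" for i
    using that by (simp add: P_def matrix_vector_mult_def axis_def to_nat_on_idx Finite_Cartesian_Product.vec_eq_iff
        if_distrib[of "(*) _"] cong: if_cong)
  have "adj P ** P = Finite_Cartesian_Product.mat 1"
  proof (rule Finite_Cartesian_Product.vec_eq_iff[THEN iffD2, rule_format],
      rule Finite_Cartesian_Product.vec_eq_iff[THEN iffD2, rule_format])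
    fix k l :: 'n
    obtain i where i: "i < CARD('n)" "k = idx i" by (rule ex_idx)
    obtain j where j: "j < CARD('n)" "l = idx j" by (rule ex_idx)
    have "(adj P ** P) $h k $h l = hprod (g j) (g i)"
      using i j by (simp add: matrix_matrix_mult_def adj_def P_def hprod_def to_nat_on_idx mult.commute)
    thus "(adj P ** P) $h k $h l = Finite_Cartesian_Product.mat 1 $h k $h l"
      using i j g by (auto simp: Finite_Cartesian_Product.mat_def idx_eq_iff)
  qed
  moreover from this have "P ** adj P = Finite_Cartesian_Product.mat 1"
    by (simp add: matrix_left_right_inverse)
  ultimately have "unitary P"
    by (simp add: unitary_def matrix_vector_mul_assoc)
  thus ?thesis using that[of P] col gf m by auto
qed

text \<open>The defining function Im z - |Z|^2 of the half-plane, positive exactly inside. Writing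
  it with the full norm makes its invariance under unitaries that fix \<open>e\<^sub>0\<close>
  immediate.\<close>

definition height :: "complex^'n::finite \<Rightarrow> real" where
  "height y = Im (y $h idx 0) + (cmod (y $h idx 0))\<^sup>2 - (norm y)\<^sup>2"

lemma siegel_iff_height: "y \<in> siegel \<longleftrightarrow> height y > 0"
proof -
  have "(norm y)\<^sup>2 = (cmod (y $h idx 0))\<^sup>2 + (\<Sum>i\<in>UNIV - {idx 0}. (cmod (y $h i))\<^sup>2)"
    unfolding norm_sq_sum by (simp add: sum.remove)
  thus ?thesis unfolding siegel_iff height_def by linarith
qed

lemma height_add_e0:
  fixes x :: "complex^'n::finite"
  assumes "x $h idx 0 = 0"
  shows "height (x + k *s e\<^sub>0) = Im k - (norm x)\<^sup>2"
proof -
  have "(norm (x + k *s e\<^sub>0))\<^sup>2 = (norm x)\<^sup>2 + (norm (k *s e\<^sub>0 :: complex^'n))\<^sup>2"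
    using assms by (simp add: norm_add_sq hprod_smult_right hprod_axis_right)
  also have "(norm (k *s e\<^sub>0 :: complex^'n))\<^sup>2 = (cmod k)\<^sup>2" by (simp add: norm_smult)
  finally show ?thesis using assms by (simp add: height_def)
qed

lemma open_siegel: "open (siegel :: (complex^'n::finite) set)"
proof -
  have "open {y :: complex^'n. 0 < height y}"
    unfolding height_def by (intro open_Collect_less continuous_intros)
  moreover have "siegel = {y :: complex^'n. 0 < height y}" by (auto simp: siegel_iff_height)
  ultimately show ?thesis by simp
qed

text \<open>For \<alpha> without \<open>e\<^sub>0\<close> component this is the translation (z, Z)
  to (z + 2i<Z,\<alpha>> + i|\<alpha>|^2, Z + \<alpha>) of the Heisenberg group. The correction in z
  compensates the growth of |Z + \<alpha>|^2, so the height is preserved.\<close>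

definition heis :: "complex^'n \<Rightarrow> complex^'n \<Rightarrow> complex^'n::finite" where
  "heis \<alpha> y = y + \<alpha> + (2 * \<i> * hprod y \<alpha> + \<i> * of_real ((norm \<alpha>)\<^sup>2)) *s e\<^sub>0"

lemma heis_inverse:
  assumes "\<alpha> $h idx 0 = 0"
  shows "heis (- \<alpha>) (heis \<alpha> y) = y"
proof -
  define k where "k = 2 * \<i> * hprod y \<alpha> + \<i> * complex_of_real ((norm \<alpha>)\<^sup>2)"
  have y: "heis \<alpha> y = y + \<alpha> + k *s e\<^sub>0" by (simp only: heis_def k_def)
  have "hprod (heis \<alpha> y) \<alpha> = hprod y \<alpha> + of_real ((norm \<alpha>)\<^sup>2)"
    using assms by (simp only: y hprod_add_left hprod_smult_left hprod_self hprod_axis_left) simp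
  hence "2 * \<i> * hprod (heis \<alpha> y) (- \<alpha>) + \<i> * complex_of_real ((norm (- \<alpha>))\<^sup>2) = - k"
    by (simp only: hprod_uminus_right k_def norm_minus_cancel) (simp add: ring_distribs)
  hence "heis (- \<alpha>) (heis \<alpha> y) = heis \<alpha> y + - \<alpha> + (- k) *s e\<^sub>0"
    unfolding heis_def[of "- \<alpha>"] by (simp only:)
  also have "\<dots> = y" unfolding y by (simp add: Finite_Cartesian_Product.vec_eq_iff)
  finally show ?thesis .
qed

lemma height_heis:
  assumes "\<alpha> $h idx 0 = 0"
  shows "height (heis \<alpha> y) = height y"
proof -
  define x where "x = y - (y $h idx 0) *s e\<^sub>0"
  have x0: "x $h idx 0 = 0" by (simp add: x_def axis_def)
  have y: "y = x + (y $h idx 0) *s e\<^sub>0" by (simp add: x_def)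
  have hx: "hprod y \<alpha> = hprod x \<alpha>" using assms by (simp add: x_def hprod_diff_left hprod_smult_left hprod_axis_left)
  have "heis \<alpha> y = (x + \<alpha>) + (y $h idx 0 + (2 * \<i> * hprod y \<alpha> + \<i> * of_real ((norm \<alpha>)\<^sup>2))) *s e\<^sub>0"
    unfolding heis_def by (subst (1) y) (simp add: vector_sadd_rdistrib)
  hence "height (heis \<alpha> y) =
      Im (y $h idx 0 + (2 * \<i> * hprod y \<alpha> + \<i> * of_real ((norm \<alpha>)\<^sup>2))) - (norm (x + \<alpha>))\<^sup>2"
    using x0 assms by (simp only: height_add_e0 vector_add_component add_0)
  hence "height (heis \<alpha> y) = Im (y $h idx 0) + 2 * Re (hprod y \<alpha>) + (norm \<alpha>)\<^sup>2 - (norm (x + \<alpha>))\<^sup>2"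
    by (simp add: power2_eq_square)
  also have "\<dots> = Im (y $h idx 0) - (norm x)\<^sup>2" by (simp add: norm_add_sq hx)
  also have "\<dots> = height y" using height_add_e0[OF x0, of "y $h idx 0"] y by simp
  finally show ?thesis .
qed

lemma holomorphic_heis: "holomorphic_map S (heis \<alpha>)"
  unfolding heis_def hprod_def
  by (rule holomorphic_mapI) (simp, intro holomorphic_fun_intros)

lemma holomorphic_matrix: "holomorphic_map S ((*v) P)"
  unfolding matrix_vector_mult_def
  by (rule holomorphic_mapI) (simp, intro holomorphic_fun_intros)

lemma unitary_fixing_e0:
  assumes "unitary P" "P *v e\<^sub>0 = e\<^sub>0"
  shows "adj P *v e\<^sub>0 = e\<^sub>0" "(P *v y) $h idx 0 = y $h idx 0" "(adj P *v y) $h idx 0 = y $h idx 0"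
    "height (P *v y) = height y" "height (adj P *v y) = height y"
proof -
  show 1: "adj P *v e\<^sub>0 = e\<^sub>0" using assms by (metis unitary_def)
  show 2: "(P *v y) $h idx 0 = y $h idx 0" "(adj P *v y) $h idx 0 = y $h idx 0" for y
    using assms(2) 1 by (metis hprod_axis_right hprod_adj, metis hprod_axis_right hprod_adj')
  show "height (P *v y) = height y" "height (adj P *v y) = height y"
    using 2 unitary_norm[OF assms(1)] by (simp_all add: height_def)
qed

section \<open>The Cayley transform\<close>

text \<open>In coordinates z = i(1 + x_0)/(1 - x_0) and Z = i x'/(1 - x_0): adding
  \<open>e\<^sub>0\<close> to x treats both at once. The point \<open>e\<^sub>0\<close> goes to
  infinity and the centre of the ball to i \<open>e\<^sub>0\<close>.\<close>

definition cayley :: "complex^'n \<Rightarrow> complex^'n::finite" where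
  "cayley x = (\<i> / (1 - x $h idx 0)) *s (x + e\<^sub>0)"

definition cayley_inv :: "complex^'n \<Rightarrow> complex^'n::finite" where
  "cayley_inv y = (2 / (y $h idx 0 + \<i>)) *s y - e\<^sub>0"

lemma cayley_nth: "cayley x $h k = \<i> / (1 - x $h idx 0) * (x $h k + e\<^sub>0 $h k)"
  by (simp only: cayley_def vector_smult_component vector_add_component)

lemma unit_ball_nth_neq_1: "x \<in> unit_ball \<Longrightarrow> x $h k \<noteq> 1"
  using Finite_Cartesian_Product.norm_nth_le[of x k] by auto

lemma siegel_Im_pos: "y \<in> siegel \<Longrightarrow> Im (y $h idx 0) > 0"
  unfolding siegel_iff by (rule order.strict_trans1[rotated]) (auto intro: sum_nonneg)

lemma siegel_neq_minus_i: "y \<in> siegel \<Longrightarrow> y $h idx 0 + \<i> \<noteq> 0"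
  using siegel_Im_pos[of y] by (auto simp: complex_eq_iff)

lemma one_minus_cayley_inv:
  "y \<in> siegel \<Longrightarrow> 1 - cayley_inv y $h idx 0 = 2 * \<i> / (y $h idx 0 + \<i>)"
  using siegel_neq_minus_i[of y] by (simp add: cayley_inv_def field_simps)

text \<open>This identity carries positivity from the ball to the half-plane. Its inverse form
  \<open>height_eq\<close> also turns the dilation quotient into a quotient of heights.\<close>

lemma height_cayley:
  fixes x :: "complex^'n::finite"
  assumes "x $h idx 0 \<noteq> 1"
  shows "(cmod (1 - x $h idx 0))\<^sup>2 * height (cayley x) = 1 - (norm x)\<^sup>2"
proof -
  define z where "z = x $h idx 0"
  have z: "1 - z \<noteq> 0" using assms by (simp add: z_def)
  have 0: "cayley x $h idx 0 = \<i> * (1 + z) / (1 - z)" by (simp only: cayley_nth z_def) simp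
  have "Im (cayley x $h idx 0) * (cmod (1 - z))\<^sup>2 = Re ((1 + z) * cnj (1 - z))"
    unfolding 0 using z by (simp add: complex_div_cnj[of _ "1 - z"] Im_divide_of_real cmod_power2)
  also have "\<dots> = 1 - (cmod z)\<^sup>2" unfolding cmod_power2 by (simp add: power2_eq_square algebra_simps)
  finally have 1: "Im (cayley x $h idx 0) * (cmod (1 - z))\<^sup>2 = 1 - (cmod z)\<^sup>2" .
  have 2: "(cmod (cayley x $h idx 0))\<^sup>2 * (cmod (1 - z))\<^sup>2 = (cmod (1 + z))\<^sup>2"
    unfolding 0 using z by (simp add: norm_mult norm_divide power_divide)
  have "(norm (cayley x))\<^sup>2 * (cmod (1 - z))\<^sup>2 = (norm (x + e\<^sub>0))\<^sup>2"
    unfolding cayley_def norm_smult z_def[symmetric] using z by (simp add: norm_divide power_divide power_mult_distrib)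
  also have "\<dots> = (norm x)\<^sup>2 + 2 * Re z + 1" by (simp add: norm_add_sq hprod_axis_right z_def)
  finally have 3: "(norm (cayley x))\<^sup>2 * (cmod (1 - z))\<^sup>2 = (norm x)\<^sup>2 + 2 * Re z + 1" .
  have 4: "(cmod (1 + z))\<^sup>2 = 1 + 2 * Re z + (cmod z)\<^sup>2" unfolding cmod_power2 by (simp add: power2_eq_square algebra_simps)
  show ?thesis using 1 2 3 4 unfolding height_def z_def[symmetric] by (simp add: algebra_simps)
qed

lemma cayley_siegel: "x \<in> unit_ball \<Longrightarrow> cayley x \<in> siegel"
proof -
  assume x: "x \<in> unit_ball"
  hence "(norm x)\<^sup>2 < 1" by (simp add: power_less_one_iff abs_square_less_1)
  thus "cayley x \<in> siegel"
    using height_cayley[OF unit_ball_nth_neq_1[OF x], symmetric]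
    unfolding siegel_iff_height by (metis diff_gt_0_iff_gt zero_less_mult_pos zero_le_power2 less_eq_real_def mult_zero_left)
qed

lemma cayley_cayley_inv:
  assumes "y \<in> siegel"
  shows "cayley (cayley_inv y) = y"
proof -
  define k where "k = y $h idx 0 + \<i>"
  have "k \<noteq> 0" using siegel_neq_minus_i[OF assms] by (simp add: k_def)
  hence k: "\<i> / (2 * \<i> / k) * (2 / k) = 1" by simp
  have "cayley (cayley_inv y) = (\<i> / (2 * \<i> / k)) *s ((2 / k) *s y)"
    unfolding cayley_def one_minus_cayley_inv[OF assms] k_def[symmetric] by (simp add: cayley_inv_def k_def)
  also have "\<dots> = y" unfolding vector_smult_assoc k by simp
  finally show ?thesis .
qed

lemma cayley_inv_cayley:
  assumes "x $h idx 0 \<noteq> 1"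
  shows "cayley_inv (cayley x) = x"
proof -
  define d where "d = 1 - x $h idx 0"
  have d: "2 / (2 * \<i> / d) * (\<i> / d) = 1" using assms by (simp add: d_def)
  have "cayley x $h idx 0 = \<i> / d * (x $h idx 0 + 1)" by (simp only: cayley_nth d_def) simp
  also have "\<dots> + \<i> = 2 * \<i> / d" using assms by (simp add: d_def field_simps)
  finally have "cayley_inv (cayley x) = (2 / (2 * \<i> / d)) *s ((\<i> / d) *s (x + e\<^sub>0)) - e\<^sub>0"
    unfolding cayley_inv_def by (simp only: cayley_def d_def)
  also have "\<dots> = x" unfolding vector_smult_assoc d by simp
  finally show ?thesis .
qed

text \<open>\<open>height_cayley\<close> read from the other side, where 1 - x_0 becomes 2i/(y_0 +
  i).\<close>

lemma height_eq:
  assumes "y \<in> siegel"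
  shows "4 * height y = (cmod (y $h idx 0 + \<i>))\<^sup>2 * (1 - (norm (cayley_inv y))\<^sup>2)"
proof -
  have "cayley_inv y $h idx 0 \<noteq> 1"
    using one_minus_cayley_inv[OF assms] siegel_neq_minus_i[OF assms] by auto
  from height_cayley[OF this]
  have "1 - (norm (cayley_inv y))\<^sup>2 = (cmod (2 * \<i> / (y $h idx 0 + \<i>)))\<^sup>2 * height y"
    by (simp add: cayley_cayley_inv[OF assms] one_minus_cayley_inv[OF assms])
  thus ?thesis using siegel_neq_minus_i[OF assms] by (simp add: norm_divide norm_mult power_divide)
qed

lemma cayley_inv_ball: "y \<in> siegel \<Longrightarrow> cayley_inv y \<in> unit_ball"
proof -
  assume y: "y \<in> siegel"
  hence "0 < (cmod (y $h idx 0 + \<i>))\<^sup>2 * (1 - (norm (cayley_inv y))\<^sup>2)"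
    using height_eq[OF y] by (simp add: siegel_iff_height)
  hence "(norm (cayley_inv y))\<^sup>2 < 1" by (simp add: zero_less_mult_iff)
  thus "cayley_inv y \<in> unit_ball" by (simp add: abs_square_less_1)
qed

lemma holomorphic_cayley: "holomorphic_map unit_ball cayley"
proof (rule holomorphic_mapI)
  fix k
  have "(\<lambda>x :: complex^'a. cayley x $h k) = (\<lambda>x. \<i> * inverse (1 + (- 1) * x $h idx 0) * (x $h k + e\<^sub>0 $h k))"
    by (rule ext) (simp only: cayley_nth, simp add: divide_inverse)
  moreover have "holomorphic_fun unit_ball (\<lambda>x :: complex^'a. inverse (1 + (- 1) * x $h idx 0))"
    using unit_ball_nth_neq_1 by (intro holomorphic_fun_inverse holomorphic_fun_intros) auto
  ultimately show "holomorphic_fun unit_ball (\<lambda>x :: complex^'a. cayley x $h k)"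
    by (simp only:) (intro holomorphic_fun_intros)
qed

lemma holomorphic_cayley_inv: "holomorphic_map siegel cayley_inv"
proof (rule holomorphic_mapI)
  fix k
  have "(\<lambda>x :: complex^'a. cayley_inv x $h k) = (\<lambda>x. 2 * inverse (x $h idx 0 + \<i>) * x $h k + - (e\<^sub>0 $h k))"
    by (simp add: cayley_inv_def divide_inverse)
  moreover have "holomorphic_fun siegel (\<lambda>x :: complex^'a. inverse (x $h idx 0 + \<i>))"
    using siegel_neq_minus_i by (intro holomorphic_fun_inverse holomorphic_fun_intros) auto
  ultimately show "holomorphic_fun siegel (\<lambda>x :: complex^'a. cayley_inv x $h k)"
    by (simp only:) (intro holomorphic_fun_intros)
qed

section \<open>Affine functions, and affinity of the transformed map\<close>

definition affine_fun :: "(complex^'n::finite \<Rightarrow> complex) \<Rightarrow> bool" where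
  "affine_fun f \<longleftrightarrow> (\<exists>l c. \<forall>x. f x = hprod x l + c)"

lemma affine_fun_const: "affine_fun (\<lambda>x. c)"
  unfolding affine_fun_def by (intro exI[of _ 0] exI[of _ c]) simp

lemma affine_fun_hprod: "affine_fun (\<lambda>x. hprod x l)"
  unfolding affine_fun_def by (intro exI[of _ l] exI[of _ 0]) simp

lemma affine_fun_nth: "affine_fun (\<lambda>x. x $h k)"
  using affine_fun_hprod[of "axis k 1"] by (simp add: hprod_axis_right)

lemma affine_fun_add: "affine_fun f \<Longrightarrow> affine_fun g \<Longrightarrow> affine_fun (\<lambda>x. f x + g x)"
  unfolding affine_fun_def
proof (elim exE)
  fix l c l' c' assume "\<forall>x. f x = hprod x l + c" "\<forall>x. g x = hprod x l' + c'"
  thus "\<exists>l c. \<forall>x. f x + g x = hprod x l + c"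
    by (intro exI[of _ "l + l'"] exI[of _ "c + c'"]) (simp add: hprod_add_right)
qed

lemma affine_fun_mult: "affine_fun f \<Longrightarrow> affine_fun (\<lambda>x. k * f x)"
  unfolding affine_fun_def
proof (elim exE)
  fix l c assume "\<forall>x. f x = hprod x l + c"
  thus "\<exists>l c. \<forall>x. k * f x = hprod x l + c"
    by (intro exI[of _ "cnj k *s l"] exI[of _ "k * c"]) (simp add: hprod_smult_right algebra_simps)
qed

lemma affine_fun_sum: "(\<And>i. i \<in> I \<Longrightarrow> affine_fun (f i)) \<Longrightarrow> affine_fun (\<lambda>x. \<Sum>i\<in>I. f i x)"
  by (induction I rule: infinite_finite_induct) (auto intro: affine_fun_const affine_fun_add)

lemma affine_fun_matrix:
  assumes "\<And>j. affine_fun (\<lambda>x. f x $h j)"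
  shows "affine_fun (\<lambda>x. (A *v f x) $h k)"
  unfolding matrix_vector_mult_def using assms by (simp add: affine_fun_sum affine_fun_mult)

text \<open>Both f(x) and 1 - x_0 acquire the denominator y_0 + i on the Siegel side. It cancels in
  the quotient, and since 1 - x_0 has the constant numerator 2i, an affine function of y is
  left.\<close>

lemma affine_fun_divide_cayley:
  assumes "affine_fun f"
  obtains m where "affine_fun m"
    "\<And>y. y \<in> siegel \<Longrightarrow> f (cayley_inv y) / (1 - cayley_inv y $h idx 0) = m y"
proof -
  obtain l c where f: "\<And>x. f x = hprod x l + c" using assms by (auto simp: affine_fun_def)
  \<comment> \<open>The value of f at minus \<open>e\<^sub>0\<close>, the constant term in
    \<open>cayley_inv\<close>.\<close>
  define d where "d = c - cnj (l $h idx 0)"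
  define m where "m y = inverse \<i> * hprod y l + (d / (2 * \<i>) * y $h idx 0 + d / 2)" for y
  have "affine_fun m"
    unfolding m_def by (intro affine_fun_add affine_fun_mult affine_fun_hprod affine_fun_const affine_fun_nth)
  moreover have "f (cayley_inv y) / (1 - cayley_inv y $h idx 0) = m y" if y: "y \<in> siegel" for y
  proof -
    define k where "k = y $h idx 0 + \<i>"
    have k: "k \<noteq> 0" using siegel_neq_minus_i[OF y] by (simp add: k_def)
    have "f (cayley_inv y) = 2 / k * hprod y l + d"
      by (simp add: f cayley_inv_def hprod_diff_left hprod_smult_left hprod_axis_left d_def k_def)
    hence "f (cayley_inv y) / (1 - cayley_inv y $h idx 0) = (2 / k * hprod y l + d) / (2 * \<i> / k)"
      using one_minus_cayley_inv[OF y] by (simp only: k_def)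
    also have "\<dots> = inverse \<i> * hprod y l + d / (2 * \<i>) * k"
      using k by (simp add: field_simps)
    also have "\<dots> = m y" by (simp add: m_def k_def field_simps)
    finally show ?thesis .
  qed
  ultimately show ?thesis using that by blast
qed

text \<open>On the Siegel side the quotient of \<open>f\<close> by \<open>1 - x\<^sub>0\<close> is affine in the free variable \<open>Z' \<in> \<complex>\<^sup>N\<^sup>-\<^sup>1\<close>,
  so it can only avoid \<open>0\<close> if it is constant.\<close>

lemma nonvanishing_affine_fun:
  fixes f :: "complex^'n::finite \<Rightarrow> complex"
  assumes "affine_fun f" and nz: "\<And>x. x \<in> unit_ball \<Longrightarrow> f x \<noteq> 0" and f0: "f e\<^sub>0 = 0"
  obtains c where "c \<noteq> 0" "\<And>x. f x = c * (1 - x $h idx 0)"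
proof -
  obtain l c where f: "\<And>x. f x = hprod x l + c" using assms by (auto simp: affine_fun_def)
  have c: "c \<noteq> 0" using nz[of 0] by (simp add: f)
  have l0: "cnj (l $h idx 0) = - c" using f0 by (simp add: f hprod_axis_left eq_neg_iff_add_eq_0)
  have lk: "l $h k = 0" if k: "k \<noteq> idx 0" for k
  proof (rule ccontr)
    assume nk: "l $h k \<noteq> 0"
    \<comment> \<open>Solves for a zero: the \<open>k\<close>-th coordinate is tuned so that the
      linear part at \<open>y\<close> equals -c(y_0 + i). The imaginary part |u|^2 + 1 of y_0 puts
      \<open>y\<close> at height 1, inside the half-plane whatever u is.\<close>
    define u where "u = - (c * \<i>) / cnj (l $h k)"
    define y :: "complex^'n" where "y = u *s axis k 1 + (\<i> * of_real ((cmod u)\<^sup>2 + 1)) *s e\<^sub>0"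
    have "height y = 1"
    proof -
      have "(u *s axis k 1 :: complex^'n) $h idx 0 = 0" using k by (simp add: axis_def)
      from height_add_e0[OF this] show ?thesis by (simp add: y_def norm_smult norm_axis_1)
    qed
    hence y: "y \<in> siegel" by (simp add: siegel_iff_height)
    have y0: "y $h idx 0 = \<i> * of_real ((cmod u)\<^sup>2 + 1)" using k by (simp add: y_def axis_def)
    have "hprod y l = - (c * \<i>) - c * y $h idx 0"
      unfolding y0 unfolding y_def hprod_add_left hprod_smult_left hprod_axis_left l0 u_def using nk by simp
    hence "f (cayley_inv y) = 2 / (y $h idx 0 + \<i>) * (- (c * (y $h idx 0 + \<i>))) + c + c"
      by (simp only: f cayley_inv_def hprod_diff_left hprod_smult_left hprod_axis_left l0) (simp add: algebra_simps)
    also have "\<dots> = 0" using siegel_neq_minus_i[OF y] by simp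
    finally show False using nz[OF cayley_inv_ball[OF y]] by simp
  qed
  have "l = l $h idx 0 *s e\<^sub>0"
    using lk by (auto simp: Finite_Cartesian_Product.vec_eq_iff axis_def)
  hence "f x = c * (1 - x $h idx 0)" for x
    using l0 by (metis (no_types, opaque_lifting) f hprod_smult_right hprod_axis_right add.commute
        mult_minus_left right_diff_distrib diff_conv_add_uminus mult.right_neutral)
  thus ?thesis using c that by blast
qed

text \<open>In i(num/den + \<open>e\<^sub>0\<close>)/(1 - num_0/den) the factor den cancels, leaving
  den - num_0 below. As this is a multiple of 1 - x_0, every coordinate is an affine function
  divided by 1 - x_0, and \<open>affine_fun_divide_cayley\<close> applies. The sequence
  \<open>x\<close> is how the behaviour at the boundary point w enters.\<close>

lemma LFM_affine:
  fixes \<phi> :: "complex^'n::finite \<Rightarrow> complex^'n"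
  assumes \<phi>: "\<phi> \<in> LFM_ball" and P: "unitary P" "P *v e\<^sub>0 = w"
    and x: "\<And>n. x n \<in> unit_ball" "x \<longlonglongrightarrow> w" "(\<lambda>n. \<phi> (x n)) \<longlonglongrightarrow> w"
  obtains m where "\<And>k. affine_fun (m k)"
    "\<And>y k. y \<in> siegel \<Longrightarrow> cayley (adj P *v \<phi> (P *v cayley_inv y)) $h k = m k y"
proof -
  obtain A B C D where "\<And>z. z \<in> unit_ball \<Longrightarrow>
        hprod z C + D \<noteq> 0 \<and> \<phi> z = inverse (hprod z C + D) *s (A *v z + B)"
    using \<phi> unfolding LFM_ball_def linear_fractional_on_def by blast
  hence den0: "\<And>z. z \<in> unit_ball \<Longrightarrow> hprod z C + D \<noteq> 0"
    and \<phi>_eq: "\<And>z. z \<in> unit_ball \<Longrightarrow> \<phi> z = inverse (hprod z C + D) *s (A *v z + B)" by blast+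
  have \<phi>_ball: "\<And>z. z \<in> unit_ball \<Longrightarrow> \<phi> z \<in> unit_ball" using \<phi> unfolding LFM_ball_def by blast
  have adjP: "adj P *v (P *v z) = z" "P *v (adj P *v z) = z" for z using P(1) by (simp_all add: unitary_def)
  have Pball: "P *v z \<in> unit_ball \<longleftrightarrow> z \<in> unit_ball" "adj P *v z \<in> unit_ball \<longleftrightarrow> z \<in> unit_ball" for z
    using unitary_norm[OF P(1)] by simp_all
  define den where "den z = hprod (P *v z) C + D" for z
  define num where "num z = adj P *v (A *v (P *v z) + B)" for z
  have \<phi>1: "adj P *v \<phi> (P *v z) = inverse (den z) *s num z" if "z \<in> unit_ball" for z
    using that by (simp only: \<phi>_eq Pball den_def num_def matrix_vector_mult_smult)
  have den: "den z \<noteq> 0" if "z \<in> unit_ball" for z using den0 Pball that by (simp add: den_def)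
  have aff_den: "affine_fun den"
    unfolding den_def hprod_adj by (intro affine_fun_add affine_fun_hprod affine_fun_const)
  have aff_num: "affine_fun (\<lambda>z. num z $h k)" for k
    unfolding num_def
    by (intro affine_fun_matrix) (simp, intro affine_fun_add affine_fun_matrix affine_fun_const affine_fun_nth)
  define L where "L z = den z + (- 1) * num z $h idx 0" for z
  have affL: "affine_fun L" unfolding L_def by (intro affine_fun_add affine_fun_mult aff_den aff_num)
  have Lnz: "L z \<noteq> 0" if z: "z \<in> unit_ball" for z
  proof
    assume "L z = 0"
    hence "(inverse (den z) *s num z) $h idx 0 = 1" using den[OF z] by (simp add: L_def)
    moreover have "inverse (den z) *s num z \<in> unit_ball"
      using \<phi>1[OF z] \<phi>_ball Pball z by metis
    ultimately show False using unit_ball_nth_neq_1 by blast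
  qed
  have cont: "isCont f z" if "affine_fun f" for f z
  proof -
    obtain l c where "\<And>x. f x = hprod x l + c" using \<open>affine_fun f\<close> by (auto simp: affine_fun_def)
    hence "f = (\<lambda>x. hprod x l + c)" by auto
    thus ?thesis unfolding hprod_def by (auto intro!: continuous_intros)
  qed
  have L0: "L e\<^sub>0 = 0"
  proof -
    define y where "y n = adj P *v x n" for n
    have contP: "isCont (\<lambda>z. adj P *v z) w" for w
      unfolding isCont_def
      by (rule vec_tendstoI) (rule isContD[OF cont[OF affine_fun_matrix[OF affine_fun_nth]]])
    have w: "adj P *v w = e\<^sub>0" using P adjP by metis
    have yb: "y n \<in> unit_ball" for n using x(1) Pball by (simp add: y_def)
    have y: "y \<longlonglongrightarrow> e\<^sub>0"
      using isCont_tendsto_compose[OF contP x(2)] by (simp add: y_def[abs_def] w)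
    have "(\<lambda>n. adj P *v \<phi> (x n)) \<longlonglongrightarrow> e\<^sub>0"
      using isCont_tendsto_compose[OF contP x(3)] by (simp add: w)
    \<comment> \<open>The limit is taken of the product with the denominator, not of the quotient:
      nothing is known yet about \<open>den\<close> being nonzero at the boundary point.\<close>
    hence "(\<lambda>n. (adj P *v \<phi> (x n)) $h idx 0 * den (y n)) \<longlonglongrightarrow> (e\<^sub>0 :: complex^'n) $h idx 0 * den e\<^sub>0"
      by (intro tendsto_mult tendsto_vec_nth isCont_tendsto_compose[OF cont[OF aff_den] y])
    moreover have "(adj P *v \<phi> (x n)) $h idx 0 * den (y n) = num (y n) $h idx 0" for n
      using \<phi>1[OF yb[of n]] den[OF yb[of n]] by (simp add: y_def adjP)
    ultimately have "(\<lambda>n. num (y n) $h idx 0) \<longlonglongrightarrow> den e\<^sub>0" by simp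
    moreover have "(\<lambda>n. num (y n) $h idx 0) \<longlonglongrightarrow> num e\<^sub>0 $h idx 0"
      by (rule isCont_tendsto_compose[OF cont[OF aff_num] y])
    ultimately have "num e\<^sub>0 $h idx 0 = den e\<^sub>0" using LIMSEQ_unique by blast
    thus ?thesis by (simp add: L_def)
  qed
  obtain c where c: "c \<noteq> 0" and Lc: "\<And>x. L x = c * (1 - x $h idx 0)"
    using nonvanishing_affine_fun[OF affL Lnz L0] by blast
  have "\<exists>m. affine_fun m \<and> (\<forall>y\<in>siegel. cayley (adj P *v \<phi> (P *v cayley_inv y)) $h k = m y)" for k
  proof -
    define F where "F z = (\<i> / c) * (num z $h k + e\<^sub>0 $h k * den z)" for z
    have "affine_fun F" unfolding F_def by (intro affine_fun_mult affine_fun_add aff_num aff_den)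
    then obtain m where m: "affine_fun m"
      "\<And>y. y \<in> siegel \<Longrightarrow> F (cayley_inv y) / (1 - cayley_inv y $h idx 0) = m y"
      using affine_fun_divide_cayley by metis
    have "cayley (adj P *v \<phi> (P *v cayley_inv y)) $h k = m y" if y: "y \<in> siegel" for y
    proof -
      define z where "z = cayley_inv y"
      have z: "z \<in> unit_ball" using cayley_inv_ball[OF y] by (simp add: z_def)
      have d: "den z \<noteq> 0" by (rule den[OF z])
      have Lz: "den z - num z $h idx 0 = c * (1 - z $h idx 0)" using Lc[of z] by (simp add: L_def)
      have z1: "1 - z $h idx 0 \<noteq> 0" using unit_ball_nth_neq_1[OF z] by simp
      have "cayley (inverse (den z) *s num z) $h k =
          \<i> / (1 - inverse (den z) * num z $h idx 0) * (inverse (den z) * num z $h k + e\<^sub>0 $h k)"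
        by (simp only: cayley_nth vector_smult_component)
      also have "1 - inverse (den z) * num z $h idx 0 = (den z - num z $h idx 0) / den z"
        using d by (simp add: field_simps)
      also have "inverse (den z) * num z $h k + e\<^sub>0 $h k = (num z $h k + e\<^sub>0 $h k * den z) / den z"
        using d by (simp add: field_simps)
      also have "\<i> / ((den z - num z $h idx 0) / den z) * ((num z $h k + e\<^sub>0 $h k * den z) / den z) =
          F z / (1 - z $h idx 0)"
        unfolding Lz F_def using d c z1 by (simp add: field_simps)
      finally show ?thesis using m(2)[OF y] \<phi>1[OF z] by (simp add: z_def)
    qed
    thus ?thesis using m(1) by blast
  qed
  then obtain m where "\<forall>k. affine_fun (m k) \<and>
      (\<forall>y\<in>siegel. cayley (adj P *v \<phi> (P *v cayley_inv y)) $h k = m k y)" by metis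
  thus ?thesis using that by blast
qed

section \<open>Affine self-maps of the Siegel half-plane\<close>

text \<open>Rotating x by a unimodular scalar makes the product real and nonnegative, so the real
  Cauchy-Schwarz inequality suffices.\<close>

lemma cmod_hprod_le: "cmod (hprod x y) \<le> norm x * norm (y :: complex^'n::finite)"
proof (cases "hprod x y = 0")
  case False
  define u where "u = cnj (hprod x y) / cmod (hprod x y)"
  have u: "cmod u = 1" using False by (simp add: u_def norm_divide)
  have "hprod (u *s x) y = of_real (cmod (hprod x y))"
    unfolding hprod_smult_left u_def using False
    by (simp add: mult.commute[of "cnj _"] complex_norm_square[symmetric] power2_eq_square)
  hence "cmod (hprod x y) = inner (u *s x) y" by (metis Re_complex_of_real Re_hprod)
  also have "\<dots> \<le> norm (u *s x) * norm y" by (rule norm_cauchy_schwarz)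
  finally show ?thesis by (simp add: norm_smult u)
qed simp

definition siegel_affine ::
    "real \<Rightarrow> complex^'n^'n \<Rightarrow> complex^'n \<Rightarrow> complex^'n \<Rightarrow> complex \<Rightarrow> complex^'n \<Rightarrow> complex^'n::finite" where
  "siegel_affine \<rho> S \<beta> s t y = S *v y + s + (of_real \<rho> * y $h idx 0 + hprod y \<beta> + t) *s e\<^sub>0"

text \<open>The space of the variable Z is realised as the hyperplane y_0 = 0 of the full space. S,
  \<beta> and s are required to live on it.\<close>

definition horizontal :: "complex^'n^'n \<Rightarrow> complex^'n \<Rightarrow> complex^'n::finite \<Rightarrow> bool" where
  "horizontal S \<beta> s \<longleftrightarrow>
     (\<forall>y. (S *v y) $h idx 0 = 0) \<and> S *v e\<^sub>0 = 0 \<and> \<beta> $h idx 0 = 0 \<and> s $h idx 0 = 0"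

lemma siegel_affine_nth_0:
  assumes "horizontal S \<beta> s"
  shows "siegel_affine \<rho> S \<beta> s t y $h idx 0 = of_real \<rho> * y $h idx 0 + hprod y \<beta> + t"
  using assms by (simp add: siegel_affine_def horizontal_def)

lemma height_siegel_affine:
  assumes "horizontal S \<beta> s"
  shows "height (siegel_affine \<rho> S \<beta> s t y) =
    \<rho> * Im (y $h idx 0) + Im (hprod y \<beta>) + Im t - (norm (S *v y + s))\<^sup>2"
  unfolding siegel_affine_def using assms
  by (subst height_add_e0) (simp_all add: horizontal_def)

text \<open>Divide by the square of \<eta> and let \<eta> tend to infinity. It serves to show that z
  does not enter the Z-components of a self-map.\<close>

lemma linear_growth_imp_0:
  fixes a b :: complex
  assumes "\<And>\<eta> :: real. \<eta> > 0 \<Longrightarrow> (cmod (of_real \<eta> * a + b))\<^sup>2 \<le> K * \<eta> + L"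
  shows "a = 0"
proof -
  have "eventually (\<lambda>\<eta>::real. (cmod (a + b / of_real \<eta>))\<^sup>2 \<le> K / \<eta> + L / \<eta> / \<eta>) at_top"
    using eventually_gt_at_top[of 0]
  proof eventually_elim
    fix \<eta> :: real assume \<eta>: "\<eta> > 0"
    have "a + b / of_real \<eta> = (of_real \<eta> * a + b) / of_real \<eta>" using \<eta> by (simp add: field_simps)
    hence "(cmod (a + b / of_real \<eta>))\<^sup>2 = (cmod (of_real \<eta> * a + b))\<^sup>2 / \<eta>\<^sup>2"
      using \<eta> by (simp add: norm_divide power_divide)
    also have "\<dots> \<le> (K * \<eta> + L) / \<eta>\<^sup>2" using assms[OF \<eta>] \<eta> by (intro divide_right_mono) auto
    finally show "(cmod (a + b / of_real \<eta>))\<^sup>2 \<le> K / \<eta> + L / \<eta> / \<eta>"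
      using \<eta> by (simp add: field_simps power2_eq_square)
  qed
  moreover have *: "((\<lambda>\<eta>::real. k / of_real \<eta>) \<longlongrightarrow> 0) at_top" for k :: complex
    by (rule tendsto_divide_0[OF tendsto_const filterlim_of_real_at_infinity])
  have "((\<lambda>\<eta>::real. (cmod (a + b / of_real \<eta>))\<^sup>2) \<longlongrightarrow> (cmod (a + 0))\<^sup>2) at_top"
    by (intro tendsto_intros *)
  moreover have "((\<lambda>\<eta>::real. K / \<eta> + L / \<eta> / \<eta>) \<longlongrightarrow> 0 + 0) at_top"
    by (intro tendsto_intros tendsto_divide_0[OF tendsto_const] tendsto_divide_0[OF tendsto_divide_0[OF tendsto_const]]
        filterlim_at_top_imp_at_infinity filterlim_ident)
  ultimately have "(cmod (a + 0))\<^sup>2 \<le> 0 + 0"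
    by (intro tendsto_le[OF trivial_limit_at_top_linorder])
  thus "a = 0" by simp
qed

text \<open>Testing on the points \<zeta> \<open>e\<^sub>0\<close> is enough. Moving Re \<zeta> to
  either side forces the coefficient \<mu> of z to be real, and raising Im \<zeta> forces it to be
  nonnegative. On the imaginary axis the Z-components have squares bounded by the first coordinate,
  which grows only linearly, so they cannot depend on z.\<close>

lemma affine_siegel_self_map:
  fixes g :: "complex^'n::finite \<Rightarrow> complex^'n"
  assumes aff: "\<And>k. affine_fun (m k)" and g: "\<And>y k. y \<in> siegel \<Longrightarrow> g y $h k = m k y"
    and self: "\<And>y. y \<in> siegel \<Longrightarrow> g y \<in> siegel"
  obtains \<rho> S \<beta> s t where "\<rho> \<ge> 0" "horizontal S \<beta> s" "\<And>y. y \<in> siegel \<Longrightarrow> g y = siegel_affine \<rho> S \<beta> s t y"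
proof -
  from aff have "\<forall>k. \<exists>l c. \<forall>y. m k y = hprod y l + c" unfolding affine_fun_def by blast
  then obtain l c where m: "\<And>k y. m k y = hprod y (l k) + c k" by metis
  have point: "(\<zeta> *s e\<^sub>0 :: complex^'n) \<in> siegel" if "Im \<zeta> > 0" for \<zeta>
    using that height_add_e0[of "0 :: complex^'n" \<zeta>] by (simp add: siegel_iff_height)
  have val: "g (\<zeta> *s e\<^sub>0) $h k = \<zeta> * cnj (l k $h idx 0) + c k" if "Im \<zeta> > 0" for \<zeta> k
    using g[OF point[OF that]] by (simp add: m hprod_smult_left hprod_axis_left)
  define \<mu> where "\<mu> = cnj (l (idx 0) $h idx 0)"
  have Im_pos: "Im (\<zeta> * \<mu> + c (idx 0)) > 0" if "Im \<zeta> > 0" for \<zeta>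
    using siegel_Im_pos[OF self[OF point[OF that]]] val[OF that, of "idx 0"] by (simp add: \<mu>_def)
  have \<mu>1: "Im \<mu> = 0"
  proof (rule ccontr)
    assume nz: "Im \<mu> \<noteq> 0"
    define x where "x = - (\<bar>Re \<mu>\<bar> + \<bar>Im (c (idx 0))\<bar>) / Im \<mu>"
    have "Im ((of_real x + \<i>) * \<mu> + c (idx 0)) = x * Im \<mu> + Re \<mu> + Im (c (idx 0))" by simp
    also have "x * Im \<mu> = - (\<bar>Re \<mu>\<bar> + \<bar>Im (c (idx 0))\<bar>)" using nz by (simp add: x_def)
    finally show False using Im_pos[of "of_real x + \<i>"] by simp
  qed
  have \<mu>2: "Re \<mu> \<ge> 0"
  proof (rule ccontr)
    assume neg: "\<not> Re \<mu> \<ge> 0"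
    define x where "x = (\<bar>Im (c (idx 0))\<bar> + 1) / (- Re \<mu>)"
    have "- Re \<mu> > 0" using neg by simp
    hence "x > 0" unfolding x_def by (intro divide_pos_pos) auto
    moreover have "Im (\<i> * of_real x * \<mu> + c (idx 0)) = x * Re \<mu> + Im (c (idx 0))" by simp
    moreover have "x * Re \<mu> = - (\<bar>Im (c (idx 0))\<bar> + 1)" using neg by (simp add: x_def)
    ultimately show False using Im_pos[of "\<i> * of_real x"] by simp
  qed
  have lk: "l k $h idx 0 = 0" if k: "k \<noteq> idx 0" for k
  proof -
    have "\<i> * cnj (l k $h idx 0) = 0"
    proof (rule linear_growth_imp_0[of _ "c k" "Re \<mu>" "Im (c (idx 0))"])
      fix \<eta> :: real assume \<eta>: "\<eta> > 0"
      define \<zeta> where "\<zeta> = \<i> * of_real \<eta>"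
      have \<zeta>: "Im \<zeta> > 0" using \<eta> by (simp add: \<zeta>_def)
      have "(cmod (g (\<zeta> *s e\<^sub>0) $h k))\<^sup>2 \<le> (\<Sum>i\<in>UNIV - {idx 0}. (cmod (g (\<zeta> *s e\<^sub>0) $h i))\<^sup>2)"
        using k by (intro member_le_sum) auto
      also have "\<dots> < Im (g (\<zeta> *s e\<^sub>0) $h idx 0)" using self[OF point[OF \<zeta>]] by (simp only: siegel_iff)
      finally show "(cmod (of_real \<eta> * (\<i> * cnj (l k $h idx 0)) + c k))\<^sup>2 \<le> Re \<mu> * \<eta> + Im (c (idx 0))"
        unfolding val[OF \<zeta>] by (simp add: \<zeta>_def \<mu>_def mult_ac)
    qed
    thus ?thesis by simp
  qed
  define S :: "complex^'n^'n" where "S = (\<chi> k j. if k = idx 0 then 0 else cnj (l k $h j))"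
  define \<beta> :: "complex^'n" where "\<beta> = (\<chi> j. if j = idx 0 then 0 else l (idx 0) $h j)"
  define s :: "complex^'n" where "s = (\<chi> k. if k = idx 0 then 0 else c k)"
  have S: "(S *v y) $h k = (if k = idx 0 then 0 else hprod y (l k))" for y k
    by (simp add: S_def matrix_vector_mult_def hprod_def mult.commute)
  have \<beta>: "hprod y (l (idx 0)) = of_real (Re \<mu>) * y $h idx 0 + hprod y \<beta>" for y
  proof -
    have "l (idx 0) = \<beta> + of_real (Re \<mu>) *s e\<^sub>0"
      using \<mu>1 by (auto simp: Finite_Cartesian_Product.vec_eq_iff \<beta>_def \<mu>_def axis_def complex_eq_iff)
    thus ?thesis by (simp add: hprod_add_right hprod_smult_right hprod_axis_right)
  qed
  have "horizontal S \<beta> s"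
    unfolding horizontal_def
    by (auto simp: S \<beta>_def s_def Finite_Cartesian_Product.vec_eq_iff hprod_axis_left lk)
  moreover have "g y = siegel_affine (Re \<mu>) S \<beta> s (c (idx 0)) y" if y: "y \<in> siegel" for y
  proof (rule Finite_Cartesian_Product.vec_eq_iff[THEN iffD2, rule_format])
    fix k
    show "g y $h k = siegel_affine (Re \<mu>) S \<beta> s (c (idx 0)) y $h k"
      using g[OF y, of k] by (cases "k = idx 0") (simp_all add: m siegel_affine_def S s_def \<beta> axis_def)
  qed
  ultimately show ?thesis using that \<mu>2 by blast
qed

text \<open>The point vertically above Z at height d is mapped into the half-plane. Letting d tend
  to 0 leaves an inequality in Z alone.\<close>

lemma siegel_affine_inequality:
  fixes Z :: "complex^'n::finite"
  assumes h: "horizontal S \<beta> s" and self: "\<And>y. y \<in> siegel \<Longrightarrow> siegel_affine \<rho> S \<beta> s t y \<in> siegel"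
    and Z: "Z $h idx 0 = 0" and \<rho>: "\<rho> \<ge> 0"
  shows "(norm (S *v Z + s))\<^sup>2 \<le> \<rho> * (norm Z)\<^sup>2 + Im (hprod Z \<beta>) + Im t"
proof (rule field_le_epsilon)
  fix e :: real assume e: "e > 0"
  define d where "d = e / (\<rho> + 1)"
  have d: "d > 0" "\<rho> * d \<le> e" using e \<rho> by (auto simp: d_def field_simps)
  define y where "y = Z + (\<i> * of_real ((norm Z)\<^sup>2 + d)) *s e\<^sub>0"
  have "height y = d" using height_add_e0[OF Z] by (simp add: y_def)
  hence "0 < height (siegel_affine \<rho> S \<beta> s t y)" using self d by (simp add: siegel_iff_height)
  also have "S *v y = S *v Z"
    using h by (simp add: y_def matrix_vector_right_distrib matrix_vector_mult_smult horizontal_def)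
  moreover have "hprod y \<beta> = hprod Z \<beta>"
    using h by (simp add: y_def hprod_add_left hprod_smult_left hprod_axis_left horizontal_def)
  moreover have "Im (y $h idx 0) = (norm Z)\<^sup>2 + d" using Z by (simp add: y_def)
  ultimately have "0 < \<rho> * ((norm Z)\<^sup>2 + d) + Im (hprod Z \<beta>) + Im t - (norm (S *v Z + s))\<^sup>2"
    by (simp only: height_siegel_affine[OF h])
  thus "(norm (S *v Z + s))\<^sup>2 \<le> \<rho> * (norm Z)\<^sup>2 + Im (hprod Z \<beta>) + Im t + e"
    using d by (simp add: algebra_simps)
qed

lemma horizontal_proj:
  assumes "horizontal S \<beta> s"
  shows "S *v y = S *v (y - (y $h idx 0) *s e\<^sub>0)" "hprod y \<beta> = hprod (y - (y $h idx 0) *s e\<^sub>0) \<beta>"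
  using assms
  by (simp_all add: horizontal_def matrix_vector_mult_diff_distrib matrix_vector_mult_smult
      hprod_diff_left hprod_smult_left hprod_axis_left)

lemma norm_horizontal_part:
  fixes y :: "complex^'n::finite"
  shows "(norm (y - (y $h idx 0) *s e\<^sub>0))\<^sup>2 = (norm y)\<^sup>2 - (cmod (y $h idx 0))\<^sup>2"
proof -
  define Z where "Z = y - (y $h idx 0) *s e\<^sub>0"
  have "Z $h idx 0 = 0" by (simp add: Z_def)
  hence "hprod Z ((y $h idx 0) *s e\<^sub>0) = 0" by (simp add: hprod_smult_right hprod_axis_right)
  hence "(norm (Z + (y $h idx 0) *s e\<^sub>0))\<^sup>2 = (norm Z)\<^sup>2 + (cmod (y $h idx 0))\<^sup>2"
    unfolding norm_add_sq by (simp add: norm_smult norm_axis_1)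
  moreover have "Z + (y $h idx 0) *s e\<^sub>0 = y" by (simp add: Z_def)
  ultimately show ?thesis by (simp add: Z_def)
qed

text \<open>Apply \<open>siegel_affine_inequality\<close> to rZ with r large: the quadratic
  coefficients must already satisfy the inequality, as the remaining terms grow at most linearly. A
  general vector is reduced to its component in the hyperplane, which is all that S sees.\<close>

lemma siegel_affine_norm_le:
  fixes Z :: "complex^'n::finite"
  assumes h: "horizontal S \<beta> s" and self: "\<And>y. y \<in> siegel \<Longrightarrow> siegel_affine \<rho> S \<beta> s t y \<in> siegel"
    and \<rho>: "\<rho> \<ge> 0"
  shows "(norm (S *v Z))\<^sup>2 \<le> \<rho> * (norm Z)\<^sup>2"
proof -
  have main: "(norm (S *v Z))\<^sup>2 \<le> \<rho> * (norm Z)\<^sup>2" if Z: "Z $h idx 0 = 0" for Z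
  proof (rule ccontr)
    assume "\<not> ?thesis"
    define \<delta> where "\<delta> = (norm (S *v Z))\<^sup>2 - \<rho> * (norm Z)\<^sup>2"
    have \<delta>: "\<delta> > 0" using \<open>\<not> _\<close> by (simp add: \<delta>_def)
    define b where "b = Im (hprod Z \<beta>) - 2 * Re (hprod (S *v Z) s)"
    define c where "c = Im t - (norm s)\<^sup>2"
    have ineq: "r\<^sup>2 * \<delta> \<le> r * b + c" for r :: real
    proof -
      have "(norm (S *v (of_real r *s Z) + s))\<^sup>2 = r\<^sup>2 * (norm (S *v Z))\<^sup>2 + 2 * (r * Re (hprod (S *v Z) s)) + (norm s)\<^sup>2"
        by (simp add: matrix_vector_mult_smult norm_add_sq hprod_smult_left norm_smult power_mult_distrib)
      moreover have "\<rho> * (norm (of_real r *s Z))\<^sup>2 + Im (hprod (of_real r *s Z) \<beta>) + Im t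
          = \<rho> * (r\<^sup>2 * (norm Z)\<^sup>2) + r * Im (hprod Z \<beta>) + Im t"
        by (simp add: norm_smult power_mult_distrib hprod_smult_left)
      ultimately show ?thesis
        using siegel_affine_inequality[OF h self _ \<rho>, of "of_real r *s Z"] Z
        by (simp add: b_def c_def \<delta>_def algebra_simps)
    qed
    \<comment> \<open>Large enough that r \<delta> exceeds |b| + |c|. The added 1 ensures r \<ge> 1,
      so that r|c| dominates c.\<close>
    define r where "r = (\<bar>b\<bar> + \<bar>c\<bar> + 1) / \<delta> + 1"
    have r1: "r \<ge> 1" using \<delta> by (auto simp: r_def intro!: divide_nonneg_pos)
    have "r * \<delta> = \<bar>b\<bar> + \<bar>c\<bar> + 1 + \<delta>" using \<delta> by (simp add: r_def field_simps)
    hence "r * (r * \<delta>) > r * (\<bar>b\<bar> + \<bar>c\<bar>)" using r1 \<delta> by (intro mult_strict_left_mono) auto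
    moreover have "r * (\<bar>b\<bar> + \<bar>c\<bar>) \<ge> r * b + c"
    proof -
      have "r * \<bar>b\<bar> \<ge> r * b" using r1 by (intro mult_left_mono) auto
      moreover have "r * \<bar>c\<bar> \<ge> 1 * \<bar>c\<bar>" using r1 by (intro mult_right_mono) auto
      ultimately show ?thesis by (simp add: ring_distribs)
    qed
    ultimately show False using ineq[of r] by (simp add: power2_eq_square mult.assoc)
  qed
  define Y where "Y = Z - (Z $h idx 0) *s e\<^sub>0"
  have "(norm (S *v Z))\<^sup>2 = (norm (S *v Y))\<^sup>2" using horizontal_proj(1)[OF h, of Z] by (simp add: Y_def)
  also have "\<dots> \<le> \<rho> * (norm Y)\<^sup>2" by (rule main) (simp add: Y_def)
  also have "\<dots> \<le> \<rho> * (norm Z)\<^sup>2"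
    using \<rho> norm_horizontal_part[of Z] by (intro mult_left_mono) (auto simp: Y_def)
  finally show ?thesis .
qed

text \<open>|K|/(1 - r) is the fixed point of the majorising recurrence, so bounds above it are
  reproduced.\<close>

lemma contracting_recurrence_bounded:
  fixes a :: "nat \<Rightarrow> real"
  assumes r: "0 \<le> r" "r < 1" and step: "\<And>n. a (Suc n) \<le> r * a n + K"
  shows "a n \<le> \<bar>a 0\<bar> + \<bar>K\<bar> / (1 - r)"
proof (induction n)
  case 0
  have "\<bar>K\<bar> / (1 - r) \<ge> 0" using r by simp
  thus ?case by linarith
next
  case (Suc n)
  define M where "M = \<bar>a 0\<bar> + \<bar>K\<bar> / (1 - r)"
  have "(1 - r) * M \<ge> \<bar>K\<bar>" using r by (simp add: M_def ring_distribs(1))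
  have "a (Suc n) \<le> r * a n + K" by (rule step)
  also have "\<dots> \<le> r * M + \<bar>K\<bar>" using Suc r by (intro add_mono mult_left_mono) (auto simp: M_def)
  also have "\<dots> \<le> M" using \<open>(1 - r) * M \<ge> \<bar>K\<bar>\<close> by (simp add: algebra_simps)
  finally show ?case by (simp add: M_def)
qed

text \<open>Two recurrences in cascade: Z contracts with ratio at most the square root of \<rho>, by
  \<open>siegel_affine_norm_le\<close>. Its boundedness makes <Z,\<beta>> a bounded perturbation in
  the recurrence for z, of ratio \<rho>.\<close>

lemma siegel_affine_orbit_bounded:
  fixes y :: "nat \<Rightarrow> complex^'n::finite"
  assumes h: "horizontal S \<beta> s" and self: "\<And>y. y \<in> siegel \<Longrightarrow> siegel_affine \<rho> S \<beta> s t y \<in> siegel"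
    and \<rho>: "0 \<le> \<rho>" "\<rho> < 1" and y: "\<And>n. y (Suc n) = siegel_affine \<rho> S \<beta> s t (y n)"
  obtains R where "\<And>n. cmod (y n $h idx 0) \<le> R"
proof -
  define Z where "Z n = y n - (y n $h idx 0) *s e\<^sub>0" for n
  have ZSuc: "Z (Suc n) = S *v Z n + s" for n
    using h by (simp add: Z_def[of "Suc n"] y siegel_affine_nth_0)
      (simp add: siegel_affine_def Z_def horizontal_proj(1)[OF h, of "y n", symmetric])
  have "norm (S *v z) \<le> sqrt \<rho> * norm z" for z
    using siegel_affine_norm_le[OF h self \<rho>(1), of z] real_sqrt_le_mono[of "(norm (S *v z))\<^sup>2" "\<rho> * (norm z)\<^sup>2"]
    by (simp add: real_sqrt_mult)
  hence "norm (Z (Suc n)) \<le> sqrt \<rho> * norm (Z n) + norm s" for n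
    unfolding ZSuc by (meson add_mono_thms_linordered_semiring(3) norm_triangle_ineq order_trans)
  from contracting_recurrence_bounded[where a = "\<lambda>n. norm (Z n)", OF _ _ this]
  obtain R1 where R1: "\<And>n. norm (Z n) \<le> R1" using \<rho> that by auto
  have "cmod (y (Suc n) $h idx 0) \<le> \<rho> * cmod (y n $h idx 0) + (R1 * norm \<beta> + cmod t)" for n
  proof -
    have "cmod (hprod (Z n) \<beta>) \<le> norm (Z n) * norm \<beta>" by (rule cmod_hprod_le)
    also have "\<dots> \<le> R1 * norm \<beta>" by (intro mult_right_mono R1) auto
    finally have "cmod (hprod (y n) \<beta>) \<le> R1 * norm \<beta>" using horizontal_proj(2)[OF h, of "y n"] by (simp add: Z_def)
    moreover have "y (Suc n) $h idx 0 = of_real \<rho> * y n $h idx 0 + hprod (y n) \<beta> + t"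
      by (simp add: y siegel_affine_nth_0[OF h])
    moreover have "cmod (of_real \<rho> * y n $h idx 0 + hprod (y n) \<beta> + t) \<le>
        cmod (of_real \<rho> * y n $h idx 0) + cmod (hprod (y n) \<beta>) + cmod t"
      by (meson add_right_mono norm_triangle_ineq order_trans)
    ultimately show ?thesis using \<rho> by (simp add: norm_mult)
  qed
  from contracting_recurrence_bounded[where a = "\<lambda>n. cmod (y n $h idx 0)", OF \<rho> this] show ?thesis using that by blast
qed

section \<open>The dilation coefficient and reduction of the affine part\<close>

text \<open>The points i\<eta> \<open>e\<^sub>0\<close> correspond to a radial approach to w. Along
  it \<open>height_eq\<close> expresses the dilation quotient explicitly, and it tends to
  \<rho>/\<rho>^2 = 1/\<rho>. For \<rho> > 1 this would push the lower limit below 1.\<close>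

lemma dilation_bound:
  fixes \<phi> :: "complex^'n::finite \<Rightarrow> complex^'n"
  assumes self: "\<And>z. z \<in> unit_ball \<Longrightarrow> \<phi> z \<in> unit_ball"
    and dil: "boundary_dilation \<phi> w = 1" and P: "unitary P" "P *v e\<^sub>0 = w"
    and h: "horizontal S \<beta> s"
    and g: "\<And>y. y \<in> siegel \<Longrightarrow> cayley (adj P *v \<phi> (P *v cayley_inv y)) = siegel_affine \<rho> S \<beta> s t y"
  shows "\<rho> \<le> 1"
proof (rule ccontr)
  assume "\<not> \<rho> \<le> 1"
  hence \<rho>: "\<rho> > 1" by simp
  define r where "r = (1 + 1 / \<rho>) / 2"
  have r: "r < 1" "1 / \<rho> < r" using \<rho> by (auto simp: r_def field_simps)
  define R where "R z = (1 - (norm (\<phi> z))\<^sup>2) / (1 - (norm z)\<^sup>2)" for z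
  have "ereal r < Liminf (at w within unit_ball) (\<lambda>z. ereal (R z))"
    using dil r(1) by (simp add: boundary_dilation_def R_def)
  hence ev: "eventually (\<lambda>z. r < R z) (at w within unit_ball)"
    using less_LiminfD by fastforce
  define y :: "real \<Rightarrow> complex^'n" where "y \<eta> = (\<i> * of_real \<eta>) *s e\<^sub>0" for \<eta>
  define z where "z \<eta> = P *v cayley_inv (y \<eta>)" for \<eta>
  have y0: "y \<eta> $h idx 0 = \<i> * of_real \<eta>" for \<eta> by (simp add: y_def)
  have hy: "height (y \<eta>) = \<eta>" for \<eta>
    using height_add_e0[of "0 :: complex^'n" "\<i> * of_real \<eta>"] by (simp add: y_def)
  have y: "y \<eta> \<in> siegel" if "\<eta> > 0" for \<eta> using that hy by (simp add: siegel_iff_height)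
  have z: "z \<eta> \<in> unit_ball" if "\<eta> > 0" for \<eta>
    using cayley_inv_ball[OF y[OF that]] unitary_norm[OF P(1)] by (simp add: z_def)
  have inv0: "((\<lambda>\<eta>::real. k / of_real \<eta>) \<longlongrightarrow> 0) at_top" for k :: complex
    by (rule tendsto_divide_0[OF tendsto_const filterlim_of_real_at_infinity])
  have inv0': "((\<lambda>\<eta>::real. k / \<eta>) \<longlongrightarrow> 0) at_top" for k :: real
    by (intro tendsto_divide_0[OF tendsto_const] filterlim_at_top_imp_at_infinity filterlim_ident)
  have "filterlim z (at w within unit_ball) at_top"
    unfolding filterlim_at
  proof (intro conjI)
    show "eventually (\<lambda>\<eta>. z \<eta> \<in> unit_ball \<and> z \<eta> \<noteq> w) at_top"
      using eventually_gt_at_top[of 0]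
    proof eventually_elim
      fix \<eta> :: real assume "\<eta> > 0"
      moreover have "norm w = 1" using unitary_norm(1)[OF P(1), of e\<^sub>0] P(2) by (simp add: norm_axis_1)
      ultimately show "z \<eta> \<in> unit_ball \<and> z \<eta> \<noteq> w" using z[of \<eta>] by auto
    qed
    have zw: "z \<eta> = (2 / (1 + 1 / of_real \<eta>) - 1) *s w" if "\<eta> > 0" for \<eta>
    proof -
      have "2 / (\<i> * of_real \<eta> + \<i>) * (\<i> * of_real \<eta>) = 2 / (1 + 1 / complex_of_real \<eta>)"
      proof -
        have nz: "1 + complex_of_real \<eta> \<noteq> 0" using that by (auto simp: complex_eq_iff)
        have "\<i> * complex_of_real \<eta> + \<i> = \<i> * (1 + of_real \<eta>)" by (simp add: ring_distribs)
        hence "2 / (\<i> * of_real \<eta> + \<i>) * (\<i> * of_real \<eta>) = 2 * complex_of_real \<eta> / (1 + of_real \<eta>)"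
          using nz by simp
        also have "\<dots> = 2 / (1 + 1 / complex_of_real \<eta>)" using nz that by (simp add: field_simps)
        finally show ?thesis .
      qed
      hence "cayley_inv (y \<eta>) = (2 / (1 + 1 / complex_of_real \<eta>)) *s e\<^sub>0 - e\<^sub>0"
        unfolding cayley_inv_def y0 unfolding y_def vector_smult_assoc by simp
      thus ?thesis
        by (simp add: z_def matrix_vector_mult_diff_distrib matrix_vector_mult_smult P(2) vector_sub_rdistrib)
    qed
    have "((\<lambda>\<eta>. (2 / (1 + 1 / complex_of_real \<eta>) - 1) * w $h k) \<longlongrightarrow> (2 / (1 + 0) - 1) * w $h k) at_top" for k
      by (intro tendsto_intros inv0) simp
    moreover have "(2 / (1 + 0) - 1) * w $h k = w $h k" for k by simp
    ultimately have "((\<lambda>\<eta>. (2 / (1 + 1 / complex_of_real \<eta>) - 1) *s w) \<longlongrightarrow> w) at_top"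
      by (intro vec_tendstoI) (simp only: vector_smult_component)
    moreover have "eventually (\<lambda>\<eta>. (2 / (1 + 1 / complex_of_real \<eta>) - 1) *s w = z \<eta>) at_top"
      using eventually_gt_at_top[of 0] by eventually_elim (simp add: zw)
    ultimately show "(z \<longlongrightarrow> w) at_top" by (rule Lim_transform_eventually)
  qed
  hence ev': "eventually (\<lambda>\<eta>. r < R (z \<eta>)) at_top" using ev unfolding filterlim_iff by blast
  define \<tau> where "\<tau> = Im t - (norm s)\<^sup>2"
  \<comment> \<open>The dilation quotient at \<open>z \<eta>\<close> with all powers of \<eta>
    cancelled: heights \<rho>\<eta> + \<tau> and \<eta>, divided by the squared moduli of y_0 + i at
    the image point and at \<open>y \<eta>\<close>.\<close>
  define L where "L \<eta> = (\<rho> + \<tau> / \<eta>) * (1 + 1 / \<eta>)\<^sup>2 / (cmod (\<i> * of_real \<rho> + (t + \<i>) / of_real \<eta>))\<^sup>2" for \<eta>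
  have "R (z \<eta>) = L \<eta>" if \<eta>: "\<eta> > 0" for \<eta>
  proof -
    define Y where "Y = siegel_affine \<rho> S \<beta> s t (y \<eta>)"
    define u where "u = adj P *v \<phi> (z \<eta>)"
    have u: "u \<in> unit_ball" using self[OF z[OF \<eta>]] unitary_norm[OF P(1)] by (simp add: u_def)
    have cu: "cayley u = Y" using g[OF y[OF \<eta>]] by (simp add: u_def z_def Y_def)
    hence Yu: "cayley_inv Y = u" using cayley_inv_cayley[OF unit_ball_nth_neq_1[OF u]] by simp
    have Ys: "Y \<in> siegel" using cayley_siegel[OF u] cu by simp
    have Sy: "S *v y \<eta> = 0" using h by (simp add: y_def matrix_vector_mult_smult horizontal_def)
    have \<beta>y: "hprod (y \<eta>) \<beta> = 0" using h by (simp add: y_def hprod_smult_left hprod_axis_left horizontal_def)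
    have Y0: "Y $h idx 0 = of_real \<rho> * (\<i> * of_real \<eta>) + t"
      unfolding Y_def siegel_affine_nth_0[OF h] y0 \<beta>y by simp
    have hY: "height Y = \<rho> * \<eta> + \<tau>"
      unfolding Y_def height_siegel_affine[OF h] y0 \<beta>y Sy by (simp add: \<tau>_def)
    have Y0': "Y $h idx 0 + \<i> = of_real \<eta> * (\<i> * of_real \<rho> + (t + \<i>) / of_real \<eta>)"
      unfolding Y0 using \<eta> by (simp add: field_simps)
    have "4 * height Y = (cmod (Y $h idx 0 + \<i>))\<^sup>2 * (1 - (norm (\<phi> (z \<eta>)))\<^sup>2)"
      using height_eq[OF Ys] unfolding Yu using unitary_norm[OF P(1)] by (simp add: u_def)
    hence 1: "1 - (norm (\<phi> (z \<eta>)))\<^sup>2 = 4 * height Y / (cmod (Y $h idx 0 + \<i>))\<^sup>2"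
      using siegel_neq_minus_i[OF Ys] by simp
    have "4 * \<eta> = (cmod (\<i> * of_real \<eta> + \<i>))\<^sup>2 * (1 - (norm (z \<eta>))\<^sup>2)"
      using height_eq[OF y[OF \<eta>]] unitary_norm[OF P(1)] by (simp add: hy y0 z_def)
    moreover have "\<i> * of_real \<eta> + \<i> = \<i> * of_real (\<eta> + 1)" by (simp add: ring_distribs)
    hence "cmod (\<i> * of_real \<eta> + \<i>) = \<eta> + 1" using \<eta> by (simp only: norm_mult norm_of_real) simp
    ultimately have 2: "1 - (norm (z \<eta>))\<^sup>2 = 4 * \<eta> / (\<eta> + 1)\<^sup>2" using \<eta> by (simp add: field_simps)
    define v where "v = (cmod (\<i> * of_real \<rho> + (t + \<i>) / of_real \<eta>))\<^sup>2"
    have v: "(cmod (Y $h idx 0 + \<i>))\<^sup>2 = \<eta>\<^sup>2 * v"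
      unfolding Y0' norm_mult v_def using \<eta> by (simp add: power_mult_distrib)
    show ?thesis
      unfolding R_def 1 2 L_def v v_def[symmetric] hY using \<eta>
      by (cases "v = 0") (simp_all add: field_simps power2_eq_square)
  qed
  hence "eventually (\<lambda>\<eta>. R (z \<eta>) = L \<eta>) at_top"
    by (intro eventually_mono[OF eventually_gt_at_top[of 0]])
  with ev' have evL: "eventually (\<lambda>\<eta>. r \<le> L \<eta>) at_top" by eventually_elim auto
  have "(L \<longlongrightarrow> (\<rho> + 0) * (1 + 0)\<^sup>2 / (cmod (\<i> * of_real \<rho> + 0))\<^sup>2) at_top"
    unfolding L_def[abs_def] using \<rho> by (intro tendsto_intros inv0 inv0') auto
  hence "(L \<longlongrightarrow> 1 / \<rho>) at_top" using \<rho> by (simp add: norm_mult power2_eq_square)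
  from tendsto_lowerbound[OF this evL] r(2) show False by simp
qed

text \<open>The component k of s orthogonal to the range of I - S is orthogonal in particular to k -
  Sk, so Re<k,Sk> = |k|^2. For a contraction this forces Sk = k. Real orthogonality suffices for
  this argument.\<close>

lemma contraction_range_decomposition:
  fixes s :: "complex^'n::finite"
  assumes contr: "\<And>x. norm (S *v x) \<le> norm x" and h: "horizontal S \<beta> s"
  obtains \<alpha> k where "\<alpha> $h idx 0 = 0" "k $h idx 0 = 0" "S *v k = k" "s = k + (\<alpha> - S *v \<alpha>)"
proof -
  define V where "V = (\<lambda>x. x - S *v x) ` {x. x $h idx 0 = 0}"
  have "Real_Vector_Spaces.subspace V"
    unfolding V_def
  proof (rule linear_subspace_image)
    show "linear (\<lambda>x. x - S *v x)"
    proof (rule linearI)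
      fix x y and r :: real
      show "x + y - S *v (x + y) = x - S *v x + (y - S *v y)" by (simp add: matrix_vector_right_distrib)
      have *: "r *\<^sub>R z = of_real r *s z" for z :: "complex^'n"
        by (simp add: Finite_Cartesian_Product.vec_eq_iff) (simp add: scaleR_conv_of_real)
      show "r *\<^sub>R x - S *v (r *\<^sub>R x) = r *\<^sub>R (x - S *v x)"
        by (simp only: * matrix_vector_mult_smult vector_ssub_ldistrib)
    qed
    show "Real_Vector_Spaces.subspace {x :: complex^'n. x $h idx 0 = 0}" by (auto simp: Real_Vector_Spaces.subspace_def)
  qed
  hence "span V = V" by (rule span_eq_iff[THEN iffD2])
  then obtain y k where y: "y \<in> V" and k: "\<And>w. w \<in> V \<Longrightarrow> real_inner_class.orthogonal k w" and s: "s = y + k"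
    using orthogonal_subspace_decomp_exists[of V s] by metis
  obtain \<alpha> where \<alpha>: "\<alpha> $h idx 0 = 0" "y = \<alpha> - S *v \<alpha>" using y by (auto simp: V_def)
  have k0: "k $h idx 0 = 0"
  proof -
    have "s $h idx 0 = y $h idx 0 + k $h idx 0" by (simp add: s)
    thus ?thesis using h \<alpha> by (simp add: horizontal_def)
  qed
  have "k - S *v k \<in> V" using k0 by (auto simp: V_def)
  hence "inner k (k - S *v k) = 0" using k by (simp add: real_inner_class.orthogonal_def)
  hence kS: "inner k (S *v k) = (norm k)\<^sup>2" by (simp add: inner_diff_right power2_norm_eq_inner)
  have "(norm (S *v k - k))\<^sup>2 = (norm (S *v k))\<^sup>2 - 2 * inner k (S *v k) + (norm k)\<^sup>2"
    by (simp add: power2_norm_eq_inner inner_diff_left inner_diff_right inner_commute)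
  also have "\<dots> \<le> 0" unfolding kS using power_mono[OF contr[of k] norm_ge_zero, of 2] by simp
  finally have "S *v k = k" by simp
  thus ?thesis using that[of \<alpha> k] \<alpha> k0 s by (simp add: add.commute)
qed

text \<open>The adjoint does not increase the norm of s, while <S^*s,s> = <s,Ss> = |s|^2. Equality
  in Cauchy-Schwarz then gives S^*s = s.\<close>

lemma contraction_fixed_adjoint:
  fixes s :: "complex^'n::finite"
  assumes contr: "\<And>x. norm (S *v x) \<le> norm x" and s: "S *v s = s"
  shows "adj S *v s = s"
proof -
  have "norm (adj S *v s) \<le> norm s"
  proof (rule ccontr)
    assume "\<not> ?thesis"
    hence less: "norm s < norm (adj S *v s)" by simp
    have "(norm (adj S *v s))\<^sup>2 = Re (hprod (S *v (adj S *v s)) s)"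
      by (simp add: hprod_adj hprod_self)
    also have "\<dots> \<le> norm (S *v (adj S *v s)) * norm s" unfolding Re_hprod by (rule norm_cauchy_schwarz)
    also have "\<dots> \<le> norm (adj S *v s) * norm s" by (intro mult_right_mono contr) simp
    finally have "norm (adj S *v s) * norm (adj S *v s) \<le> norm (adj S *v s) * norm s"
      by (simp add: power2_eq_square)
    moreover have "norm (adj S *v s) > 0" using less norm_ge_zero[of s] by linarith
    ultimately show False using less by simp
  qed
  hence "(norm (adj S *v s))\<^sup>2 \<le> (norm s)\<^sup>2" by (intro power_mono) auto
  moreover have "inner (adj S *v s) s = (norm s)\<^sup>2"
    unfolding Re_hprod[symmetric] hprod_adj' s hprod_self by simp
  ultimately have "(norm (adj S *v s - s))\<^sup>2 \<le> 0"
    by (simp add: power2_norm_eq_inner inner_diff_left inner_diff_right inner_commute)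
  thus ?thesis by simp
qed

text \<open>On the Z-part the conjugation gives S(Z + \<alpha>) + s - \<alpha> = SZ + k, so exactly
  the component \<alpha> - S\<alpha> of s disappears. The corrections in z are linear in Z plus a
  constant and are absorbed into \<beta>' and t'.\<close>

lemma heis_conj_siegel_affine:
  fixes s :: "complex^'n::finite"
  assumes h: "horizontal S \<beta> s" and \<alpha>: "\<alpha> $h idx 0 = 0" and s: "s = k + (\<alpha> - S *v \<alpha>)" and k: "k $h idx 0 = 0"
  obtains \<beta>' t' where "horizontal S \<beta>' k"
    "\<And>y. heis (- \<alpha>) (siegel_affine 1 S \<beta> s t (heis \<alpha> y)) = siegel_affine 1 S \<beta>' k t' y"
proof -
  \<comment> \<open>The inner translation contributes 2i<y,\<alpha>>, the outer one
    -2i<Sy,\<alpha>>. The signs appear reversed because \<open>hprod\<close> is conjugate linear in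
    its second argument.\<close>
  define \<beta>' where "\<beta>' = \<beta> + (- 2 * \<i>) *s \<alpha> + (2 * \<i>) *s (adj S *v \<alpha>)"
  define n where "n = \<i> * complex_of_real ((norm \<alpha>)\<^sup>2)"
  define t' where "t' = n + hprod \<alpha> \<beta> + t - 2 * \<i> * hprod (S *v \<alpha> + s) \<alpha> + n"
  have Se0: "S *v e\<^sub>0 = 0" and S0: "\<And>y. (S *v y) $h idx 0 = 0" using h by (auto simp: horizontal_def)
  have "(adj S *v \<alpha>) $h idx 0 = 0"
    using hprod_adj'[of S \<alpha> e\<^sub>0] by (simp add: hprod_axis_right Se0)
  hence "horizontal S \<beta>' k" using h \<alpha> k by (simp add: horizontal_def \<beta>'_def)
  moreover have "heis (- \<alpha>) (siegel_affine 1 S \<beta> s t (heis \<alpha> y)) = siegel_affine 1 S \<beta>' k t' y" for y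
  proof -
    define c where "c = 2 * \<i> * hprod y \<alpha> + n"
    define d where "d = y $h idx 0 + c + (hprod y \<beta> + hprod \<alpha> \<beta>) + t"
    have y1: "heis \<alpha> y = y + \<alpha> + c *s e\<^sub>0" by (simp only: heis_def c_def n_def)
    have Sy1: "S *v heis \<alpha> y = S *v y + S *v \<alpha>"
      by (simp add: y1 matrix_vector_right_distrib matrix_vector_mult_smult Se0)
    have \<beta>y1: "hprod (heis \<alpha> y) \<beta> = hprod y \<beta> + hprod \<alpha> \<beta>"
      using h by (simp add: y1 hprod_add_left hprod_smult_left hprod_axis_left horizontal_def)
    have 0: "heis \<alpha> y $h idx 0 = y $h idx 0 + c" using \<alpha> by (simp add: y1)
    have g: "siegel_affine 1 S \<beta> s t (heis \<alpha> y) = S *v y + (S *v \<alpha> + s) + d *s e\<^sub>0"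
      unfolding siegel_affine_def Sy1 \<beta>y1 0 d_def by (simp add: add.assoc)
    have "hprod (siegel_affine 1 S \<beta> s t (heis \<alpha> y)) \<alpha> = hprod y (adj S *v \<alpha>) + hprod (S *v \<alpha> + s) \<alpha>"
      unfolding g using \<alpha> by (simp only: hprod_add_left hprod_smult_left hprod_axis_left hprod_adj) simp
    hence "2 * \<i> * - hprod (siegel_affine 1 S \<beta> s t (heis \<alpha> y)) \<alpha> + \<i> * complex_of_real ((norm (- \<alpha>))\<^sup>2)
        = - 2 * \<i> * (hprod y (adj S *v \<alpha>) + hprod (S *v \<alpha> + s) \<alpha>) + n"
      by (simp add: n_def ring_distribs)
    hence "heis (- \<alpha>) (siegel_affine 1 S \<beta> s t (heis \<alpha> y)) = S *v y + (S *v \<alpha> + s) + d *s e\<^sub>0 + - \<alpha> +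
        (- 2 * \<i> * (hprod y (adj S *v \<alpha>) + hprod (S *v \<alpha> + s) \<alpha>) + n) *s e\<^sub>0"
      unfolding heis_def[of "- \<alpha>"] hprod_uminus_right by (simp only: g)
    also have "\<dots> = S *v y + k + (d + (- 2 * \<i> * (hprod y (adj S *v \<alpha>) + hprod (S *v \<alpha> + s) \<alpha>) + n)) *s e\<^sub>0"
      using s by (simp add: Finite_Cartesian_Product.vec_eq_iff algebra_simps)
    also have "d + (- 2 * \<i> * (hprod y (adj S *v \<alpha>) + hprod (S *v \<alpha> + s) \<alpha>) + n) = y $h idx 0 + hprod y \<beta>' + t'"
      by (simp add: d_def c_def t'_def \<beta>'_def hprod_add_right hprod_diff_right hprod_smult_right ring_distribs)
    finally show ?thesis by (simp add: siegel_affine_def)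
  qed
  ultimately show ?thesis using that by blast
qed

lemma unitary_conj_siegel_affine:
  fixes s :: "complex^'n::finite"
  assumes h: "horizontal S \<beta> s" and W: "unitary W" "W *v e\<^sub>0 = e\<^sub>0"
  shows "horizontal (adj W ** S ** W) (adj W *v \<beta>) (adj W *v s)"
    and "adj W *v siegel_affine \<rho> S \<beta> s t (W *v y) = siegel_affine \<rho> (adj W ** S ** W) (adj W *v \<beta>) (adj W *v s) t y"
proof -
  note fix0 = unitary_fixing_e0[OF W]
  show "horizontal (adj W ** S ** W) (adj W *v \<beta>) (adj W *v s)"
    using h W(2) by (simp add: horizontal_def fix0 matrix_vector_mul_assoc[symmetric])
  show "adj W *v siegel_affine \<rho> S \<beta> s t (W *v y) = siegel_affine \<rho> (adj W ** S ** W) (adj W *v \<beta>) (adj W *v s) t y"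
    by (simp only: siegel_affine_def matrix_vector_right_distrib matrix_vector_mult_smult fix0 hprod_adj
        matrix_vector_mul_assoc[symmetric])
qed

section \<open>Reduction to the normal form\<close>

text \<open>The summand 0 in the hypothesis is the size of the absent v-block, written out so that
  the general block lemmas apply as they stand.\<close>

lemma sum_blocks:
  fixes f :: "'n::finite \<Rightarrow> 'a::comm_monoid_add"
  assumes N: "1 + p + q + 0 = CARD('n)"
  shows "(\<Sum>k\<in>UNIV. f k) = f (idx 0) + (\<Sum>i<p. f (idx (1 + i))) + (\<Sum>i<q. f (idx (1 + p + i)))"
proof -
  have *: "(\<Sum>i<m + n. g i) = (\<Sum>i<m. g i) + (\<Sum>i<n. g (m + i))" for m n and g :: "nat \<Rightarrow> 'a"
    by (induction n) (simp_all add: add.assoc)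
  have N': "CARD('n) = (1 + p) + q" using N by simp
  show ?thesis unfolding sum_UNIV_idx N' * by simp
qed

text \<open>An eigenvector must be nonzero, and there is no nonzero vector of dimension 0. An absent
  v-block thus satisfies the condition on the spectrum vacuously.\<close>

lemma spectrum_mat_0: "spectrum (0\<^sub>m 0 0 :: complex mat) = {}"
  by (auto simp: spectrum_def eigenvalue_def eigenvector_def)

lemma linear_bounded_below_imp_0:
  fixes n :: complex
  assumes "\<And>\<zeta>. K \<le> Re (\<zeta> * n)"
  shows "n = 0"
proof (rule ccontr)
  assume n: "n \<noteq> 0"
  define x where "x = (\<bar>K\<bar> + 1) / (cmod n)\<^sup>2"
  have "cnj n * n = of_real ((cmod n)\<^sup>2)" by (metis complex_norm_square mult.commute)
  hence "of_real (- x) * cnj n * n = of_real (- x * (cmod n)\<^sup>2)" by (simp only: mult.assoc of_real_mult)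
  hence "Re (of_real (- x) * cnj n * n) = - x * (cmod n)\<^sup>2" by (metis Re_complex_of_real)
  also have "\<dots> = - (\<bar>K\<bar> + 1)" using n by (simp add: x_def)
  finally show False using assms[of "of_real (- x) * cnj n"] by simp
qed

text \<open>The direction of the fixed vector s becomes the u-block, the other horizontal
  coordinates the w-block. On the u-axis the invariance inequality forces the component of \<beta>
  to match s, which is why one vector a can serve both as the translation and in <u,a>. On the
  w-block the same inequality is the hypothesis of \<open>psd_quadratic_bound_imp\<close>, whose
  conclusions are the remaining conditions of the normal form.\<close>

lemma siegel_affine_normal_form:
  fixes s :: "complex^'n::finite" and \<kappa> :: real
  assumes h: "horizontal S \<beta> s" and self: "\<And>y. y \<in> siegel \<Longrightarrow> siegel_affine 1 S \<beta> s t y \<in> siegel"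
    and Ss: "S *v s = s" and N: "1 + p + q + 0 = CARD('n)"
    and s: "p = 0 \<and> s = 0 \<or> p = 1 \<and> s = of_real \<kappa> *s axis (idx 1) 1 \<and> \<kappa> \<noteq> 0"
  obtains b a c D A where "normal_form_data CARD('n) b a c D A"
    "\<And>y. normal_map b a c D A y = siegel_affine 1 S \<beta> s t y"
proof -
  have ineq: "(norm (S *v Z + s))\<^sup>2 \<le> (norm Z)\<^sup>2 + Im (hprod Z \<beta>) + Im t" if "Z $h idx 0 = 0" for Z
    using siegel_affine_inequality[OF h self that] by simp
  have contr: "norm (S *v x) \<le> norm x" for x
    using siegel_affine_norm_le[OF h self, of x] by (simp add: power2_le_iff_abs_le)
  have S0: "(S *v y) $h idx 0 = 0" and Se0: "S *v e\<^sub>0 = 0" and \<beta>0: "\<beta> $h idx 0 = 0" for y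
    using h by (auto simp: horizontal_def)
  have adjs: "adj S *v s = s" by (rule contraction_fixed_adjoint[OF contr Ss])
  have hs: "hprod (S *v y) s = hprod y s" for y unfolding hprod_adj adjs ..
  have p1: "p \<le> 1" using s by auto
  have s1: "\<kappa> \<noteq> 0" "s = of_real \<kappa> *s axis (idx (1 + i)) 1" if "i < p" for i using s that by auto
  have Se: "S *v axis (idx (1 + i)) 1 = axis (idx (1 + i)) 1" if "i < p" for i
  proof -
    have "of_real \<kappa> *s (S *v axis (idx (1 + i)) 1) = of_real \<kappa> *s axis (idx (1 + i)) 1"
      using Ss unfolding s1(2)[OF that] matrix_vector_mult_smult .
    thus ?thesis using s1(1)[OF that] by simp
  qed
  \<comment> \<open>\<open>Se\<close> describes a column and this a row: S and its adjoint both fix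
    the u-axis, so S splits into the identity there and a block on w.\<close>
  have Su: "(S *v y) $h idx (1 + i) = y $h idx (1 + i)" if "i < p" for y i
    using hs[of y] s1(1)[OF that] unfolding s1(2)[OF that] hprod_smult_right hprod_axis_right by simp
  have col: "(S *v axis j 1) $h k = S $h k $h j" for j k
    by (simp add: matrix_vector_mult_def axis_def if_distrib[of "(*) _"] cong: if_cong)
  have idx_ne: "idx (1 + p + j) \<noteq> (idx (1 + i) :: 'n)" if "i < p" "j < q" for i j
    using idx_eq_iff[of "1 + p + j" "1 + i", where 'n = 'n] that N by simp
  have Sw: "(S *v y) $h idx (1 + p + i) = (\<Sum>j<q. S $h idx (1 + p + i) $h idx (1 + p + j) * y $h idx (1 + p + j))"
    if i: "i < q" for y i
  proof -
    have "S $h idx (1 + p + i) $h idx 0 = 0" using Se0 col[of "idx 0" "idx (1 + p + i)"] by simp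
    moreover have "S $h idx (1 + p + i) $h idx (1 + j) = 0" if "j < p" for j
      using col[of "idx (1 + j)" "idx (1 + p + i)"] idx_ne[OF that i] by (simp only: Se[OF that]) (simp add: axis_def)
    ultimately show ?thesis
      unfolding matrix_vector_mult_def by (simp add: sum_blocks[OF N])
  qed
  have \<beta>1: "cnj (\<beta> $h idx (1 + i)) = 2 * \<i> * of_real \<kappa>" if i: "i < p" for i
  proof -
    define m where "m = cnj (\<beta> $h idx (1 + i))"
    have ne: "idx (1 + i) \<noteq> (idx 0 :: 'n)" using idx_eq_iff[of "1 + i" 0, where 'n = 'n] i N by simp
    \<comment> \<open>On the u-axis S is the identity, so |\<zeta>|^2 occurs on both sides and
      cancels. What remains is a real-linear function of \<zeta> that is bounded below, hence zero,
      and this determines \<open>m\<close>.\<close>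
    have "\<kappa>\<^sup>2 - Im t \<le> Re (\<zeta> * (- \<i> * m - 2 * of_real \<kappa>))" for \<zeta>
    proof -
      define Z :: "complex^'n" where "Z = \<zeta> *s axis (idx (1 + i)) 1"
      have "S *v Z + s = (\<zeta> + of_real \<kappa>) *s axis (idx (1 + i)) 1"
        unfolding Z_def matrix_vector_mult_smult Se[OF i] by (subst s1(2)[OF i]) (simp add: vector_sadd_rdistrib)
      hence "(norm (S *v Z + s))\<^sup>2 = (cmod (\<zeta> + of_real \<kappa>))\<^sup>2"
        by (simp only: norm_smult norm_axis_1) simp
      moreover have "hprod Z \<beta> = \<zeta> * m" by (simp add: Z_def hprod_smult_left hprod_axis_left m_def)
      moreover have "(norm Z)\<^sup>2 = (cmod \<zeta>)\<^sup>2" by (simp add: Z_def norm_smult norm_axis_1)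
      moreover have "Z $h idx 0 = 0" using ne by (simp add: Z_def axis_def)
      ultimately have "(cmod (\<zeta> + of_real \<kappa>))\<^sup>2 \<le> (cmod \<zeta>)\<^sup>2 + Im (\<zeta> * m) + Im t" using ineq[of Z] by simp
      thus ?thesis unfolding cmod_power2 by (simp add: power2_eq_square algebra_simps)
    qed
    from linear_bounded_below_imp_0[OF this] have "\<i> * (- \<i> * m - 2 * of_real \<kappa>) = 0" by simp
    thus ?thesis unfolding m_def[symmetric] by (simp add: ring_distribs)
  qed
  define a where "a = Matrix.vec p (\<lambda>_. complex_of_real \<kappa>)"
  \<comment> \<open>Solves <w,\<beta>> = 2i<w,c>: by conjugate linearity \<beta> = -2i c on the
    w-block, that is c = (i/2) \<beta>.\<close>
  define c where "c = Matrix.vec q (\<lambda>i. \<i> / 2 * \<beta> $h idx (1 + p + i))"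
  define A where "A = mat q q (\<lambda>(i, j). S $h idx (1 + p + i) $h idx (1 + p + j))"
  define D where "D = (0\<^sub>m 0 0 :: complex mat)"
  have a: "a \<in> carrier_vec p" and c: "c \<in> carrier_vec q" and D: "D \<in> carrier_mat 0 0" and A: "A \<in> carrier_mat q q"
    by (simp_all add: a_def c_def D_def A_def)
  have c': "2 * \<i> * cnj (c $ i) = cnj (\<beta> $h idx (1 + p + i))" if "i < q" for i
    using that by (simp add: c_def)
  have a': "2 * \<i> * cnj (a $ i) = cnj (\<beta> $h idx (1 + i))" if "i < p" for i
    using that by (simp add: a_def \<beta>1[simplified])
  have hb: "hprod y \<beta> = 2 * \<i> * (\<Sum>i<p. y $h idx (1 + i) * cnj (a $ i)) + 2 * \<i> * (\<Sum>i<q. y $h idx (1 + p + i) * cnj (c $ i))" for y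
  proof -
    have "hprod y \<beta> = (\<Sum>i<p. y $h idx (1 + i) * (2 * \<i> * cnj (a $ i))) + (\<Sum>i<q. y $h idx (1 + p + i) * (2 * \<i> * cnj (c $ i)))"
      unfolding hprod_def sum_blocks[OF N] using \<beta>0 a' c' by simp
    thus ?thesis by (simp add: sum_distrib_left mult_ac)
  qed
  have N0: "1 + p + q + 0 = CARD('n)" by (rule N)
  note nth = normal_map_nth[OF N0 a c D A, unfolded add_0_right]
  have map_eq: "normal_map t a c D A y = siegel_affine 1 S \<beta> s t y" for y
  proof (rule Finite_Cartesian_Product.vec_eq_iff[THEN iffD2, rule_format])
    fix k :: 'n
    show "normal_map t a c D A y $h k = siegel_affine 1 S \<beta> s t y $h k"
    proof (cases rule: idx_cases[OF N0, of k])
      case 1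
      show ?thesis unfolding 1 nth(1) siegel_affine_nth_0[OF h] hb by simp
    next
      case (2 i)
      have ne: "idx (1 + i) \<noteq> (idx 0 :: 'n)" using idx_eq_iff[of "1 + i" 0, where 'n = 'n] 2 N by simp
      have "s $h idx (1 + i) = a $ i" using 2 s1(2)[OF 2(1)] by (simp add: a_def)
      thus ?thesis unfolding 2 nth(2)[OF 2(1)] siegel_affine_def using Su[OF 2(1), of y] ne by (simp add: axis_def)
    next
      case (3 i)
      thus ?thesis by simp
    next
      case (4 i)
      have i: "i < q" by (rule 4(1))
      have k: "k = idx (1 + p + i)" using 4(2) by simp
      have ne: "idx (1 + p + i) \<noteq> (idx 0 :: 'n)" using idx_eq_iff[of "1 + p + i" 0, where 'n = 'n] i N by simp
      have "s $h idx (1 + p + i) = 0" using s idx_ne[OF _ i] by (auto simp: axis_def)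
      hence "siegel_affine 1 S \<beta> s t y $h k = (S *v y) $h idx (1 + p + i)"
        unfolding k siegel_affine_def using ne by (simp add: axis_def)
      also have "\<dots> = (\<Sum>j<q. A $$ (i, j) * y $h idx (1 + p + j))"
        unfolding Sw[OF i] using i by (intro sum.cong refl) (simp add: A_def)
      finally show ?thesis unfolding k nth(4)[OF i] by simp
    qed
  qed
  \<comment> \<open>Embeds the w-block into the hyperplane, padding z and u by zeros. It intertwines
    A with S and preserves the norm.\<close>
  define Zw :: "complex Matrix.vec \<Rightarrow> complex^'n" where
    "Zw w = of_coords (Matrix.vec CARD('n) (\<lambda>m. if m < 1 + p then 0 else w $ (m - (1 + p))))" for w
  have Zw0: "Zw w $h idx 0 = 0" for w by (simp add: Zw_def of_coords_idx)
  have Zw1: "Zw w $h idx (1 + i) = 0" if "i < p" for w i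
    using that N unfolding Zw_def by (subst of_coords_idx) auto
  have Zw2: "Zw w $h idx (1 + p + i) = w $ i" if "i < q" for w i
    using that N unfolding Zw_def by (subst of_coords_idx) auto
  have norm_Zw: "(norm (Zw w))\<^sup>2 = Re (w \<bullet>c w)" if "w \<in> carrier_vec q" for w
    using that Zw0 Zw1 Zw2 by (simp add: norm_sq_sum sum_blocks[OF N] cscalar_prod_self)
  have SZw: "S *v Zw w = Zw (A *\<^sub>v w)" if w: "w \<in> carrier_vec q" for w
  proof (rule Finite_Cartesian_Product.vec_eq_iff[THEN iffD2, rule_format])
    fix k :: 'n
    show "(S *v Zw w) $h k = Zw (A *\<^sub>v w) $h k"
    proof (cases rule: idx_cases[OF N0, of k])
      case 1
      thus ?thesis by (simp add: S0 Zw0)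
    next
      case (2 i)
      thus ?thesis by (simp only: Su Zw1)
    next
      case (3 i)
      thus ?thesis by simp
    next
      case (4 i)
      have i: "i < q" by (rule 4(1))
      have k: "k = idx (1 + p + i)" using 4(2) by simp
      show ?thesis unfolding k Sw[OF i] Zw2[OF i] index_mult_mat_vec_sum[OF A w i]
        using i by (intro sum.cong refl) (simp add: A_def Zw2[simplified])
    qed
  qed
  have Aw: "A *\<^sub>v w \<in> carrier_vec q" if "w \<in> carrier_vec q" for w using A that by (rule mult_mat_vec_carrier)
  have Acontr: "Re ((A *\<^sub>v w) \<bullet>c (A *\<^sub>v w)) \<le> Re (w \<bullet>c w)" if "w \<in> carrier_vec q" for w
    using power_mono[OF contr[of "Zw w"] norm_ge_zero, of 2]
    unfolding SZw[OF that] norm_Zw[OF that] norm_Zw[OF Aw[OF that]] .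
  define Q where "Q = 1\<^sub>m q - mat_adjoint A * A"
  have Q: "Q \<in> carrier_mat q q" unfolding Q_def by (rule minus_carrier_mat, rule mult_carrier_mat[of _ q q]) (use A in simp_all)
  have psd: "hermitian_psd Q" unfolding Q_def by (rule hermitian_psd_defect[OF A Acontr])
  have norm_s: "(norm s)\<^sup>2 = Re (a \<bullet>c a)"
    using s by (auto simp: a_def cscalar_prod_self norm_smult norm_axis_1)
  have nonneg: "0 \<le> Re ((Q *\<^sub>v w) \<bullet>c w) + 2 * Re (w \<bullet>c c) + (Im t - Re (a \<bullet>c a))" if w: "w \<in> carrier_vec q" for w
  proof -
    have "hprod (Zw w) s = 0" using s Zw1[of 0 w] by (auto simp: hprod_smult_right hprod_axis_right)
    hence "(norm (S *v Zw w + s))\<^sup>2 = Re ((A *\<^sub>v w) \<bullet>c (A *\<^sub>v w)) + Re (a \<bullet>c a)"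
      unfolding norm_add_sq hs norm_s by (simp add: SZw[OF w] norm_Zw[OF Aw[OF w]])
    moreover have "hprod (Zw w) \<beta> = 2 * \<i> * (w \<bullet>c c)"
    proof -
      have "(\<Sum>i<p. Zw w $h idx (1 + i) * cnj (a $ i)) = 0" by (rule sum.neutral) (use Zw1 in simp)
      moreover have "(\<Sum>i<q. Zw w $h idx (1 + p + i) * cnj (c $ i)) = w \<bullet>c c"
        unfolding cscalar_prod_sum using c by (intro sum.cong) (use Zw2 in auto)
      ultimately show ?thesis unfolding hb by (simp only:) simp
    qed
    ultimately show ?thesis
      using ineq[OF Zw0, of w] defect_form[OF A w] by (simp add: norm_Zw[OF w] Q_def)
  qed
  note bound = psd_quadratic_bound_imp[OF Q psd c nonneg]
  have "normal_form_data CARD('n) t a c D A"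
    unfolding normal_form_data_def
  proof (intro exI conjI)
    show "1 + p + q + 0 = CARD('n)" by (rule N)
    show "diagonal_mat D" by (simp add: D_def diagonal_mat_def)
    show "spectrum D \<subseteq> sphere 0 1 - {1}" by (simp add: D_def spectrum_mat_0)
    show "let Q = 1\<^sub>m q - mat_adjoint A * A in hermitian_psd Q \<and> pinv_form Q c \<le> Im t - Re (a \<bullet>c a) \<and>
        Q * pseudo_inverse Q *\<^sub>v c = c"
      using psd bound unfolding Let_def Q_def by blast
  qed (fact a c D A)+
  thus ?thesis using that map_eq by blast
qed

text \<open>W is a unitary with \<open>e\<^sub>0\<close> and k/|k| as its first two columns,
  possible since k is orthogonal to \<open>e\<^sub>0\<close>. A nonzero k with vanishing first
  coordinate also forces N \<ge> 2. For k = 0 there is no u-block.\<close>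

lemma ex_rotation_to_axis:
  fixes k :: "complex^'n::finite"
  assumes k0: "k $h idx 0 = 0"
  obtains W p \<kappa> where "unitary W" "W *v e\<^sub>0 = e\<^sub>0" "1 + p \<le> CARD('n)"
    "p = 0 \<and> adj W *v k = 0 \<or> p = 1 \<and> adj W *v k = of_real \<kappa> *s axis (idx 1) 1 \<and> \<kappa> \<noteq> 0"
proof (cases "k = 0")
  case True
  have "hprod e\<^sub>0 (e\<^sub>0 :: complex^'n) = 1" by (simp add: hprod_axis_right)
  then obtain W where "unitary W" "\<And>i. i < 1 \<Longrightarrow> W *v axis (idx i) 1 = (e\<^sub>0 :: complex^'n)"
    using unitary_extension[of 1 "\<lambda>_. e\<^sub>0 :: complex^'n"] by auto
  thus ?thesis using True by (intro that[of W 0 0]) auto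
next
  case False
  define f where "f i = (if i = 0 then e\<^sub>0 else of_real (inverse (norm k)) *s k)" for i :: nat
  have card: "2 \<le> CARD('n)"
  proof (rule ccontr)
    assume "\<not> ?thesis"
    moreover have "0 < CARD('n)" by simp
    ultimately have "CARD('n) = 1" by linarith
    hence "k = 0" using k0 by (intro vec_eq_idxI) simp
    thus False using False by simp
  qed
  have "hprod e\<^sub>0 k = 0" "hprod k e\<^sub>0 = 0" using k0 by (simp_all add: hprod_axis_right hprod_axis_left)
  moreover have "hprod k k / (of_real (norm k) * of_real (norm k)) = 1"
    using False by (simp add: hprod_self power2_eq_square)
  ultimately have "hprod (f i) (f j) = (if i = j then 1 else 0)" if "i < 2" "j < 2" for i j
    using that False
    by (auto simp: f_def less_2_cases_iff hprod_smult_left hprod_smult_right hprod_axis_right hprod_axis_left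
        divide_inverse mult_ac)
  then obtain W where W: "unitary W" "\<And>i. i < 2 \<Longrightarrow> W *v axis (idx i) 1 = f i"
    using unitary_extension[of 2 f] card by blast
  have "W *v axis (idx 1) 1 = of_real (inverse (norm k)) *s k" using W(2)[of 1] by (simp add: f_def)
  hence "of_real (norm k) *s (W *v axis (idx 1) 1) = k" using False by (simp add: vector_smult_assoc)
  hence "adj W *v k = of_real (norm k) *s (adj W *v (W *v axis (idx 1) 1))"
    by (metis matrix_vector_mult_smult)
  also have "adj W *v (W *v axis (idx 1) 1) = axis (idx 1) 1" using W(1) by (simp add: unitary_def)
  finally show ?thesis using W(1) W(2)[of 0] card False by (intro that[of W 1 "norm k"]) (auto simp: f_def)
qed

lemma parabolic_normal_form:
  fixes \<phi> :: "complex^'n::finite \<Rightarrow> complex^'n"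
  assumes LFM: "\<phi> \<in> LFM_ball" and par: "parabolic \<phi>"
  shows "\<exists>b a c D A. normal_form_data CARD('n) b a c D A \<and>
    conjugated unit_ball \<phi> (siegel :: (complex^'n) set) (normal_map b a c D A)"
proof -
  obtain w where dw: "denjoy_wolff_point \<phi> w" and dil: "boundary_dilation \<phi> w = 1"
    and hol: "holomorphic_self_map unit_ball \<phi>"
    using par unfolding parabolic_def by blast
  have self: "\<phi> z \<in> unit_ball" if "z \<in> unit_ball" for z
    using hol that unfolding holomorphic_self_map_def by blast
  have w: "norm w = 1" using dw by (simp add: denjoy_wolff_point_def)
  have "hprod w w = 1" by (simp add: hprod_self w)
  then obtain P where P: "unitary P" "P *v e\<^sub>0 = w"
    using unitary_extension[of 1 "\<lambda>_. w"] by auto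
  have adjP: "adj P *v (P *v z) = z" "P *v (adj P *v z) = z" for z using P(1) by (simp_all add: unitary_def)
  have Pball: "P *v z \<in> unit_ball \<longleftrightarrow> z \<in> unit_ball" "adj P *v z \<in> unit_ball \<longleftrightarrow> z \<in> unit_ball" for z
    using unitary_norm[OF P(1)] by simp_all
  \<comment> \<open>Locally uniform convergence of the iterates enters only through this orbit of 0,
    which supplies both the boundary value in \<open>LFM_affine\<close> and the contradiction for
    \<rho> < 1.\<close>
  define x where "x n = (\<phi> ^^ n) 0" for n
  have xb: "x n \<in> unit_ball" for n by (induction n) (simp_all add: x_def self[simplified])
  have xSuc: "\<phi> (x n) = x (Suc n)" for n by (simp add: x_def)
  have x: "x \<longlonglongrightarrow> w"
  proof -
    have "(0 :: complex^'n) \<in> unit_ball" by simp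
    then obtain e where e: "e > 0" "uniform_limit (ball 0 e \<inter> unit_ball) (\<lambda>n. \<phi> ^^ n) (\<lambda>_. w) sequentially"
      using dw unfolding denjoy_wolff_point_def by blast
    from tendsto_uniform_limitI[OF e(2), of 0] show ?thesis using e(1) by (simp add: x_def[abs_def])
  qed
  have x': "(\<lambda>n. \<phi> (x n)) \<longlonglongrightarrow> w" unfolding xSuc by (rule LIMSEQ_Suc[OF x])
  define g where "g y = cayley (adj P *v \<phi> (P *v cayley_inv y))" for y
  have gs: "g y \<in> siegel" if "y \<in> siegel" for y
    unfolding g_def by (intro cayley_siegel) (use self cayley_inv_ball[OF that] Pball in blast)
  obtain m where "\<And>k. affine_fun (m k)" "\<And>y k. y \<in> siegel \<Longrightarrow> g y $h k = m k y"
    using LFM_affine[OF LFM P xb x x'] unfolding g_def by metis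
  then obtain \<rho> S \<beta> s t where \<rho>: "\<rho> \<ge> 0" and h: "horizontal S \<beta> s"
    and g: "\<And>y. y \<in> siegel \<Longrightarrow> g y = siegel_affine \<rho> S \<beta> s t y"
    using affine_siegel_self_map[of m g] gs by metis
  have sa: "siegel_affine \<rho> S \<beta> s t y \<in> siegel" if "y \<in> siegel" for y using g gs that by metis
  have "\<not> \<rho> < 1"
  proof
    assume "\<rho> < 1"
    define y where "y n = cayley (adj P *v x n)" for n
    have ys: "y n \<in> siegel" for n unfolding y_def by (rule cayley_siegel) (use xb Pball in blast)
    have yx: "cayley_inv (y n) = adj P *v x n" for n
      unfolding y_def by (rule cayley_inv_cayley, rule unit_ball_nth_neq_1) (use xb Pball in blast)
    have "y (Suc n) = siegel_affine \<rho> S \<beta> s t (y n)" for n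
      unfolding g[OF ys, symmetric] g_def yx adjP xSuc by (simp add: y_def)
    then obtain R where R: "\<And>n. cmod (y n $h idx 0) \<le> R"
      using siegel_affine_orbit_bounded[OF h sa \<rho> \<open>\<rho> < 1\<close>] by metis
    have R0: "0 \<le> R" using R[of 0] norm_ge_zero order_trans by blast
    have "(\<lambda>n. hprod (x n) (P *v e\<^sub>0)) \<longlonglongrightarrow> hprod w (P *v e\<^sub>0)"
      unfolding hprod_def by (intro tendsto_intros tendsto_vec_nth x)
    hence "(\<lambda>n. (adj P *v x n) $h idx 0) \<longlonglongrightarrow> 1"
      unfolding hprod_adj'[symmetric] using P adjP(1)[of e\<^sub>0] by (simp add: hprod_axis_right)
    hence "(\<lambda>n. cmod (1 - (adj P *v x n) $h idx 0)) \<longlonglongrightarrow> cmod (1 - 1)" by (intro tendsto_intros)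
    \<comment> \<open>The Cayley transform sends \<open>e\<^sub>0\<close> to infinity: by 1 - x_0 =
      2i/(y_0 + i), a bounded y_0 keeps the orbit at a fixed distance from the point to which it
      converges.\<close>
    moreover have "2 / (R + 1) \<le> cmod (1 - (adj P *v x n) $h idx 0)" for n
    proof -
      have "cmod (y n $h idx 0 + \<i>) \<le> R + 1" using norm_triangle_ineq[of "y n $h idx 0" \<i>] R[of n] by simp
      moreover have "cmod (y n $h idx 0 + \<i>) > 0" using siegel_neq_minus_i[OF ys] by simp
      ultimately have "2 / (R + 1) \<le> 2 / cmod (y n $h idx 0 + \<i>)" using R0 by (intro divide_left_mono) auto
      also have "\<dots> = cmod (1 - cayley_inv (y n) $h idx 0)"
        unfolding one_minus_cayley_inv[OF ys] by (simp add: norm_divide norm_mult)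
      finally show ?thesis by (simp only: yx)
    qed
    ultimately have "2 / (R + 1) \<le> cmod (1 - 1)"
      by (intro tendsto_lowerbound[of _ _ sequentially]) auto
    thus False using R0 by simp
  qed
  moreover have "\<rho> \<le> 1" using dilation_bound[OF self dil P h] g unfolding g_def by blast
  ultimately have "\<rho> = 1" by simp
  note g = g[unfolded \<open>\<rho> = 1\<close>] and sa = sa[unfolded \<open>\<rho> = 1\<close>]
  have contr: "norm (S *v x) \<le> norm x" for x
    using siegel_affine_norm_le[OF h sa, of x] by (simp add: power2_le_iff_abs_le)
  obtain \<alpha> k where \<alpha>: "\<alpha> $h idx 0 = 0" and k: "k $h idx 0 = 0" "S *v k = k" and s: "s = k + (\<alpha> - S *v \<alpha>)"
    using contraction_range_decomposition[OF contr h] by metis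
  have \<alpha>': "(- \<alpha>) $h idx 0 = 0" using \<alpha> by simp
  obtain \<beta>' t' where h': "horizontal S \<beta>' k"
    and g': "\<And>y. heis (- \<alpha>) (siegel_affine 1 S \<beta> s t (heis \<alpha> y)) = siegel_affine 1 S \<beta>' k t' y"
    using heis_conj_siegel_affine[OF h \<alpha> s k(1)] by metis
  obtain W p \<kappa> where W: "unitary W" "W *v e\<^sub>0 = e\<^sub>0" and p: "1 + p \<le> CARD('n)"
    "p = 0 \<and> adj W *v k = 0 \<or> p = 1 \<and> adj W *v k = of_real \<kappa> *s axis (idx 1) 1 \<and> \<kappa> \<noteq> 0"
    using ex_rotation_to_axis[OF k(1)] by metis
  have adjW: "adj W *v (W *v z) = z" "W *v (adj W *v z) = z" for z using W(1) by (simp_all add: unitary_def)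
  \<comment> \<open>Read from the right: rotate w to \<open>e\<^sub>0\<close>, pass to the
    half-plane, translate away the range part of s, rotate the fixed part to a coordinate axis.
    \<open>f'\<close> undoes these in reverse order.\<close>
  define f where "f = ((*v) (adj W)) \<circ> (heis (- \<alpha>) \<circ> (cayley \<circ> (*v) (adj P)))"
  define f' where "f' = ((*v) P) \<circ> (cayley_inv \<circ> (heis \<alpha> \<circ> (*v) W))"
  have heis_siegel: "heis \<alpha> y \<in> siegel \<longleftrightarrow> y \<in> siegel" "heis (- \<alpha>) y \<in> siegel \<longleftrightarrow> y \<in> siegel" for y
    by (simp_all add: siegel_iff_height height_heis \<alpha> \<alpha>')
  have W_siegel: "W *v y \<in> siegel \<longleftrightarrow> y \<in> siegel" "adj W *v y \<in> siegel \<longleftrightarrow> y \<in> siegel" for y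
    by (simp_all add: siegel_iff_height unitary_fixing_e0[OF W])
  have heis_inv: "heis (- \<alpha>) (heis \<alpha> y) = y" "heis \<alpha> (heis (- \<alpha>) y) = y" for y
    using heis_inverse[OF \<alpha>] heis_inverse[OF \<alpha>'] by simp_all
  define S' where "S' = adj W ** S ** W"
  have h'': "horizontal S' (adj W *v \<beta>') (adj W *v k)"
    and g'': "\<And>y. adj W *v siegel_affine 1 S \<beta>' k t' (W *v y) = siegel_affine 1 S' (adj W *v \<beta>') (adj W *v k) t' y"
    using unitary_conj_siegel_affine[OF h' W] by (simp_all add: S'_def)
  have \<psi>: "f (\<phi> (f' y)) = siegel_affine 1 S' (adj W *v \<beta>') (adj W *v k) t' y" if y: "y \<in> siegel" for y
  proof -
    have "heis \<alpha> (W *v y) \<in> siegel" using y heis_siegel W_siegel by blast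
    from g[OF this] show ?thesis unfolding f_def f'_def o_apply g_def by (simp only: g' g'')
  qed
  have f: "f z \<in> siegel" if "z \<in> unit_ball" for z
    unfolding f_def o_apply W_siegel heis_siegel by (rule cayley_siegel) (use that Pball in blast)
  have f': "f' y \<in> unit_ball" if "y \<in> siegel" for y
    unfolding f'_def o_apply Pball by (rule cayley_inv_ball) (use that heis_siegel W_siegel in blast)
  have self'': "siegel_affine 1 S' (adj W *v \<beta>') (adj W *v k) t' y \<in> siegel" if y: "y \<in> siegel" for y
    using f[OF self[OF f'[OF y]]] \<psi>[OF y] by simp
  have "S' *v (adj W *v k) = adj W *v k"
    by (simp only: S'_def matrix_vector_mul_assoc[symmetric] adjW k(2))
  moreover have "1 + p + (CARD('n) - (1 + p)) + 0 = CARD('n)" using p(1) by simp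
  ultimately obtain b a c D A where data: "normal_form_data CARD('n) b a c D A"
    and map: "\<And>y. normal_map b a c D A y = siegel_affine 1 S' (adj W *v \<beta>') (adj W *v k) t' y"
    using siegel_affine_normal_form[OF h'' self'' _ _ p(2)] by metis
  have "conjugated unit_ball \<phi> (siegel :: (complex^'n) set) (normal_map b a c D A)"
  proof (rule conjugatedI[of unit_ball f siegel f'])
    show "holomorphic_map unit_ball f"
      unfolding f_def
      by (intro holomorphic_map_compose[OF _ holomorphic_matrix[of UNIV]] holomorphic_map_compose[OF _ holomorphic_heis[of UNIV]]
          holomorphic_map_compose[OF holomorphic_matrix holomorphic_cayley]) (use Pball in blast)+
    show "holomorphic_map siegel f'"
      unfolding f'_def
      by (intro holomorphic_map_compose[OF _ holomorphic_matrix[of UNIV]] holomorphic_map_compose[OF _ holomorphic_cayley_inv]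
          holomorphic_map_compose[OF holomorphic_matrix holomorphic_heis[of UNIV]])
        (use W_siegel heis_siegel in auto)
    show "f' (f z) = z" if "z \<in> unit_ball" for z
    proof -
      have "adj P *v z \<in> unit_ball" using that Pball by blast
      from cayley_inv_cayley[OF unit_ball_nth_neq_1[OF this]] show ?thesis
        unfolding f_def f'_def o_apply by (simp only: adjW heis_inv adjP)
    qed
    show "f (f' y) = y" if "y \<in> siegel" for y
    proof -
      have "heis \<alpha> (W *v y) \<in> siegel" using that heis_siegel W_siegel by blast
      from cayley_cayley_inv[OF this] show ?thesis
        unfolding f_def f'_def o_apply by (simp only: adjP heis_inv adjW)
    qed
    show "normal_map b a c D A y = f (\<phi> (f' y))" if "y \<in> siegel" for y using map \<psi>[OF that] by simp
  qed (use f f' hol open_siegel in auto)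
  thus ?thesis using data by blast
qed

theorem theorem4p3:
  fixes \<phi> :: "complex^'n \<Rightarrow> complex^'n"
  assumes "\<phi> \<in> LFM_ball" and "parabolic \<phi>"
  shows
    "(\<exists>b a c D A. normal_form_data CARD('n) b a c D A \<and>
        conjugated unit_ball \<phi> (siegel :: (complex^'n) set) (normal_map b a c D A)) \<and>
     (\<forall>b a c D A M.
        normal_form_data CARD('n) b a c D A \<and>
        conjugated unit_ball \<phi> (siegel :: (complex^'n) set) (normal_map b a c D A) \<and>
        0 \<notin> spectrum A \<and> invertible_mat (1\<^sub>m (dim_row A) - mat_adjoint A) \<and>
        M \<in> carrier_mat (dim_row A) (dim_row A) \<and> mat_exp M = A \<and>
        dissipative M \<and>
        (\<forall>t\<ge>0. t * (Im b - Re (a \<bullet>c a)) \<ge> pinv_form (Q_at M t) (c_at M c t)) \<and>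
        (\<forall>t\<ge>0. Q_at M t * pseudo_inverse (Q_at M t) *\<^sub>v c_at M c t = c_at M c t)
        \<longrightarrow> embeddable_into_semigroup (siegel :: (complex^'n) set) (normal_map b a c D A))"
proof (intro conjI allI impI)
  show "\<exists>b a c D A. normal_form_data CARD('n) b a c D A \<and>
      conjugated unit_ball \<phi> (siegel :: (complex^'n) set) (normal_map b a c D A)"
    by (rule parabolic_normal_form[OF assms])
next
  fix b a c D A M
  assume "normal_form_data CARD('n) b a c D A \<and>
        conjugated unit_ball \<phi> (siegel :: (complex^'n) set) (normal_map b a c D A) \<and>
        0 \<notin> spectrum A \<and> invertible_mat (1\<^sub>m (dim_row A) - mat_adjoint A) \<and>
        M \<in> carrier_mat (dim_row A) (dim_row A) \<and> mat_exp M = A \<and>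
        dissipative M \<and>
        (\<forall>t\<ge>0. t * (Im b - Re (a \<bullet>c a)) \<ge> pinv_form (Q_at M t) (c_at M c t)) \<and>
        (\<forall>t\<ge>0. Q_at M t * pseudo_inverse (Q_at M t) *\<^sub>v c_at M c t = c_at M c t)"
  thus "embeddable_into_semigroup (siegel :: (complex^'n) set) (normal_map b a c D A)"
    by (intro embeddable_normal_map[where M = M]) blast+
qed

end
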